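(* An MV-algebra $A$ is strongly semisimple if and only if $A\cong\mathscr{M}(X)$ for a closed set $X\subseteq[0,1]^A$ such that, whenever $C\subseteq A$ is finite, the set $\pi^A_C(X)\subseteq[0,1]^C$ does not have rationally outgoing $k$-tangents for any $k$.
   Context: An MV-algebra is an abelian monoid $(A,\oplus,0)$ with a unary operation $\neg$ such that $\neg\neg x=x$, $x\oplus\neg 0=\neg 0$, and $x\oplus\neg(x\oplus\neg y)=y\oplus\neg(y\oplus\neg x)$. The standard MV-algebra is $[0,1]$ with $x\oplus y=\min\{x+y,1\}$, $\neg x=1-x$. An MV-algebra is semisimple if it is a subdirect product of simple MV-algebras, equivalently if it belongs to $\mathbb{ISP}([0,1])$; it is strongly semisimple if all its quotients by principal ideals are semisimple. $\mathscr{F}(I)$ is the free MV-algebra on $I$; for $p\in[0,1]^I$, $\bar p\colon\mathscr{F}(I)\to[0,1]$ is the unique homomorphism extending $p$. For closed $X\subseteq[0,1]^I$, $\mathscr{M}(X)$ is the MV-algebra (with pointwise operations, a subalgebra of $[0,1]^X$) of all definable maps $X\to[0,1]$, i.e. all maps of the form $p\mapsto\bar p(t)$ with $t\in\mathscr{F}(I)$. For $C\subseteq A$, $\pi^A_C\colon[0,1]^A\to[0,1]^C$ is the projection. $k$-tangents: for a $k$-tuple $u=(u_1,\dots,u_k)$ ($k\ge1$) of pairwise orthogonal unit vectors in $\mathbb{R}^n$ and $l\le k$, let $\mathsf p_l$ be the orthogonal projection of $\mathbb{R}^n$ onto $\mathbb{R}u_1+\dots+\mathbb{R}u_l$. For closed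 $X\subseteq[0,1]^n$, $u$ is a (Bouligand–Severi) $k$-tangent of $X$ at $x$ if $X$ contains a sequence $x_1,x_2,\dots$ such that: (1) $\lim_i x_i=x$; (2) no vector $x_i-x$ lies in $\mathbb{R}u_1+\dots+\mathbb{R}u_k$; (3) putting $x_i^1=(x_i-x)/\|x_i-x\|$ and $x_i^l=\frac{x_i-x-\mathsf p_{l-1}(x_i-x)}{\|x_i-x-\mathsf p_{l-1}(x_i-x)\|}$ for $2\le l\le k$, one has $\lim_i x_i^s=u_s$ for each $s\in\{1,\dots,k\}$. A $k$-tangent $u$ of $X$ at $x$ is rationally outgoing if there are a rational simplex $S\subseteq\mathbb{R}^n$ (convex hull of affinely independent points with rational coordinates), a face $F\subseteq S$, and $(\lambda_1,\dots,\lambda_k)\in(\mathbb{R}_{>0})^k$ such that, with $T=\mathrm{conv}(x,x+\lambda_1u_1,\dots,x+\lambda_1u_1+\dots+\lambda_ku_k)$: (1) $S\supseteq T$; (2) $F\not\supseteq T$; (3) $F\cap X=S\cap X$. *)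

theory Defs
  imports "HOL-Analysis.Analysis" "HOL-Algebra.Group" "HOL-Library.Function_Algebras"
begin

section \<open>MV-algebras\<close>

record 'a mv = "'a partial_object" +
  oplus :: "'a \<Rightarrow> 'a \<Rightarrow> 'a"
  zero :: 'a
  neg :: "'a \<Rightarrow> 'a"

locale mv_algebra =
  fixes A :: "'a mv"
  assumes comm_monoid: "comm_monoid \<lparr>carrier = carrier A, mult = oplus A, one = zero A\<rparr>"
    and neg_closed: "x \<in> carrier A \<Longrightarrow> neg A x \<in> carrier A"
    and neg_neg: "x \<in> carrier A \<Longrightarrow> neg A (neg A x) = x"
    and oplus_top: "x \<in> carrier A \<Longrightarrow> oplus A x (neg A (zero A)) = neg A (zero A)"
    and lukasiewicz: "x \<in> carrier A \<Longrightarrow> y \<in> carrier A \<Longrightarrow>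
      oplus A x (neg A (oplus A x (neg A y))) = oplus A y (neg A (oplus A y (neg A x)))"

lemma mv_algebraI:
  assumes "\<And>x y. x \<in> carrier A \<Longrightarrow> y \<in> carrier A \<Longrightarrow> oplus A x y \<in> carrier A"
    and "zero A \<in> carrier A"
    and "\<And>x. x \<in> carrier A \<Longrightarrow> neg A x \<in> carrier A"
    and "\<And>x y z. x \<in> carrier A \<Longrightarrow> y \<in> carrier A \<Longrightarrow> z \<in> carrier A \<Longrightarrow>
           oplus A (oplus A x y) z = oplus A x (oplus A y z)"
    and "\<And>x y. x \<in> carrier A \<Longrightarrow> y \<in> carrier A \<Longrightarrow> oplus A x y = oplus A y x"
    and "\<And>x. x \<in> carrier A \<Longrightarrow> oplus A x (zero A) = x"
    and "\<And>x. x \<in> carrier A \<Longrightarrow> neg A (neg A x) = x"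
    and "\<And>x. x \<in> carrier A \<Longrightarrow> oplus A x (neg A (zero A)) = neg A (zero A)"
    and "\<And>x y. x \<in> carrier A \<Longrightarrow> y \<in> carrier A \<Longrightarrow>
      oplus A x (neg A (oplus A x (neg A y))) = oplus A y (neg A (oplus A y (neg A x)))"
  shows "mv_algebra A"
proof (rule mv_algebra.intro)
  have "oplus A (zero A) x = x" if "x \<in> carrier A" for x
    using assms that by metis
  then show "comm_monoid \<lparr>carrier = carrier A, mult = oplus A, one = zero A\<rparr>"
    by (intro comm_monoidI) (simp_all add: assms(1-4), rule assms(5))
qed (use assms in simp_all)

context mv_algebra
begin

lemma oplus_closed: "x \<in> carrier A \<Longrightarrow> y \<in> carrier A \<Longrightarrow> oplus A x y \<in> carrier A"
  using monoid.m_closed[OF comm_monoid.axioms(1)[OF comm_monoid]] by simp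

lemma zero_closed: "zero A \<in> carrier A"
  using monoid.one_closed[OF comm_monoid.axioms(1)[OF comm_monoid]] by simp

lemma oplus_assoc: "x \<in> carrier A \<Longrightarrow> y \<in> carrier A \<Longrightarrow> z \<in> carrier A \<Longrightarrow>
    oplus A (oplus A x y) z = oplus A x (oplus A y z)"
  using monoid.m_assoc[OF comm_monoid.axioms(1)[OF comm_monoid]] by simp

lemma oplus_commute: "x \<in> carrier A \<Longrightarrow> y \<in> carrier A \<Longrightarrow> oplus A x y = oplus A y x"
  using comm_monoid.m_comm[OF comm_monoid] by simp

lemma oplus_zero: "x \<in> carrier A \<Longrightarrow> oplus A x (zero A) = x"
  using monoid.r_one[OF comm_monoid.axioms(1)[OF comm_monoid]] by simp

end

definition std_mv :: "real mv" where
  "std_mv = \<lparr>carrier = {0..1}, oplus = (\<lambda>x y. min (x + y) 1), zero = 0, neg = (\<lambda>x. 1 - x)\<rparr>"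

lemma mv_algebra_std_mv: "mv_algebra std_mv"
  by (rule mv_algebraI) (auto simp: std_mv_def min_def)

definition mv_hom :: "'a mv \<Rightarrow> 'b mv \<Rightarrow> ('a \<Rightarrow> 'b) set" where
  "mv_hom A B = {h \<in> carrier A \<rightarrow> carrier B.
     h (zero A) = zero B \<and>
     (\<forall>x\<in>carrier A. h (neg A x) = neg B (h x)) \<and>
     (\<forall>x\<in>carrier A. \<forall>y\<in>carrier A. h (oplus A x y) = oplus B (h x) (h y))}"

definition mv_iso :: "'a mv \<Rightarrow> 'b mv \<Rightarrow> bool" where
  "mv_iso A B \<longleftrightarrow> (\<exists>h\<in>mv_hom A B. bij_betw h (carrier A) (carrier B))"

definition mv_prod :: "'i set \<Rightarrow> ('i \<Rightarrow> 'b mv) \<Rightarrow> ('i \<Rightarrow> 'b) mv" where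
  "mv_prod I B = \<lparr>carrier = (\<Pi>\<^sub>E i\<in>I. carrier (B i)),
     oplus = (\<lambda>f g. \<lambda>i\<in>I. oplus (B i) (f i) (g i)),
     zero = (\<lambda>i\<in>I. zero (B i)),
     neg = (\<lambda>f. \<lambda>i\<in>I. neg (B i) (f i))\<rparr>"


section \<open>Congruences, ideals and quotients\<close>

definition mv_congruence :: "'a mv \<Rightarrow> ('a \<times> 'a) set \<Rightarrow> bool" where
  "mv_congruence A r \<longleftrightarrow> equiv (carrier A) r \<and>
     (\<forall>(x, y)\<in>r. (neg A x, neg A y) \<in> r) \<and>
     (\<forall>(x, x')\<in>r. \<forall>(y, y')\<in>r. (oplus A x y, oplus A x' y') \<in> r)"

text \<open>If \<open>r\<close> is a congruence, the unions below are unions of equal classes; see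
  \<open>mv_quot_simps\<close>.\<close>

definition mv_quot :: "'a mv \<Rightarrow> ('a \<times> 'a) set \<Rightarrow> 'a set mv" where
  "mv_quot A r = \<lparr>carrier = carrier A // r,
     oplus = (\<lambda>X Y. \<Union>x\<in>X. \<Union>y\<in>Y. r `` {oplus A x y}),
     zero = r `` {zero A},
     neg = (\<lambda>X. \<Union>x\<in>X. r `` {neg A x})\<rparr>"

lemma mv_quot_simps:
  assumes "mv_congruence A r"
  shows "x \<in> carrier A \<Longrightarrow> neg (mv_quot A r) (r `` {x}) = r `` {neg A x}"
    and "x \<in> carrier A \<Longrightarrow> y \<in> carrier A \<Longrightarrow>
           oplus (mv_quot A r) (r `` {x}) (r `` {y}) = r `` {oplus A x y}"
proof -
  have eq: "equiv (carrier A) r"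
    and n: "\<And>x y. (x, y) \<in> r \<Longrightarrow> (neg A x, neg A y) \<in> r"
    and p: "\<And>x x' y y'. (x, x') \<in> r \<Longrightarrow> (y, y') \<in> r \<Longrightarrow> (oplus A x y, oplus A x' y') \<in> r"
    using assms unfolding mv_congruence_def by blast+
  show "neg (mv_quot A r) (r `` {x}) = r `` {neg A x}" if "x \<in> carrier A"
  proof -
    have "(\<lambda>x. r `` {neg A x}) respects r"
      by (auto simp: congruent_def intro!: equiv_class_eq[OF eq] n)
    then show ?thesis using UN_equiv_class[OF eq _ that] by (simp add: mv_quot_def)
  qed
  show "oplus (mv_quot A r) (r `` {x}) (r `` {y}) = r `` {oplus A x y}"
    if "x \<in> carrier A" "y \<in> carrier A"
  proof -
    have "(\<lambda>x y. r `` {oplus A x y}) respects2 r"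
      by (auto simp: congruent2_def intro!: equiv_class_eq[OF eq] p)
    then show ?thesis using UN_equiv_class2[OF eq eq _ that] by (simp add: mv_quot_def)
  qed
qed

definition mv_le :: "'a mv \<Rightarrow> 'a \<Rightarrow> 'a \<Rightarrow> bool" where
  "mv_le A x y \<longleftrightarrow> oplus A (neg A x) y = neg A (zero A)"

definition mv_minus :: "'a mv \<Rightarrow> 'a \<Rightarrow> 'a \<Rightarrow> 'a" where
  "mv_minus A x y = neg A (oplus A (neg A x) y)"

definition mv_ideal :: "'a mv \<Rightarrow> 'a set \<Rightarrow> bool" where
  "mv_ideal A J \<longleftrightarrow> J \<subseteq> carrier A \<and> zero A \<in> J \<and>
     (\<forall>x\<in>J. \<forall>y\<in>J. oplus A x y \<in> J) \<and>
     (\<forall>x\<in>carrier A. \<forall>y\<in>J. mv_le A x y \<longrightarrow> x \<in> J)"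

definition principal_ideal :: "'a mv \<Rightarrow> 'a \<Rightarrow> 'a set" where
  "principal_ideal A a = \<Inter>{J. mv_ideal A J \<and> a \<in> J}"

text \<open>The congruence of an ideal is given by Chang's distance function.\<close>

definition ideal_cong :: "'a mv \<Rightarrow> 'a set \<Rightarrow> ('a \<times> 'a) set" where
  "ideal_cong A J = {(x, y). x \<in> carrier A \<and> y \<in> carrier A \<and>
     oplus A (mv_minus A x y) (mv_minus A y x) \<in> J}"

definition mv_quot_ideal :: "'a mv \<Rightarrow> 'a set \<Rightarrow> 'a set mv" where
  "mv_quot_ideal A J = mv_quot A (ideal_cong A J)"


section \<open>Semisimplicity\<close>

definition simple_mv :: "'a mv \<Rightarrow> bool" where
  "simple_mv A \<longleftrightarrow> mv_algebra A \<and> carrier A \<noteq> {zero A} \<and>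
     (\<forall>J. mv_ideal A J \<longrightarrow> J = {zero A} \<or> J = carrier A)"

definition subdirect_embedding ::
    "'a mv \<Rightarrow> 'i set \<Rightarrow> ('i \<Rightarrow> 'b mv) \<Rightarrow> ('a \<Rightarrow> 'i \<Rightarrow> 'b) \<Rightarrow> bool" where
  "subdirect_embedding A I B h \<longleftrightarrow> h \<in> mv_hom A (mv_prod I B) \<and> inj_on h (carrier A) \<and>
     (\<forall>i\<in>I. (\<lambda>x. h x i) ` carrier A = carrier (B i))"

text \<open>
  The family is indexed by a set \<open>I\<close> of subsets of \<open>A\<close> and its members live on sets of
  subsets of \<open>A\<close>. This is no restriction: every factor of a subdirect product is isomorphic
  to a quotient of \<open>A\<close>, and one factor for each kernel suffices. The lemma \<open>semisimple_mvI\<close>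
  below makes this precise. The empty family is allowed, so the trivial algebra is semisimple.
\<close>

definition semisimple_mv :: "'a mv \<Rightarrow> bool" where
  "semisimple_mv A \<longleftrightarrow> (\<exists>(I :: 'a set set) (B :: 'a set \<Rightarrow> 'a set mv) h.
     (\<forall>i\<in>I. simple_mv (B i)) \<and> subdirect_embedding A I B h)"

lemma (in mv_algebra) minus_eq_zero_iff:
  assumes "x \<in> carrier A" "y \<in> carrier A"
  shows "mv_minus A x y = zero A \<and> mv_minus A y x = zero A \<longleftrightarrow> x = y"
proof
  note cl = oplus_closed zero_closed neg_closed assms
  assume "mv_minus A x y = zero A \<and> mv_minus A y x = zero A"
  then have "neg A (oplus A y (neg A x)) = zero A" "neg A (oplus A x (neg A y)) = zero A"
    using oplus_commute cl by (auto simp: mv_minus_def)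
  then show "x = y" using lukasiewicz[of x y] oplus_zero cl by simp
next
  assume "x = y"
  have "oplus A x (neg A (oplus A x (neg A (neg A (zero A)))))
        = oplus A (neg A (zero A)) (neg A (oplus A (neg A (zero A)) (neg A x)))"
    by (rule lukasiewicz) (simp_all add: assms zero_closed neg_closed)
  then have "oplus A x (neg A x) = neg A (zero A)"
    by (simp add: assms neg_neg zero_closed neg_closed oplus_zero oplus_closed oplus_top
        oplus_commute[of "neg A (zero A)"])
  then have "oplus A (neg A x) x = neg A (zero A)"
    using oplus_commute assms neg_closed by metis
  then show "mv_minus A x y = zero A \<and> mv_minus A y x = zero A"
    using \<open>x = y\<close> by (simp add: mv_minus_def neg_neg zero_closed)
qed

lemma simple_mv_iso:
  assumes B: "simple_mv B" and g: "g \<in> mv_hom B C" and bij: "bij_betw g (carrier B) (carrier C)"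
  shows "simple_mv C"
proof -
  interpret B: mv_algebra B using B by (simp add: simple_mv_def)
  have C: "carrier C = g ` carrier B" and inj: "inj_on g (carrier B)"
    using bij by (auto simp: bij_betw_def)
  have hom: "zero C = g (zero B)" "\<And>x. x \<in> carrier B \<Longrightarrow> neg C (g x) = g (neg B x)"
    "\<And>x y. x \<in> carrier B \<Longrightarrow> y \<in> carrier B \<Longrightarrow> oplus C (g x) (g y) = g (oplus B x y)"
    using g by (auto simp: mv_hom_def)
  note cl = B.oplus_closed B.zero_closed B.neg_closed
  have mv: "mv_algebra C"
  proof (rule mv_algebraI; (clarsimp simp: C hom cl)?)
    fix x y assume "x \<in> carrier B" "y \<in> carrier B"
    then show "g (oplus B x y) = g (oplus B y x)" by (simp add: B.oplus_commute)
    from \<open>x \<in> carrier B\<close> \<open>y \<in> carrier B\<close>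
    show "g (oplus B x (neg B (oplus B x (neg B y)))) = g (oplus B y (neg B (oplus B y (neg B x))))"
      by (simp add: B.lukasiewicz)
  qed (simp_all add: B.oplus_assoc B.oplus_zero B.neg_neg B.oplus_top cl)
  have "carrier C \<noteq> {zero C}"
  proof
    assume "carrier C = {zero C}"
    then have "g x = g (zero B)" if "x \<in> carrier B" for x using that by (auto simp: C hom)
    then have "x = zero B" if "x \<in> carrier B" for x
      using inj_onD[OF inj _ that B.zero_closed] that by blast
    then have "carrier B = {zero B}" using B.zero_closed by blast
    then show False using B by (simp add: simple_mv_def)
  qed
  moreover have "J = {zero C} \<or> J = carrier C" if J: "mv_ideal C J" for J
  proof -
    define K where "K = {x \<in> carrier B. g x \<in> J}"
    have JK: "J = g ` K" using J by (auto simp: K_def mv_ideal_def C)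
    have le: "mv_le C (g x) (g y)" if "x \<in> carrier B" "y \<in> carrier B" "mv_le B x y" for x y
      using that by (simp add: mv_le_def hom cl)
    have "mv_ideal B K"
      unfolding mv_ideal_def
    proof (intro conjI ballI impI)
      show "K \<subseteq> carrier B" by (auto simp: K_def)
      show "zero B \<in> K" using J by (simp add: K_def mv_ideal_def cl hom)
      show "oplus B x y \<in> K" if "x \<in> K" "y \<in> K" for x y
        using that J by (simp add: K_def mv_ideal_def cl flip: hom)
      show "x \<in> K" if "x \<in> carrier B" "y \<in> K" "mv_le B x y" for x y
      proof -
        have "mv_le C (g x) (g y)" "g x \<in> carrier C" "g y \<in> J"
          using that le[of x y] by (auto simp: K_def C)
        then show ?thesis using J that(1) unfolding mv_ideal_def K_def by blast
      qed
    qed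
    then have "K = {zero B} \<or> K = carrier B" using B by (simp add: simple_mv_def)
    then show ?thesis by (auto simp: JK C hom)
  qed
  ultimately show ?thesis using mv by (simp add: simple_mv_def)
qed

lemma semisimple_mvI:
  fixes A :: "'a mv" and I :: "'i set" and B :: "'i \<Rightarrow> 'b mv"
  assumes A: "mv_algebra A" and simple: "\<And>i. i \<in> I \<Longrightarrow> simple_mv (B i)"
    and emb: "subdirect_embedding A I B h"
  shows "semisimple_mv A"
proof -
  interpret A: mv_algebra A by fact
  note cl = A.oplus_closed A.zero_closed A.neg_closed
  have mvB: "mv_algebra (B i)" if "i \<in> I" for i using simple[OF that] by (simp add: simple_mv_def)
  have inj: "inj_on h (carrier A)"
    and surj: "\<And>i. i \<in> I \<Longrightarrow> (\<lambda>x. h x i) ` carrier A = carrier (B i)"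
    using emb by (auto simp: subdirect_embedding_def)
  have hE: "h x \<in> extensional I" if "x \<in> carrier A" for x
    using emb that by (auto simp: subdirect_embedding_def mv_hom_def mv_prod_def PiE_def)
  have hom: "h (zero A) i = zero (B i)"
    "\<And>x. x \<in> carrier A \<Longrightarrow> h (neg A x) i = neg (B i) (h x i)"
    "\<And>x y. x \<in> carrier A \<Longrightarrow> y \<in> carrier A \<Longrightarrow> h (oplus A x y) i = oplus (B i) (h x i) (h y i)"
    "\<And>x. x \<in> carrier A \<Longrightarrow> h x i \<in> carrier (B i)" if "i \<in> I" for i
    using emb surj[of i] that by (auto simp: subdirect_embedding_def mv_hom_def mv_prod_def)
  define ker where "ker i = {x \<in> carrier A. h x i = zero (B i)}" for i
  have same: "h x i = h y i \<longleftrightarrow> mv_minus A x y \<in> ker i \<and> mv_minus A y x \<in> ker i"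
    if "i \<in> I" "x \<in> carrier A" "y \<in> carrier A" for i x y
    using mv_algebra.minus_eq_zero_iff[OF mvB, of i "h x i" "h y i"] that
    by (auto simp: ker_def mv_minus_def hom cl)
  define j where "j = inv_into I ker"
  have j: "j K \<in> I" "ker (j K) = K" if "K \<in> ker ` I" for K
    using that by (auto simp: j_def inv_into_into f_inv_into_f)
  define g where "g i b = {x \<in> carrier A. h x i = b}" for i b
  have g_inj: "inj_on (g i) (carrier (B i))" if "i \<in> I" for i
  proof (rule inj_onI)
    fix b b' assume "b \<in> carrier (B i)" "b' \<in> carrier (B i)" "g i b = g i b'"
    moreover have "b \<in> (\<lambda>x. h x i) ` carrier A"
      unfolding surj[OF \<open>i \<in> I\<close>] by fact
    then obtain x where "x \<in> carrier A" "h x i = b" by auto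
    ultimately show "b = b'" unfolding g_def by blast
  qed
  define ginv where "ginv i = inv_into (carrier (B i)) (g i)" for i
  have ginv_g: "ginv i (g i b) = b" if "i \<in> I" "b \<in> carrier (B i)" for i b
    using inv_into_f_f[OF g_inj[OF that(1)] that(2)] by (simp add: ginv_def)
  define B' where "B' K = (let i = j K in \<lparr>carrier = g i ` carrier (B i),
      oplus = (\<lambda>X Y. g i (oplus (B i) (ginv i X) (ginv i Y))), zero = g i (zero (B i)),
      neg = (\<lambda>X. g i (neg (B i) (ginv i X)))\<rparr>)" for K
  have g_hom: "g (j K) \<in> mv_hom (B (j K)) (B' K)" if "K \<in> ker ` I" for K
    using j(1)[OF that] by (auto simp: mv_hom_def B'_def Let_def ginv_g)
  have simple': "simple_mv (B' K)" if "K \<in> ker ` I" for K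
    using simple_mv_iso[OF simple[OF j(1)[OF that]] g_hom[OF that]] g_inj[OF j(1)[OF that]]
    by (simp add: bij_betw_def B'_def Let_def)
  define h' where "h' x = (\<lambda>K\<in>ker ` I. g (j K) (h x (j K)))" for x
  have "inj_on h' (carrier A)"
  proof (rule inj_onI)
    fix x y assume xy: "x \<in> carrier A" "y \<in> carrier A" and eq: "h' x = h' y"
    have "h x i = h y i" if i: "i \<in> I" for i
    proof -
      let ?K = "ker i"
      have K: "?K \<in> ker ` I" using i by blast
      have "g (j ?K) (h x (j ?K)) = g (j ?K) (h y (j ?K))"
        using fun_cong[OF eq, of ?K] K by (simp add: h'_def)
      then have "h x (j ?K) = h y (j ?K)"
        using g_inj[OF j(1)[OF K]] hom(4)[OF j(1)[OF K]] xy by (simp add: inj_on_def)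
      then show ?thesis using same[OF j(1)[OF K] xy] same[OF i xy] j(2)[OF K] by simp
    qed
    then have "h x = h y" using hE xy by (blast intro: extensionalityI)
    then show "x = y" using inj xy by (simp add: inj_on_def)
  qed
  moreover have "h' \<in> mv_hom A (mv_prod (ker ` I) B')"
  proof -
    have g: "zero (B' K) = g (j K) (zero (B (j K)))"
      "\<And>x. x \<in> carrier (B (j K)) \<Longrightarrow> neg (B' K) (g (j K) x) = g (j K) (neg (B (j K)) x)"
      "\<And>x y. x \<in> carrier (B (j K)) \<Longrightarrow> y \<in> carrier (B (j K)) \<Longrightarrow>
         oplus (B' K) (g (j K) x) (g (j K) y) = g (j K) (oplus (B (j K)) x y)"
      "\<And>x. x \<in> carrier (B (j K)) \<Longrightarrow> g (j K) x \<in> carrier (B' K)"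
      if "K \<in> ker ` I" for K
      using g_hom[OF that] by (auto simp: mv_hom_def)
    note [simp del] = image_iff
    have "h' x \<in> carrier (mv_prod (ker ` I) B')" if "x \<in> carrier A" for x
      unfolding mv_prod_def h'_def using that by (simp add: g(4) hom(4) j(1))
    moreover have "h' (zero A) = zero (mv_prod (ker ` I) B')"
      unfolding mv_prod_def h'_def by (simp add: fun_eq_iff restrict_def g(1) hom(1) j(1))
    moreover have "h' (neg A x) = neg (mv_prod (ker ` I) B') (h' x)" if "x \<in> carrier A" for x
      unfolding mv_prod_def h'_def using that
      by (simp add: fun_eq_iff restrict_def g(2) hom(2) hom(4) j(1))
    moreover have "h' (oplus A x y) = oplus (mv_prod (ker ` I) B') (h' x) (h' y)"
      if "x \<in> carrier A" "y \<in> carrier A" for x y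
      unfolding mv_prod_def h'_def using that
      by (simp add: fun_eq_iff restrict_def g(3) hom(3) hom(4) j(1))
    ultimately show ?thesis by (auto simp: mv_hom_def)
  qed
  moreover have "(\<lambda>x. h' x K) ` carrier A = carrier (B' K)" if "K \<in> ker ` I" for K
  proof -
    have "(\<lambda>x. h' x K) ` carrier A = g (j K) ` (\<lambda>x. h x (j K)) ` carrier A"
      using that by (simp add: h'_def image_image)
    then show ?thesis using surj[OF j(1)[OF that]] by (simp add: B'_def Let_def)
  qed
  ultimately have "subdirect_embedding A (ker ` I) B' h'"
    by (simp add: subdirect_embedding_def)
  then show ?thesis unfolding semisimple_mv_def using simple' by blast
qed

definition strongly_semisimple_mv :: "'a mv \<Rightarrow> bool" where
  "strongly_semisimple_mv A \<longleftrightarrow>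
     (\<forall>a\<in>carrier A. semisimple_mv (mv_quot_ideal A (principal_ideal A a)))"


section \<open>Free MV-algebras\<close>

datatype 'i mv_term = Var 'i | Zero | Oplus "'i mv_term" "'i mv_term" | Neg "'i mv_term"

inductive mv_eq :: "'i mv_term \<Rightarrow> 'i mv_term \<Rightarrow> bool" where
  refl: "mv_eq s s"
| sym: "mv_eq s t \<Longrightarrow> mv_eq t s"
| trans: "mv_eq s t \<Longrightarrow> mv_eq t u \<Longrightarrow> mv_eq s u"
| Oplus: "mv_eq s s' \<Longrightarrow> mv_eq t t' \<Longrightarrow> mv_eq (Oplus s t) (Oplus s' t')"
| Neg: "mv_eq s s' \<Longrightarrow> mv_eq (Neg s) (Neg s')"
| assoc: "mv_eq (Oplus (Oplus s t) u) (Oplus s (Oplus t u))"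
| commute: "mv_eq (Oplus s t) (Oplus t s)"
| zero: "mv_eq (Oplus s Zero) s"
| neg_neg: "mv_eq (Neg (Neg s)) s"
| top: "mv_eq (Oplus s (Neg Zero)) (Neg Zero)"
| lukasiewicz: "mv_eq (Oplus s (Neg (Oplus s (Neg t)))) (Oplus t (Neg (Oplus t (Neg s))))"

definition mv_term_algebra :: "'i set \<Rightarrow> 'i mv_term mv" where
  "mv_term_algebra I = \<lparr>carrier = {t. set_mv_term t \<subseteq> I}, oplus = Oplus, zero = Zero, neg = Neg\<rparr>"

definition mv_term_cong :: "'i set \<Rightarrow> ('i mv_term \<times> 'i mv_term) set" where
  "mv_term_cong I = {(s, t). set_mv_term s \<subseteq> I \<and> set_mv_term t \<subseteq> I \<and> mv_eq s t}"

definition free_mv :: "'i set \<Rightarrow> 'i mv_term set mv" where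
  "free_mv I = mv_quot (mv_term_algebra I) (mv_term_cong I)"

definition free_gen :: "'i set \<Rightarrow> 'i \<Rightarrow> 'i mv_term set" where
  "free_gen I i = mv_term_cong I `` {Var i}"

definition free_ext :: "'i set \<Rightarrow> 'b mv \<Rightarrow> ('i \<Rightarrow> 'b) \<Rightarrow> 'i mv_term set \<Rightarrow> 'b" where
  "free_ext I B p = (THE h. h \<in> mv_hom (free_mv I) B \<and> h \<in> extensional (carrier (free_mv I)) \<and>
     (\<forall>i\<in>I. h (free_gen I i) = p i))"

lemma mv_congruence_term_cong: "mv_congruence (mv_term_algebra I) (mv_term_cong I)"
  unfolding mv_congruence_def mv_term_algebra_def mv_term_cong_def equiv_def
  by (auto simp: refl_on_def sym_def trans_def intro: mv_eq.intros)

lemma free_mv_simps: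
  "carrier (free_mv I) = {t. set_mv_term t \<subseteq> I} // mv_term_cong I"
  "zero (free_mv I) = mv_term_cong I `` {Zero}"
  "set_mv_term s \<subseteq> I \<Longrightarrow> neg (free_mv I) (mv_term_cong I `` {s}) = mv_term_cong I `` {Neg s}"
  "set_mv_term s \<subseteq> I \<Longrightarrow> set_mv_term t \<subseteq> I \<Longrightarrow>
     oplus (free_mv I) (mv_term_cong I `` {s}) (mv_term_cong I `` {t}) = mv_term_cong I `` {Oplus s t}"
  using mv_quot_simps[OF mv_congruence_term_cong, of _ I]
  unfolding free_mv_def
  by (simp_all add: mv_quot_def mv_term_algebra_def)

lemma mv_term_class_eq:
  assumes "set_mv_term s \<subseteq> I" "set_mv_term t \<subseteq> I"
  shows "mv_term_cong I `` {s} = mv_term_cong I `` {t} \<longleftrightarrow> mv_eq s t"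
  using assms by (auto simp: mv_term_cong_def intro: mv_eq.refl mv_eq.sym mv_eq.trans)

lemma free_mv_cases:
  assumes "X \<in> carrier (free_mv I)"
  obtains t where "X = mv_term_cong I `` {t}" "set_mv_term t \<subseteq> I"
  using assms unfolding free_mv_simps by (elim quotientE) simp

lemma mv_term_class_closed:
  "set_mv_term t \<subseteq> I \<Longrightarrow> mv_term_cong I `` {t} \<in> carrier (free_mv I)"
  unfolding free_mv_simps by (rule quotientI) simp

lemma mv_algebra_free_mv: "mv_algebra (free_mv I)"
  by (rule mv_algebraI; (elim free_mv_cases)?)
    (simp_all add: free_mv_simps(2-) mv_term_class_closed mv_term_class_eq mv_eq.assoc mv_eq.commute
      mv_eq.zero mv_eq.neg_neg mv_eq.top mv_eq.lukasiewicz)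

primrec mv_eval :: "'b mv \<Rightarrow> ('i \<Rightarrow> 'b) \<Rightarrow> 'i mv_term \<Rightarrow> 'b" where
  "mv_eval B p (Var i) = p i"
| "mv_eval B p Zero = zero B"
| "mv_eval B p (Oplus s t) = oplus B (mv_eval B p s) (mv_eval B p t)"
| "mv_eval B p (Neg s) = neg B (mv_eval B p s)"

lemma mv_eval_cong: "(\<And>i. i \<in> set_mv_term t \<Longrightarrow> p i = q i) \<Longrightarrow> mv_eval B p t = mv_eval B q t"
  by (induction t) auto

lemma mv_eval_closed:
  assumes "mv_algebra B"
  shows "(\<And>i. i \<in> set_mv_term t \<Longrightarrow> p i \<in> carrier B) \<Longrightarrow> mv_eval B p t \<in> carrier B"
  by (induction t)
    (auto intro: mv_algebra.zero_closed mv_algebra.oplus_closed mv_algebra.neg_closed assms)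

lemma mv_eval_sound:
  assumes B: "mv_algebra B" and p: "\<And>i. p i \<in> carrier B"
  shows "mv_eq s t \<Longrightarrow> mv_eval B p s = mv_eval B p t"
proof (induction rule: mv_eq.induct)
  case (lukasiewicz s t)
  then show ?case by (simp add: mv_eval_closed[OF B p] mv_algebra.lukasiewicz[OF B])
qed (simp_all add: mv_eval_closed[OF B p] mv_algebra.oplus_assoc[OF B] mv_algebra.oplus_zero[OF B]
      mv_algebra.neg_neg[OF B] mv_algebra.oplus_top[OF B] mv_algebra.oplus_commute[OF B])

theorem free_mv_universal:
  assumes B: "mv_algebra B" and p: "p \<in> I \<rightarrow> carrier B"
  shows "\<exists>!h. h \<in> mv_hom (free_mv I) B \<and> h \<in> extensional (carrier (free_mv I)) \<and>
           (\<forall>i\<in>I. h (free_gen I i) = p i)" (is "\<exists>!h. ?P h")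
    and "set_mv_term t \<subseteq> I \<Longrightarrow> free_ext I B p (mv_term_cong I `` {t}) = mv_eval B p t"
proof -
  let ?F = "free_mv I" and ?c = "\<lambda>t. mv_term_cong I `` {t}"
  define p' where "p' i = (if i \<in> I then p i else zero B)" for i
  have p': "p' i \<in> carrier B" for i
    using p mv_algebra.zero_closed[OF B] by (auto simp: p'_def)
  have ev: "mv_eval B p' t = mv_eval B p t" if "set_mv_term t \<subseteq> I" for t
    using that by (intro mv_eval_cong) (auto simp: p'_def)
  define h where "h = (\<lambda>X\<in>carrier ?F. mv_eval B p' (SOME t. t \<in> X))"
  have h: "h (?c t) = mv_eval B p' t" if t: "set_mv_term t \<subseteq> I" for t
  proof -
    have "t \<in> ?c t" using t by (auto simp: mv_term_cong_def intro: mv_eq.refl)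
    then have "(SOME s. s \<in> ?c t) \<in> ?c t" by (rule someI)
    then have "mv_eq t (SOME s. s \<in> ?c t)" unfolding mv_term_cong_def by blast
    moreover have "?c t \<in> carrier ?F" using t by (rule mv_term_class_closed)
    ultimately show ?thesis unfolding h_def using mv_eval_sound[of B p', OF B p'] by simp
  qed
  have "?P h"
  proof (intro conjI)
    show "h \<in> extensional (carrier ?F)" by (simp add: h_def)
    show "\<forall>i\<in>I. h (free_gen I i) = p i" by (simp add: free_gen_def h p'_def)
    show "h \<in> mv_hom ?F B" unfolding mv_hom_def
      by (auto simp: free_mv_simps(2-) h mv_eval_closed[OF B p'] elim!: free_mv_cases)
  qed
  have key: "g (?c t) = mv_eval B p t" if g: "?P g" and t: "set_mv_term t \<subseteq> I" for g t
    using t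
  proof (induction t)
    case (Var i)
    then show ?case using g by (simp add: free_gen_def)
  next
    case Zero
    then show ?case using g by (simp add: mv_hom_def flip: free_mv_simps(2))
  next
    case (Oplus s t)
    then have "?c s \<in> carrier ?F" "?c t \<in> carrier ?F" by (simp_all add: mv_term_class_closed)
    then have "g (oplus ?F (?c s) (?c t)) = oplus B (g (?c s)) (g (?c t))"
      using g by (simp add: mv_hom_def)
    then show ?case using Oplus by (simp add: free_mv_simps)
  next
    case (Neg s)
    then have "?c s \<in> carrier ?F" by (simp_all add: mv_term_class_closed)
    then have "g (neg ?F (?c s)) = neg B (g (?c s))"
      using g by (simp add: mv_hom_def)
    then show ?case using Neg by (simp add: free_mv_simps)
  qed
  have uniq: "g = h" if "?P g" for g
  proof (rule extensionalityI)
    show "g \<in> extensional (carrier ?F)" "h \<in> extensional (carrier ?F)"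
      using that \<open>?P h\<close> by blast+
    fix X assume "X \<in> carrier ?F"
    then obtain t where "X = ?c t" "set_mv_term t \<subseteq> I"
      by (rule free_mv_cases)
    then show "g X = h X" using key[OF that] h ev by simp
  qed
  show ex1: "\<exists>!h. ?P h" using \<open>?P h\<close> uniq by blast
  show "free_ext I B p (?c t) = mv_eval B p t" if "set_mv_term t \<subseteq> I"
    unfolding free_ext_def by (rule key[OF theI'[OF ex1] that])
qed


section \<open>The spaces \<open>\<real>\<^sup>I\<close> and the algebras \<open>\<M>(X)\<close>\<close>

text \<open>
  \<open>\<real>\<^sup>I\<close> is the set of all functions that vanish outside \<open>I\<close>. With the pointwise vector space
  structure on functions it is a linear subspace, and its product topology is the subspace
  topology of the topology of pointwise convergence on functions.
\<close>

instantiation "fun" :: (type, real_vector) real_vector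
begin

definition scaleR_fun :: "real \<Rightarrow> ('a \<Rightarrow> 'b) \<Rightarrow> 'a \<Rightarrow> 'b" where
  "scaleR_fun c f = (\<lambda>x. c *\<^sub>R f x)"

instance
  by standard (simp_all add: scaleR_fun_def plus_fun_def fun_eq_iff scaleR_add_right scaleR_add_left)

end

definition coord_space :: "'i set \<Rightarrow> ('i \<Rightarrow> real) set" where
  "coord_space I = {x. \<forall>i. i \<notin> I \<longrightarrow> x i = 0}"

definition unit_cube :: "'i set \<Rightarrow> ('i \<Rightarrow> real) set" where
  "unit_cube I = {x \<in> coord_space I. \<forall>i\<in>I. 0 \<le> x i \<and> x i \<le> 1}"

definition coord_proj :: "'i set \<Rightarrow> ('i \<Rightarrow> real) \<Rightarrow> ('i \<Rightarrow> real)" where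
  "coord_proj C p = (\<lambda>i. if i \<in> C then p i else 0)"

definition definable_map :: "'i set \<Rightarrow> ('i \<Rightarrow> real) set \<Rightarrow> 'i mv_term set \<Rightarrow> ('i \<Rightarrow> real) \<Rightarrow> real" where
  "definable_map I X t = (\<lambda>p\<in>X. free_ext I std_mv p t)"

definition mv_definable :: "'i set \<Rightarrow> ('i \<Rightarrow> real) set \<Rightarrow> (('i \<Rightarrow> real) \<Rightarrow> real) mv" where
  "mv_definable I X =
     (mv_prod X (\<lambda>_. std_mv)) \<lparr>carrier := definable_map I X ` carrier (free_mv I)\<rparr>"


section \<open>Bouligand--Severi tangents\<close>

text \<open>Throughout, \<open>C\<close> is a finite index set, \<open>\<real>\<^sup>C\<close> carries the Euclidean inner product, and
  \<open>L2_set v C\<close> is the Euclidean norm of \<open>v \<in> \<real>\<^sup>C\<close>.\<close>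

definition coord_inner :: "'i set \<Rightarrow> ('i \<Rightarrow> real) \<Rightarrow> ('i \<Rightarrow> real) \<Rightarrow> real" where
  "coord_inner C v w = (\<Sum>i\<in>C. v i * w i)"

definition orth_proj :: "'i set \<Rightarrow> ('i \<Rightarrow> real) set \<Rightarrow> ('i \<Rightarrow> real) \<Rightarrow> ('i \<Rightarrow> real)" where
  "orth_proj C W v = (THE w. w \<in> W \<and> (\<forall>y\<in>W. coord_inner C (v - w) y = 0))"

definition coord_normalize :: "'i set \<Rightarrow> ('i \<Rightarrow> real) \<Rightarrow> ('i \<Rightarrow> real)" where
  "coord_normalize C v = v /\<^sub>R L2_set v C"

definition orthonormal_tuple :: "'i set \<Rightarrow> nat \<Rightarrow> (nat \<Rightarrow> 'i \<Rightarrow> real) \<Rightarrow> bool" where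
  "orthonormal_tuple C k u \<longleftrightarrow>
     (\<forall>i\<in>{1..k}. u i \<in> coord_space C \<and> L2_set (u i) C = 1) \<and>
     (\<forall>i\<in>{1..k}. \<forall>j\<in>{1..k}. i \<noteq> j \<longrightarrow> coord_inner C (u i) (u j) = 0)"

text \<open>For \<open>l = 1\<close> the span below is \<open>{0}\<close>, so the sequence in the last condition
  is \<open>(s i - x) / \<parallel>s i - x\<parallel>\<close>.\<close>

definition tangent :: "'i set \<Rightarrow> ('i \<Rightarrow> real) set \<Rightarrow> nat \<Rightarrow> (nat \<Rightarrow> 'i \<Rightarrow> real) \<Rightarrow> ('i \<Rightarrow> real) \<Rightarrow> bool" where
  "tangent C X k u x \<longleftrightarrow> 1 \<le> k \<and> orthonormal_tuple C k u \<and> x \<in> coord_space C \<and>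
     (\<exists>s :: nat \<Rightarrow> 'i \<Rightarrow> real. (\<forall>i. s i \<in> X) \<and>
        s \<longlonglongrightarrow> x \<and>
        (\<forall>i. s i - x \<notin> span (u ` {1..k})) \<and>
        (\<forall>l\<in>{1..k}.
           (\<lambda>i. coord_normalize C ((s i - x) - orth_proj C (span (u ` {1..l-1})) (s i - x)))
             \<longlonglongrightarrow> u l))"

lemma orth_proj_span:
  assumes C: "finite C" and u: "orthonormal_tuple C k u" and l: "l \<le> k"
  shows "orth_proj C (span (u ` {1..l})) v = (\<Sum>j=1..l. coord_inner C v (u j) *\<^sub>R u j)"
    (is "_ = ?w")
  unfolding orth_proj_def
proof (rule the_equality)
  let ?W = "span (u ` {1..l})"
  have lin: "coord_inner C (a + b) y = coord_inner C a y + coord_inner C b y"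
    "coord_inner C y (a + b) = coord_inner C y a + coord_inner C y b"
    "coord_inner C (a - b) y = coord_inner C a y - coord_inner C b y"
    "coord_inner C (c *\<^sub>R a) y = c * coord_inner C a y"
    "coord_inner C y (c *\<^sub>R a) = c * coord_inner C y a"
    "coord_inner C y 0 = 0" "coord_inner C 0 y = 0" for a b y c
    by (simp_all add: coord_inner_def scaleR_fun_def algebra_simps sum.distrib sum_subtractf
        sum_distrib_left)
  have sum: "coord_inner C (\<Sum>j\<in>J. f j) y = (\<Sum>j\<in>J. coord_inner C (f j) y)"
    for f :: "nat \<Rightarrow> 'a \<Rightarrow> real" and J y
    by (induction J rule: infinite_finite_induct) (simp_all only: lin sum.insert sum.infinite sum.empty simp_thms)
  have uu: "coord_inner C (u i) (u j) = (if i = j then 1 else 0)" if "i \<in> {1..l}" "j \<in> {1..l}" for i j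
  proof -
    have ij: "i \<in> {1..k}" "j \<in> {1..k}" using that l by auto
    have "coord_inner C (u i) (u i) = (L2_set (u i) C)\<^sup>2"
      by (simp add: coord_inner_def L2_set_def power2_eq_square sum_nonneg)
    also have "\<dots> = 1" using u ij unfolding orthonormal_tuple_def by simp
    finally show ?thesis using u ij unfolding orthonormal_tuple_def by (cases "i = j") auto
  qed
  have "coord_inner C (v - ?w) y = 0" if "y \<in> ?W" for y
    using that
  proof (induction rule: span_induct_alt)
    case base
    show ?case by (rule lin)
  next
    case (step c x y)
    then obtain i where i: "i \<in> {1..l}" "x = u i" by auto
    have "coord_inner C ?w (u i) = (\<Sum>j=1..l. (if j = i then coord_inner C v (u j) else 0))"
      unfolding sum lin
    proof (rule sum.cong[OF HOL.refl])
      fix j assume "j \<in> {1..l}"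
      then have "coord_inner C (u j) (u i) = (if j = i then 1 else 0)" using i(1) by (rule uu)
      then show "coord_inner C v (u j) * coord_inner C (u j) (u i) =
          (if j = i then coord_inner C v (u j) else 0)"
        by simp
    qed
    also have "\<dots> = coord_inner C v (u i)" using i by simp
    finally have "coord_inner C (v - ?w) (u i) = 0" by (simp only: lin diff_self)
    then show ?case using step i by (simp only: lin mult_zero_right add_0)
  qed
  moreover have "?w \<in> ?W" by (intro span_sum span_scale span_base) auto
  ultimately show w: "?w \<in> ?W \<and> (\<forall>y\<in>?W. coord_inner C (v - ?w) y = 0)" by blast
  fix w' assume w': "w' \<in> ?W \<and> (\<forall>y\<in>?W. coord_inner C (v - w') y = 0)"
  have d: "w' - ?w \<in> ?W" using w w' by (blast intro: span_diff)
  have "coord_inner C (v - ?w) (w' - ?w) - coord_inner C (v - w') (w' - ?w) = 0" using w w' d by simp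
  then have "coord_inner C (w' - ?w) (w' - ?w) = 0" by (simp only: lin)
  then have "(w' - ?w) i = 0" if "i \<in> C" for i
    using C that unfolding coord_inner_def by (subst (asm) sum_nonneg_eq_0_iff) auto
  moreover have "(w' - ?w) i = 0" if "i \<notin> C" for i
  proof -
    have "x i = 0" if "x \<in> ?W" for x
      using that
    proof (induction rule: span_induct_alt)
      case (step c x y)
      then obtain j where "j \<in> {1..l}" "x = u j" by blast
      then have "j \<in> {1..k}" using l by simp
      then show ?case
        using step u \<open>i \<notin> C\<close> \<open>x = u j\<close> by (simp add: orthonormal_tuple_def coord_space_def scaleR_fun_def)
    qed simp
    then show ?thesis using d by blast
  qed
  ultimately have "w' - ?w = 0" by (auto simp: fun_eq_iff)
  then show "w' = ?w" by simp
qed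

definition rational_simplex :: "'i set \<Rightarrow> ('i \<Rightarrow> real) set \<Rightarrow> bool" where
  "rational_simplex C S \<longleftrightarrow> (\<exists>V. finite V \<and> V \<subseteq> coord_space C \<and> (\<forall>v\<in>V. \<forall>i\<in>C. v i \<in> \<rat>) \<and>
     \<not> affine_dependent V \<and> S = convex hull V)"

definition rationally_outgoing ::
    "'i set \<Rightarrow> ('i \<Rightarrow> real) set \<Rightarrow> nat \<Rightarrow> (nat \<Rightarrow> 'i \<Rightarrow> real) \<Rightarrow> ('i \<Rightarrow> real) \<Rightarrow> bool" where
  "rationally_outgoing C X k u x \<longleftrightarrow>
     (\<exists>S F c. rational_simplex C S \<and> F face_of S \<and> (\<forall>l\<in>{1..k}. 0 < c l) \<and>
        (let T = convex hull ((\<lambda>l. x + (\<Sum>j=1..l. c j *\<^sub>R u j)) ` {0..k})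
         in T \<subseteq> S \<and> \<not> T \<subseteq> F \<and> F \<inter> X = S \<inter> X))"

end

theory Submission
  imports Defs
begin

text \<open>
  By an analogue of the theorem of Hoelder, simple MV-algebras embed into \<open>[0, 1]\<close>, so \<open>A\<close> is strongly
  semisimple iff the homomorphisms into \<open>[0, 1]\<close> separate points and, whenever \<open>b\<close> vanishes at every
  homomorphism at which \<open>a\<close> does, \<open>b\<close> is dominated by a multiple of \<open>a\<close>. Only finitely many
  coordinates matter for given \<open>a\<close> and \<open>b\<close>, so this is a condition on piecewise linear functions on the
  finite-dimensional projections \<open>Y\<close>.

  Given an outgoing tangent with simplex \<open>S\<close> and face \<open>F\<close>, let \<open>a\<close> have zero set \<open>S\<close> and let \<open>b\<close> be
  the sum of the barycentric coordinates of the vertices outside \<open>F\<close>; along the sequence of the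
  tangent \<open>b / a\<close> is unbounded. Conversely, take points of \<open>Y\<close> with \<open>b > n a\<close> that converge to \<open>x\<close>
  inside a simplex on which \<open>a\<close> and \<open>b\<close> are affine, and choose the tangent along them as long as
  \<open>a\<close> is constant in its directions; \<open>b\<close> cannot be constant in all of these directions. The face
  \<open>a = 0\<close> of the simplex and its face \<open>b = 0\<close> show that the tangent is outgoing.
\<close>

section \<open>MV-algebras and the unit interval\<close>

text \<open>Homomorphisms of the quotient by the ideal of \<open>a\<close> are the homomorphisms of
  \<open>A\<close> that vanish at \<open>a\<close>; semisimplicity of the quotient therefore says
  that an element killed by all of them lies in the ideal, and that is the domination condition. The
  analogue of Hoelder's theorem works inside the chain: a sum in the ordered group behind it is
  recorded by a fractional part and a carry that is 0 or 1, and repeated doubling turns carries into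
  binary digits. The obstacle in the geometry is that slopes along the first directions of a tangent
  may vanish, so sizes cannot be compared to first order. They are measured by the residues left
  after projecting onto \<open>u 1, ..., u (p - 1)\<close>: an affine function that vanishes at
  \<open>x\<close> and whose first nonzero slope is along \<open>u p\<close> has the exact order of
  that residue. An outgoing tangent makes \<open>b\<close> of this order for some \<open>p\<close>
  while \<open>a\<close> is of smaller order. Conversely, \<open>a\<close> has the order of the
  residue left by the longest tangent on which it is constant, and \<open>b\<close>, being much
  larger, must have the order of an earlier one.\<close>

definition mv_times :: "'a mv \<Rightarrow> 'a \<Rightarrow> 'a \<Rightarrow> 'a" where
  "mv_times A x y = neg A (oplus A (neg A x) (neg A y))"

definition mv_one :: "'a mv \<Rightarrow> 'a" where
  "mv_one A = neg A (zero A)"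

section \<open>Order, residuation and lattice operations of an MV-algebra\<close>

context mv_algebra
begin

lemma one_closed: "mv_one A \<in> carrier A"
  by (simp add: mv_one_def neg_closed zero_closed)

lemma times_closed: "x \<in> carrier A \<Longrightarrow> y \<in> carrier A \<Longrightarrow> mv_times A x y \<in> carrier A"
  by (simp add: mv_times_def neg_closed oplus_closed)

lemmas closed = oplus_closed zero_closed neg_closed one_closed times_closed

lemma neg_zero: "neg A (zero A) = mv_one A"
  and neg_one: "neg A (mv_one A) = zero A"
  by (simp_all add: mv_one_def neg_neg zero_closed)

lemma neg_eq_iff: "x \<in> carrier A \<Longrightarrow> y \<in> carrier A \<Longrightarrow> neg A x = neg A y \<longleftrightarrow> x = y"
  using neg_neg by metis

lemma oplus_one: "x \<in> carrier A \<Longrightarrow> oplus A x (mv_one A) = mv_one A"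
  using oplus_top by (simp add: mv_one_def)

lemma one_oplus: "x \<in> carrier A \<Longrightarrow> oplus A (mv_one A) x = mv_one A"
  using oplus_one oplus_commute closed by simp

lemma zero_oplus: "x \<in> carrier A \<Longrightarrow> oplus A (zero A) x = x"
  using oplus_zero oplus_commute closed by simp

lemma le_iff: "mv_le A x y \<longleftrightarrow> oplus A (neg A x) y = mv_one A"
  by (simp add: mv_le_def mv_one_def)

lemma le_refl: "x \<in> carrier A \<Longrightarrow> mv_le A x x"
  using minus_eq_zero_iff[of x x] neg_neg[of "oplus A (neg A x) x"]
  by (simp add: mv_minus_def mv_le_def closed)

lemma oplus_neg: "x \<in> carrier A \<Longrightarrow> oplus A x (neg A x) = mv_one A"
  and neg_oplus: "x \<in> carrier A \<Longrightarrow> oplus A (neg A x) x = mv_one A"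
  using le_refl[of x] oplus_commute[of x "neg A x"] by (simp_all add: le_iff closed)

lemma le_one: "x \<in> carrier A \<Longrightarrow> mv_le A x (mv_one A)"
  by (simp add: le_iff oplus_one closed)

lemma zero_le: "x \<in> carrier A \<Longrightarrow> mv_le A (zero A) x"
  by (simp add: le_iff neg_zero one_oplus)

lemma le_antisym:
  assumes "x \<in> carrier A" "y \<in> carrier A" "mv_le A x y" "mv_le A y x"
  shows "x = y"
  using assms minus_eq_zero_iff[of x y] by (simp add: mv_minus_def le_iff neg_one)

lemma le_oplus:
  assumes "x \<in> carrier A" "y \<in> carrier A"
  shows "mv_le A x (oplus A x y)"
  using assms by (simp add: le_iff oplus_assoc[symmetric] closed neg_oplus one_oplus)

text \<open>Both sides are the join of \<open>x\<close> and \<open>y\<close>; the third axiom says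
  that it is symmetric.\<close>

lemma join_commute:
  assumes "x \<in> carrier A" "y \<in> carrier A"
  shows "oplus A (mv_times A x (neg A y)) y = oplus A (mv_times A y (neg A x)) x"
  using assms lukasiewicz[of x y] oplus_commute
  by (simp add: mv_times_def closed neg_neg)

lemma le_join_eq:
  assumes "x \<in> carrier A" "y \<in> carrier A" "mv_le A x y"
  shows "oplus A (mv_times A x (neg A y)) y = y" "oplus A (mv_times A y (neg A x)) x = y"
proof -
  show "oplus A (mv_times A x (neg A y)) y = y"
    using assms by (simp add: mv_times_def neg_neg le_iff neg_one zero_oplus)
  then show "oplus A (mv_times A y (neg A x)) x = y"
    using join_commute assms by simp
qed

text \<open>The order is the divisibility order of the monoid, so transitivity and monotonicity
  become regroupings of sums.\<close>

lemma le_iff_ex: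
  assumes "x \<in> carrier A" "y \<in> carrier A"
  shows "mv_le A x y \<longleftrightarrow> (\<exists>z\<in>carrier A. y = oplus A z x)"
  using le_join_eq(2)[OF assms] le_oplus oplus_commute assms closed by metis

lemma le_trans:
  assumes "x \<in> carrier A" "y \<in> carrier A" "z \<in> carrier A" "mv_le A x y" "mv_le A y z"
  shows "mv_le A x z"
proof -
  obtain a b where "a \<in> carrier A" "b \<in> carrier A" "y = oplus A a x" "z = oplus A b y"
    using assms le_iff_ex by metis
  then have "z = oplus A (oplus A b a) x" using assms oplus_assoc by simp
  then show ?thesis using le_iff_ex assms \<open>a \<in> carrier A\<close> \<open>b \<in> carrier A\<close> closed by metis
qed

lemma oplus_mono_left:
  assumes "x \<in> carrier A" "y \<in> carrier A" "z \<in> carrier A" "mv_le A x y"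
  shows "mv_le A (oplus A x z) (oplus A y z)"
proof -
  obtain a where "a \<in> carrier A" "y = oplus A a x"
    using assms le_iff_ex by metis
  then have "oplus A y z = oplus A a (oplus A x z)" using assms oplus_assoc by simp
  then show ?thesis using le_iff_ex assms \<open>a \<in> carrier A\<close> closed by metis
qed

lemma neg_le_iff:
  assumes "x \<in> carrier A" "y \<in> carrier A"
  shows "mv_le A (neg A x) (neg A y) \<longleftrightarrow> mv_le A y x"
  using assms oplus_commute by (simp add: le_iff neg_neg closed)

lemma times_commute:
  "x \<in> carrier A \<Longrightarrow> y \<in> carrier A \<Longrightarrow> mv_times A x y = mv_times A y x"
  using oplus_commute closed by (simp add: mv_times_def)

lemma times_assoc:
  "x \<in> carrier A \<Longrightarrow> y \<in> carrier A \<Longrightarrow> z \<in> carrier A \<Longrightarrow>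
    mv_times A (mv_times A x y) z = mv_times A x (mv_times A y z)"
  by (simp add: mv_times_def neg_neg closed oplus_assoc)

lemma neg_times: "x \<in> carrier A \<Longrightarrow> y \<in> carrier A \<Longrightarrow>
    neg A (mv_times A x y) = oplus A (neg A x) (neg A y)"
  and neg_oplus_eq: "x \<in> carrier A \<Longrightarrow> y \<in> carrier A \<Longrightarrow>
    neg A (oplus A x y) = mv_times A (neg A x) (neg A y)"
  by (simp_all add: mv_times_def neg_neg closed)

lemma times_mono_left:
  assumes "x \<in> carrier A" "y \<in> carrier A" "z \<in> carrier A" "mv_le A x y"
  shows "mv_le A (mv_times A x z) (mv_times A y z)"
  using assms by (simp add: mv_times_def neg_le_iff closed oplus_mono_left)

lemma residuation:
  assumes "x \<in> carrier A" "y \<in> carrier A" "z \<in> carrier A"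
  shows "mv_le A (mv_times A x y) z \<longleftrightarrow> mv_le A x (oplus A (neg A y) z)"
  using assms by (simp add: le_iff neg_times closed oplus_assoc)

lemma times_neg: "x \<in> carrier A \<Longrightarrow> mv_times A x (neg A x) = zero A"
  by (simp add: mv_times_def oplus_neg closed neg_one)

lemma one_times: "x \<in> carrier A \<Longrightarrow> mv_times A (mv_one A) x = x"
  by (simp add: mv_times_def neg_one zero_oplus closed neg_neg)

lemma times_le_left: "x \<in> carrier A \<Longrightarrow> y \<in> carrier A \<Longrightarrow> mv_le A (mv_times A x y) x"
  by (simp add: residuation closed) (metis le_oplus oplus_commute closed(3))

lemma times_le_right: "x \<in> carrier A \<Longrightarrow> y \<in> carrier A \<Longrightarrow> mv_le A (mv_times A x y) y"
  using times_le_left times_commute by metis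

lemma le_zero: "x \<in> carrier A \<Longrightarrow> mv_le A x (zero A) \<Longrightarrow> x = zero A"
  using le_antisym zero_le closed by blast

lemma times_eq_zero_iff:
  assumes "x \<in> carrier A" "y \<in> carrier A"
  shows "mv_times A x y = zero A \<longleftrightarrow> mv_le A x (neg A y)"
  using assms by (metis closed le_refl le_zero oplus_zero residuation)

lemma join_upper:
  assumes "x \<in> carrier A" "y \<in> carrier A"
  shows "mv_le A x (oplus A (mv_times A x (neg A y)) y)"
    "mv_le A y (oplus A (mv_times A x (neg A y)) y)"
  using assms join_commute le_iff_ex closed by metis+

lemma join_least:
  assumes c: "x \<in> carrier A" "y \<in> carrier A" "z \<in> carrier A" and "mv_le A x z" "mv_le A y z"
  shows "mv_le A (oplus A (mv_times A x (neg A y)) y) z"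
proof -
  have "mv_le A (oplus A (mv_times A x (neg A y)) y) (oplus A (mv_times A z (neg A y)) y)"
    using assms by (simp add: oplus_mono_left times_mono_left closed)
  then show ?thesis using le_join_eq assms by simp
qed

text \<open>A sum with \<open>x\<close> below \<open>neg A y\<close> is not truncated, so
  \<open>y\<close> can be subtracted again. The left side is the meet of \<open>x\<close> and
  \<open>neg A y\<close>; its negation is the join of \<open>neg A x\<close> and \<open>y\<close>,
  which \<open>join_commute\<close> evaluates.\<close>

lemma times_oplus_cancel:
  assumes c: "x \<in> carrier A" "y \<in> carrier A" and "mv_le A x (neg A y)"
  shows "mv_times A (neg A y) (oplus A x y) = x"
proof -
  have "oplus A (mv_times A (neg A x) (neg A (neg A (neg A y)))) (neg A (neg A y))  =
     oplus A (mv_times A (neg A (neg A y)) (neg A (neg A x))) (neg A x)"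
    using join_commute[of "neg A x" "neg A (neg A y)"] c closed by simp
  also have "\<dots> = neg A x"
    using le_join_eq(2)[of "neg A (neg A y)" "neg A x"] le_join_eq(1)[of "neg A (neg A y)" "neg A x"]
      assms by (simp add: neg_le_iff closed)
  finally have "oplus A (neg A (oplus A x y)) y = neg A x" using c by (simp add: neg_neg closed neg_oplus_eq)
  then have "neg A (mv_times A (neg A y) (oplus A x y)) = neg A x"
    using c oplus_commute by (simp add: neg_times closed neg_neg)
  then show ?thesis using c neg_eq_iff closed by metis
qed

lemma oplus_cancel:
  assumes c: "x \<in> carrier A" "y \<in> carrier A" "z \<in> carrier A"
    and "mv_le A x (neg A z)" "mv_le A y (neg A z)" "oplus A x z = oplus A y z"
  shows "x = y"
  using times_oplus_cancel assms by metis

text \<open>Let \<open>j\<close> be the join. Adding \<open>w\<close> to \<open>x\<close> or to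
  \<open>y\<close> stays below \<open>j\<close>, so \<open>x\<close> and \<open>y\<close> lie below
  \<open>j\<close> minus \<open>w\<close>, and hence so does \<open>j\<close>. Thus adding
  \<open>w\<close> to \<open>j\<close> changes nothing although this sum is not truncated, and
  cancellation gives zero.\<close>

lemma minus_disjoint:
  assumes c: "x \<in> carrier A" "y \<in> carrier A" "w \<in> carrier A"
    and w: "mv_le A w (mv_times A x (neg A y))" "mv_le A w (mv_times A y (neg A x))"
  shows "w = zero A"
proof -
  define j where "j = oplus A (mv_times A x (neg A y)) y"
  have j: "j \<in> carrier A" "mv_le A x j" "mv_le A y j"
    using c join_upper[of x y] by (auto simp: j_def closed)
  have j2: "j = oplus A (mv_times A y (neg A x)) x" using join_commute c by (simp add: j_def)
  have wx: "mv_le A w x" "mv_le A w (neg A y)" "mv_le A w y" "mv_le A w (neg A x)"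
    using le_trans[OF _ _ _ w(1) times_le_left] le_trans[OF _ _ _ w(1) times_le_right]
      le_trans[OF _ _ _ w(2) times_le_left] le_trans[OF _ _ _ w(2) times_le_right] c
    by (simp_all add: closed)
  have "mv_le A (oplus A w x) j" "mv_le A (oplus A w y) j"
    using oplus_mono_left[OF _ _ _ w(2), of x] oplus_mono_left[OF _ _ _ w(1), of y] c
    unfolding j2[symmetric] j_def[symmetric] by (simp_all add: closed)
  moreover have le: "mv_le A z (mv_times A (neg A w) j)"
    if z: "z \<in> carrier A" "mv_le A (oplus A w z) j" "mv_le A w (neg A z)" for z
  proof -
    have "mv_le A z (neg A w)"
      using z c neg_le_iff[of "neg A z" w] by (simp add: neg_neg closed)
    then have "mv_times A (oplus A w z) (neg A w) = z"
      using times_oplus_cancel[of z w] z c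
      by (simp add: closed times_commute[of _ "neg A w"] oplus_commute[of w])
    moreover have "mv_le A (mv_times A (oplus A w z) (neg A w)) (mv_times A j (neg A w))"
      using times_mono_left z c j closed by simp
    ultimately show ?thesis using times_commute[of j "neg A w"] j c closed by simp
  qed
  ultimately have "mv_le A j (mv_times A (neg A w) j)"
    using join_least[of x y "mv_times A (neg A w) j"] wx c j closed by (simp flip: j_def)
  then have "mv_le A (oplus A j w) (oplus A (mv_times A (neg A w) j) w)"
    using oplus_mono_left c j closed by simp
  also have "oplus A (mv_times A (neg A w) j) w = j"
    using le_join_eq(2)[of w j] le_trans[of w x j] times_commute[of j "neg A w"] c j wx closed by simp
  finally have "mv_le A (oplus A j w) j" .
  then have eq: "oplus A w j = j"
    using le_antisym[of "oplus A j w" j] le_oplus[of j w] c j oplus_commute[of w j] closed by simp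
  have "mv_le A j (neg A w)"
    using join_least[of x y "neg A w"] wx c neg_le_iff[of "neg A x" w] neg_le_iff[of "neg A y" w]
    by (simp add: closed neg_neg flip: j_def)
  then have "mv_le A w (neg A j)"
    using c j neg_le_iff[of "neg A w" j] by (simp add: neg_neg closed)
  then have "mv_times A (neg A j) (oplus A w j) = w" using times_oplus_cancel c j by simp
  then show ?thesis using eq times_neg[of j] times_commute[of j "neg A j"] j closed by simp
qed

text \<open>The polar of \<open>u\<close>: the condition says that the meet of \<open>z\<close> and
  \<open>u\<close> is zero. For a sum, \<open>w\<close> below \<open>oplus A x y\<close> puts
  \<open>w\<close> minus \<open>x\<close> below \<open>y\<close>; this difference is then zero, so
  \<open>w\<close> is below \<open>x\<close>.\<close>

lemma polar_ideal:
  assumes u: "u \<in> carrier A"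
  shows "mv_ideal A {z \<in> carrier A. \<forall>w\<in>carrier A. mv_le A w z \<and> mv_le A w u \<longrightarrow> w = zero A}"
    (is "mv_ideal A ?J")
  unfolding mv_ideal_def
proof (intro conjI ballI impI)
  show "?J \<subseteq> carrier A" by blast
  show "zero A \<in> ?J" using le_zero zero_closed by blast
next
  fix x y assume "x \<in> ?J" "y \<in> ?J"
  have "w = zero A"
    if w: "w \<in> carrier A" "mv_le A w (oplus A x y)" "mv_le A w u" for w
  proof -
    have c: "x \<in> carrier A" "y \<in> carrier A" using \<open>x \<in> ?J\<close> \<open>y \<in> ?J\<close> by auto
    have "mv_le A (mv_times A w (neg A x)) y"
      using w c by (simp add: residuation neg_neg closed)
    moreover have "mv_le A (mv_times A w (neg A x)) u"
      using le_trans[OF _ _ _ times_le_left[of w "neg A x"] w(3)] w c u closed by simp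
    moreover have "mv_times A w (neg A x) \<in> carrier A" using w c closed by simp
    ultimately have "mv_times A w (neg A x) = zero A" using \<open>y \<in> ?J\<close> by blast
    then have "mv_le A w x" using times_eq_zero_iff[of w "neg A x"] w c by (simp add: neg_neg closed)
    then show ?thesis using \<open>x \<in> ?J\<close> w by blast
  qed
  moreover have "oplus A x y \<in> carrier A" using \<open>x \<in> ?J\<close> \<open>y \<in> ?J\<close> by (simp add: closed)
  ultimately show "oplus A x y \<in> ?J" by blast
next
  fix x y assume xy: "x \<in> carrier A" "y \<in> ?J" "mv_le A x y"
  have "w = zero A" if w: "w \<in> carrier A" "mv_le A w x" "mv_le A w u" for w
    using le_trans[OF w(1) xy(1) _ w(2) xy(3)] xy(2) w by blast
  then show "x \<in> ?J" using xy by blast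
qed

end

text \<open>The polar of the truncated difference \<open>v\<close> contains the other difference
  \<open>u\<close>. If it is the zero ideal, \<open>u\<close> is zero; if it is everything, it
  contains \<open>v\<close> itself, which then vanishes.\<close>

lemma simple_mv_linear:
  assumes A: "simple_mv A" and c: "x \<in> carrier A" "y \<in> carrier A"
  shows "mv_le A x y \<or> mv_le A y x"
proof -
  interpret mv_algebra A using A by (simp add: simple_mv_def)
  define u where "u = mv_times A x (neg A y)"
  define v where "v = mv_times A y (neg A x)"
  have uv: "u \<in> carrier A" "v \<in> carrier A" using c by (simp_all add: u_def v_def closed)
  let ?J = "{z \<in> carrier A. \<forall>w\<in>carrier A. mv_le A w z \<and> mv_le A w v \<longrightarrow> w = zero A}"
  have "u \<in> ?J" using uv minus_disjoint[OF c] by (auto simp: u_def v_def)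
  have "?J = {zero A} \<or> ?J = carrier A"
    using A polar_ideal[OF uv(2)] by (simp add: simple_mv_def)
  then have "u = zero A \<or> v \<in> ?J" using \<open>u \<in> ?J\<close> uv by blast
  then have "u = zero A \<or> v = zero A" using le_refl[OF uv(2)] uv(2) by blast
  moreover have "mv_le A x y \<longleftrightarrow> u = zero A" "mv_le A y x \<longleftrightarrow> v = zero A"
    using c times_eq_zero_iff[of x "neg A y"] times_eq_zero_iff[of y "neg A x"]
    by (simp_all add: u_def v_def neg_neg closed)
  ultimately show ?thesis by blast
qed

section \<open>Chains and their homomorphism into the unit interval\<close>

locale mv_chain = mv_algebra +
  assumes linear: "x \<in> carrier A \<Longrightarrow> y \<in> carrier A \<Longrightarrow> mv_le A x y \<or> mv_le A y x"
begin

text \<open>\<open>residue x y\<close> and \<open>carry x y\<close> are the fractional and the integral part of \<open>x + y\<close>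
  in the ordered group with strong unit that belongs to the chain.\<close>

definition residue :: "'a \<Rightarrow> 'a \<Rightarrow> 'a" where
  "residue x y = (if oplus A x y = mv_one A then mv_times A x y else oplus A x y)"

definition carry :: "'a \<Rightarrow> 'a \<Rightarrow> real" where
  "carry x y = (if oplus A x y = mv_one A then 1 else 0)"

lemma residue_closed: "x \<in> carrier A \<Longrightarrow> y \<in> carrier A \<Longrightarrow> residue x y \<in> carrier A"
  by (simp add: residue_def closed)

lemma residue_commute: "x \<in> carrier A \<Longrightarrow> y \<in> carrier A \<Longrightarrow> residue x y = residue y x"
  and carry_commute: "x \<in> carrier A \<Longrightarrow> y \<in> carrier A \<Longrightarrow> carry x y = carry y x"
  by (simp_all add: residue_def carry_def oplus_commute[of x y] times_commute[of x y])

lemma oplus_eq_one_iff: "x \<in> carrier A \<Longrightarrow> oplus A x y = mv_one A \<longleftrightarrow> mv_le A (neg A x) y"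
  by (simp add: le_iff neg_neg)

lemma not_one_le:
  assumes "x \<in> carrier A" "y \<in> carrier A" "oplus A x y \<noteq> mv_one A"
  shows "mv_le A x (neg A y)"
proof -
  have "mv_le A y (neg A x)" using assms linear[of "neg A x" y] by (simp add: oplus_eq_one_iff closed)
  then show ?thesis using assms neg_le_iff[of "neg A x" y] by (simp add: neg_neg closed)
qed

lemma le_neg_commute:
  assumes "x \<in> carrier A" "y \<in> carrier A" "mv_le A x (neg A y)"
  shows "mv_le A y (neg A x)"
  using assms neg_le_iff[of "neg A y" x] by (simp add: neg_neg closed)

lemma neg_le_commute:
  assumes "x \<in> carrier A" "y \<in> carrier A" "mv_le A (neg A x) y"
  shows "mv_le A (neg A y) x"
  using assms neg_le_iff[of x "neg A y"] by (simp add: neg_neg closed)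

text \<open>Both sides are the positive part of \<open>x + y + z - 1\<close> in the ordered group.
  In the first case both give \<open>oplus A x y\<close> when \<open>neg A z\<close> is added and
  both are below \<open>z\<close>, so \<open>oplus_cancel\<close> applies; in the second both are
  zero.\<close>

lemma oplus_times_assoc:
  assumes c: "x \<in> carrier A" "y \<in> carrier A" "z \<in> carrier A"
    and xy: "mv_le A x (neg A y)" and yz: "mv_le A y (neg A z)"
  shows "mv_times A (oplus A x y) z = mv_times A x (oplus A y z)"
proof (cases "mv_le A (neg A z) (oplus A x y)")
  case True
  let ?p = "mv_times A (oplus A x y) z" and ?q = "mv_times A x (oplus A y z)"
  have p: "oplus A ?p (neg A z) = oplus A x y"
    using le_join_eq(2)[of "neg A z" "oplus A x y"] True c by (simp add: neg_neg closed)
  have "mv_le A (mv_times A (neg A z) (neg A y)) x"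
    using True c by (simp add: residuation closed neg_neg oplus_commute[of y])
  then have "mv_le A (neg A (oplus A y z)) x"
    using c by (simp add: neg_oplus_eq times_commute[of "neg A y"] closed)
  then have x: "oplus A ?q (neg A (oplus A y z)) = x"
    using le_join_eq(2)[of "neg A (oplus A y z)" x] c by (simp add: neg_neg closed)
  have z: "oplus A (neg A (oplus A y z)) y = neg A z"
    using le_join_eq(2)[of y "neg A z"] yz c
    by (simp add: neg_oplus_eq times_commute[of "neg A y"] closed)
  have "oplus A ?q (neg A z) = oplus A x y"
    using oplus_assoc[of ?q "neg A (oplus A y z)" y] c by (simp add: x z closed)
  moreover have "mv_le A ?q z"
  proof -
    have "mv_le A ?q (mv_times A (neg A y) (oplus A y z))"
      using c xy by (simp add: times_mono_left closed)
    moreover have "mv_le A (mv_times A (neg A y) (oplus A y z)) z"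
      using c by (simp add: times_commute[of "neg A y"] residuation neg_neg closed le_refl)
    ultimately show ?thesis by (rule le_trans[rotated 3]) (use c closed in simp_all)
  qed
  moreover have "mv_le A ?p z" using times_le_right c closed by simp
  ultimately show ?thesis using oplus_cancel[of ?p ?q "neg A z"] p c by (simp add: neg_neg closed)
next
  case False
  then have le: "mv_le A (oplus A x y) (neg A z)" using linear[of "neg A z" "oplus A x y"] c closed by auto
  then have "mv_times A (oplus A x y) z = zero A" using c by (simp add: times_eq_zero_iff closed)
  moreover have "mv_le A x (neg A (oplus A y z))"
  proof -
    have "mv_times A (oplus A x y) (neg A y) = x"
      using times_oplus_cancel[of x y] xy c times_commute closed by simp
    then have "mv_le A x (mv_times A (neg A z) (neg A y))"
      using times_mono_left[OF _ _ _ le, of "neg A y"] c by (simp add: closed)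
    then show ?thesis using c by (simp add: neg_oplus_eq times_commute[of "neg A y"] closed)
  qed
  then have "mv_times A x (oplus A y z) = zero A" using c by (simp add: times_eq_zero_iff closed)
  ultimately show ?thesis by simp
qed

lemma times_oplus_assoc:
  assumes c: "x \<in> carrier A" "y \<in> carrier A" "z \<in> carrier A"
    and xy: "mv_le A (neg A x) y" and yz: "mv_le A (neg A y) z"
  shows "oplus A (mv_times A x y) z = oplus A x (mv_times A y z)"
proof -
  have "mv_times A (oplus A (neg A x) (neg A y)) (neg A z) =
        mv_times A (neg A x) (oplus A (neg A y) (neg A z))"
    using c xy yz by (intro oplus_times_assoc) (simp_all add: closed neg_neg)
  then have "neg A (oplus A (mv_times A x y) z) = neg A (oplus A x (mv_times A y z))"
    using c by (simp add: neg_oplus_eq neg_times closed)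
  then show ?thesis using c by (simp add: neg_eq_iff closed)
qed

text \<open>Both sides are \<open>x + y + z - 1\<close>: added to \<open>neg A x\<close>, each gives
  \<open>oplus A y z\<close>, and each is below \<open>x\<close>.\<close>

lemma oplus_times_swap:
  assumes c: "x \<in> carrier A" "y \<in> carrier A" "z \<in> carrier A"
    and xy: "mv_le A (neg A x) y" and yz: "mv_le A y (neg A z)"
  shows "oplus A (mv_times A x y) z = mv_times A x (oplus A y z)"
proof -
  let ?p = "oplus A (mv_times A x y) z" and ?q = "mv_times A x (oplus A y z)"
  have "oplus A (mv_times A x y) (neg A x) = y"
    using le_join_eq(2)[of "neg A x" y] xy c by (simp add: times_commute[of x] neg_neg closed)
  moreover have "oplus A ?p (neg A x) = oplus A (oplus A (mv_times A x y) (neg A x)) z"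
    using c by (simp add: oplus_assoc oplus_commute[of z] closed)
  ultimately have p: "oplus A ?p (neg A x) = oplus A y z" by simp
  have "mv_le A (neg A x) (oplus A y z)"
    using le_trans[OF _ _ _ xy le_oplus[of y z]] c closed by simp
  then have q: "oplus A ?q (neg A x) = oplus A y z"
    using le_join_eq(2)[of "neg A x" "oplus A y z"] c by (simp add: times_commute[of x] neg_neg closed)
  have "mv_le A (oplus A z (mv_times A x y)) (oplus A (neg A y) (mv_times A x y))"
    using oplus_mono_left le_neg_commute[OF c(2,3) yz] c closed by simp
  also have "oplus A (neg A y) (mv_times A x y) = x"
    using le_join_eq(2)[of "neg A y" x] neg_le_commute[OF c(1,2) xy] c
    by (simp add: oplus_commute[of "neg A y"] neg_neg closed)
  finally have "mv_le A ?p x" using c by (simp add: oplus_commute[of z] closed)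
  moreover have "mv_le A ?q x" using times_le_left c closed by simp
  ultimately show ?thesis using oplus_cancel[of ?p ?q "neg A x"] p q c by (simp add: neg_neg closed)
qed

text \<open>The total passes 1 exactly once: in the first addition on the left and in the second one
  on the right.\<close>

lemma residue_carry_mixed:
  assumes c: "x \<in> carrier A" "y \<in> carrier A" "z \<in> carrier A"
    and xy: "oplus A x y = mv_one A" and yz: "oplus A y z \<noteq> mv_one A"
  shows "residue (residue x y) z = residue x (residue y z)"
    and "carry x y + carry (residue x y) z = carry y z + carry x (residue y z)"
proof -
  have "mv_le A (oplus A (mv_times A x y) z) (oplus A y z)"
    using oplus_mono_left times_le_right c closed by simp
  then have n: "oplus A (mv_times A x y) z \<noteq> mv_one A"
    using yz le_antisym[of "oplus A y z" "mv_one A"] le_one c closed by auto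
  have o: "oplus A x (oplus A y z) = mv_one A"
    using oplus_assoc[of x y z] c xy one_oplus by simp
  have "oplus A (mv_times A x y) z = mv_times A x (oplus A y z)"
    using oplus_times_swap c xy not_one_le[OF c(2,3) yz] oplus_eq_one_iff by simp
  then show "residue (residue x y) z = residue x (residue y z)"
    and "carry x y + carry (residue x y) z = carry y z + carry x (residue y z)"
    using n o xy yz by (simp_all add: residue_def carry_def)
qed

text \<open>Both bracketings compute the fractional and the integral part of
  \<open>x + y + z\<close>. The cases are whether each inner sum reaches 1; the fourth follows from
  the third by exchanging \<open>x\<close> and \<open>z\<close>.\<close>

lemma
  assumes c: "x \<in> carrier A" "y \<in> carrier A" "z \<in> carrier A"
  shows residue_assoc: "residue (residue x y) z = residue x (residue y z)"
    and carry_cocycle: "carry x y + carry (residue x y) z = carry y z + carry x (residue y z)"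
proof -
  have "residue (residue x y) z = residue x (residue y z) \<and>
    carry x y + carry (residue x y) z = carry y z + carry x (residue y z)"
  proof (cases "oplus A x y = mv_one A"; cases "oplus A y z = mv_one A")
    assume xy: "oplus A x y \<noteq> mv_one A" and yz: "oplus A y z \<noteq> mv_one A"
    show ?thesis
      using xy yz oplus_times_assoc[OF c not_one_le[OF c(1,2) xy] not_one_le[OF c(2,3) yz]]
      by (simp add: residue_def carry_def oplus_assoc c)
  next
    assume xy: "oplus A x y = mv_one A" and yz: "oplus A y z = mv_one A"
    then have "oplus A (mv_times A x y) z = oplus A x (mv_times A y z)"
      using times_oplus_assoc[OF c] c by (simp add: oplus_eq_one_iff)
    then show ?thesis
      using xy yz by (simp add: residue_def carry_def times_assoc c)
  next
    assume "oplus A x y = mv_one A" "oplus A y z \<noteq> mv_one A"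
    then show ?thesis using residue_carry_mixed[OF c] by simp
  next
    assume "oplus A x y \<noteq> mv_one A" "oplus A y z = mv_one A"
    then have "residue (residue z y) x = residue z (residue y x)"
      "carry z y + carry (residue z y) x = carry y x + carry z (residue y x)"
      using residue_carry_mixed[OF c(3,2,1)] c oplus_commute by auto
    then show ?thesis
      using c residue_commute[of z y] residue_commute[of y x] carry_commute[of z y] carry_commute[of y x]
        residue_commute[of x "residue y z"] residue_commute[of z "residue x y"]
        carry_commute[of x "residue y z"] carry_commute[of z "residue x y"]
      by (simp add: residue_closed)
  qed
  then show "residue (residue x y) z = residue x (residue y z)"
    and "carry x y + carry (residue x y) z = carry y z + carry x (residue y z)" by auto
qed

text \<open>Two bracketings of \<open>x + y + x + y\<close>. The carry of \<open>x + y\<close>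
  counts twice because this sum occurs in two copies.\<close>

lemma residue_double:
  assumes c: "x \<in> carrier A" "y \<in> carrier A"
  shows "residue (residue x y) (residue x y) = residue (residue x x) (residue y y)" (is ?R)
    and "carry (residue x y) (residue x y) + 2 * carry x y =
      carry x x + carry y y + carry (residue x x) (residue y y)" (is ?C)
proof -
  let ?xy = "residue x y" and ?xx = "residue x x" and ?yy = "residue y y"
  note cl = residue_closed c
  have 1: "residue ?xy x = residue ?xx y"
    using residue_assoc[of x x y] residue_commute[of x ?xy] by (simp add: cl)
  have "residue ?xy ?xy = residue (residue ?xy x) y" by (simp add: residue_assoc cl)
  also have "\<dots> = residue ?xx ?yy" unfolding 1 by (simp add: residue_assoc cl)
  finally show ?R .
  have "carry ?xy x + carry (residue ?xx y) y = carry x y + carry ?xy ?xy"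
    using carry_cocycle[of ?xy x y] by (simp add: cl 1)
  moreover have "carry x x + carry ?xx y = carry x y + carry ?xy x"
    using carry_cocycle[of x x y] carry_commute[of x ?xy] by (simp add: cl)
  moreover have "carry ?xx y + carry (residue ?xx y) y = carry y y + carry ?xx ?yy"
    using carry_cocycle[of ?xx y y] by (simp add: cl)
  ultimately show ?C by simp
qed

text \<open>The binary expansion of \<open>x\<close> is read off by repeated doubling in the ordered group.\<close>

definition binary_value :: "'a \<Rightarrow> real" where
  "binary_value x = (\<Sum>i. carry (((\<lambda>y. residue y y) ^^ i) x) (((\<lambda>y. residue y y) ^^ i) x) * (1/2) ^ Suc i)"

lemma summable_binary: "summable (\<lambda>i. carry (((\<lambda>y. residue y y) ^^ i) x) (((\<lambda>y. residue y y) ^^ i) x) * (1/2) ^ Suc i)"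
  by (rule summable_comparison_test[OF _ sums_summable[OF power_half_series]])
    (auto simp: carry_def)

lemma binary_value_bounds: "0 \<le> binary_value x" "binary_value x \<le> 1"
proof -
  show "0 \<le> binary_value x"
    unfolding binary_value_def by (rule suminf_nonneg[OF summable_binary]) (simp add: carry_def)
  have "binary_value x \<le> (\<Sum>i. (1/2) ^ Suc i)"
    unfolding binary_value_def
    by (rule suminf_le[OF _ summable_binary sums_summable[OF power_half_series]]) (simp add: carry_def)
  then show "binary_value x \<le> 1" using sums_unique[OF power_half_series] by simp
qed

lemma binary_value_step: "binary_value x = (carry x x + binary_value (residue x x)) / 2"
proof -
  let ?D = "\<lambda>y. residue y y"
  let ?f = "\<lambda>x i. carry ((?D ^^ i) x) ((?D ^^ i) x) * (1/2) ^ Suc i"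
  have "binary_value x = (\<Sum>i. ?f x (Suc i)) + ?f x 0"
    unfolding binary_value_def using suminf_split_head[OF summable_binary[of x]] by simp
  also have "(\<lambda>i. ?f x (Suc i)) = (\<lambda>i. (1/2) * ?f (?D x) i)"
    by (simp add: funpow_swap1[of ?D] fun_eq_iff)
  also have "(\<Sum>i. (1/2) * ?f (?D x) i) = (1/2) * binary_value (?D x)"
    unfolding binary_value_def by (rule suminf_mult[OF summable_binary])
  finally show ?thesis by (simp add: field_simps)
qed

text \<open>The defect \<open>E\<close> is bounded, and doubling both arguments doubles it; so
  \<open>E x y\<close> is at most a constant times \<open>(1/2) ^ n\<close> for every
  \<open>n\<close>.\<close>

lemma binary_value_add:
  assumes c: "x \<in> carrier A" "y \<in> carrier A"
  shows "binary_value x + binary_value y = carry x y + binary_value (residue x y)"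
proof -
  define E where "E x y = binary_value x + binary_value y - carry x y - binary_value (residue x y)" for x y
  have step: "E x y = E (residue x x) (residue y y) / 2" if "x \<in> carrier A" "y \<in> carrier A" for x y
    using residue_double[OF that] binary_value_step[of x] binary_value_step[of y]
      binary_value_step[of "residue x y"]
    unfolding E_def by (simp add: field_simps)
  have "\<bar>E x y\<bar> \<le> 3 * (1/2) ^ n" if "x \<in> carrier A" "y \<in> carrier A" for n x y
    using that
  proof (induction n arbitrary: x y)
    case 0
    show ?case
      using binary_value_bounds[of x] binary_value_bounds[of y] binary_value_bounds[of "residue x y"]
      by (simp add: E_def carry_def abs_le_iff)
  next
    case (Suc n)
    then show ?case
      using Suc.IH[OF residue_closed residue_closed, of x x y y] by (simp add: step[OF Suc.prems])
  qed
  then have bound: "\<bar>E x y\<bar> \<le> 3 * (1/2) ^ n" for n using c by blast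
  have "(\<lambda>n. 3 * (1/2) ^ n :: real) \<longlonglongrightarrow> 3 * 0"
    by (intro tendsto_mult tendsto_const LIMSEQ_realpow_zero) auto
  then have "\<bar>E x y\<bar> \<le> 3 * 0" by (rule LIMSEQ_le_const) (use bound in blast)
  then show ?thesis by (simp add: E_def)
qed

lemma binary_value_one: "binary_value (mv_one A) = 1"
  using binary_value_step[of "mv_one A"] by (simp add: carry_def residue_def oplus_one one_times closed)

text \<open>The hypothesis makes every digit of zero 0; if zero and one coincided, all of them would
  be 1.\<close>

lemma binary_value_hom:
  assumes ne: "zero A \<noteq> mv_one A"
  shows "binary_value \<in> mv_hom A std_mv"
proof -
  have z: "binary_value (zero A) = 0"
    using binary_value_step[of "zero A"] ne by (simp add: carry_def residue_def oplus_zero closed)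
  have n: "binary_value (neg A x) = 1 - binary_value x" if x: "x \<in> carrier A" for x
    using binary_value_add[of x "neg A x"] x
    by (simp add: carry_def residue_def oplus_neg times_neg closed z)
  have o: "binary_value (oplus A x y) = min (binary_value x + binary_value y) 1"
    if c: "x \<in> carrier A" "y \<in> carrier A" for x y
    using binary_value_add[OF c] binary_value_bounds[of "oplus A x y"] binary_value_bounds[of "mv_times A x y"]
    by (auto simp: carry_def residue_def binary_value_one split: if_splits)
  show ?thesis
    using z n o binary_value_bounds by (auto simp: mv_hom_def std_mv_def)
qed

end

text \<open>Simplicity enters twice: it makes the order linear, so that \<open>binary_value\<close>
  is a homomorphism, and it forces the kernel, an ideal without \<open>mv_one B\<close>, to be
  zero.\<close>

lemma simple_mv_hom_std:
  assumes B: "simple_mv B"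
  obtains h where "h \<in> mv_hom B std_mv" "\<And>x. x \<in> carrier B \<Longrightarrow> h x = 0 \<longleftrightarrow> x = zero B"
proof -
  interpret mv_algebra B using B by (simp add: simple_mv_def)
  interpret mv_chain B
    by unfold_locales (rule simple_mv_linear[OF B])
  have "carrier B \<noteq> {zero B}" using B by (simp add: simple_mv_def)
  then obtain x where x: "x \<in> carrier B" "x \<noteq> zero B" using closed by blast
  have ne: "zero B \<noteq> mv_one B"
    using x le_one[of x] le_zero[of x] by metis
  define h where "h = binary_value"
  have h: "h \<in> mv_hom B std_mv" unfolding h_def by (rule binary_value_hom[OF ne])
  let ?K = "{x \<in> carrier B. h x = 0}"
  have hom: "h (zero B) = 0" "\<And>x. x \<in> carrier B \<Longrightarrow> h (neg B x) = 1 - h x"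
    "\<And>x y. x \<in> carrier B \<Longrightarrow> y \<in> carrier B \<Longrightarrow> h (oplus B x y) = min (h x + h y) 1"
    "\<And>x. x \<in> carrier B \<Longrightarrow> 0 \<le> h x" "h (mv_one B) = 1"
    using h binary_value_one by (auto simp: mv_hom_def std_mv_def h_def)
  have "mv_ideal B ?K"
    unfolding mv_ideal_def
  proof (intro conjI ballI impI)
    fix x y assume "x \<in> carrier B" "y \<in> ?K" "mv_le B x y"
    then have "min (1 - h x + h y) 1 = h (mv_one B)"
      using hom(2)[of x] hom(3)[of "neg B x" y] closed(3)[of x] by (simp add: le_iff)
    then show "x \<in> ?K" using \<open>x \<in> carrier B\<close> \<open>y \<in> ?K\<close> hom(4)[of x] hom(5) by auto
  qed (auto simp: hom closed)
  then have "?K = {zero B} \<or> ?K = carrier B" using B by (simp add: simple_mv_def)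
  moreover have "mv_one B \<in> carrier B" "mv_one B \<notin> ?K" using hom(5) closed by simp_all
  ultimately have "?K = {zero B}" by blast
  then show thesis using that[OF h] hom(1) by blast
qed

section \<open>Homomorphisms into the unit interval and their images\<close>

lemma (in mv_algebra) std_hom:
  assumes h: "h \<in> mv_hom A std_mv"
  shows "h (zero A) = 0"
    and "x \<in> carrier A \<Longrightarrow> h (neg A x) = 1 - h x"
    and "x \<in> carrier A \<Longrightarrow> y \<in> carrier A \<Longrightarrow> h (oplus A x y) = min (h x + h y) 1"
    and "x \<in> carrier A \<Longrightarrow> 0 \<le> h x"
    and "x \<in> carrier A \<Longrightarrow> h x \<le> 1"
    and std_hom_minus: "x \<in> carrier A \<Longrightarrow> y \<in> carrier A \<Longrightarrow> h (mv_minus A x y) = max (h x - h y) 0"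
    and "x \<in> carrier A \<Longrightarrow> y \<in> carrier A \<Longrightarrow>
      h (oplus A (mv_minus A x y) (mv_minus A y x)) = \<bar>h x - h y\<bar>"
proof -
  show 1: "h (zero A) = 0" "x \<in> carrier A \<Longrightarrow> h (neg A x) = 1 - h x"
    "x \<in> carrier A \<Longrightarrow> y \<in> carrier A \<Longrightarrow> h (oplus A x y) = min (h x + h y) 1"
    "x \<in> carrier A \<Longrightarrow> 0 \<le> h x" "x \<in> carrier A \<Longrightarrow> h x \<le> 1" for x y
    using h by (auto simp: mv_hom_def std_mv_def)
  show 2: "h (mv_minus A x y) = max (h x - h y) 0" if "x \<in> carrier A" "y \<in> carrier A" for x y
    using that by (simp add: mv_minus_def 1(2,3) closed)
  assume c: "x \<in> carrier A" "y \<in> carrier A"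
  have "mv_minus A x y \<in> carrier A" "mv_minus A y x \<in> carrier A"
    using c by (simp_all add: mv_minus_def closed)
  then show "h (oplus A (mv_minus A x y) (mv_minus A y x)) = \<bar>h x - h y\<bar>"
    using c 1(4,5)[of x] 1(4,5)[of y] by (auto simp: 1(3) 2)
qed

text \<open>By the Archimedean property a nonzero member of an ideal has a truncated multiple equal
  to 1, and an ideal that contains 1 is everything.\<close>

lemma simple_mv_image_std:
  assumes A: "mv_algebra A" and h: "h \<in> mv_hom A std_mv"
  shows "simple_mv (std_mv\<lparr>carrier := h ` carrier A\<rparr>)" (is "simple_mv ?B")
proof -
  interpret mv_algebra A by fact
  note hom = std_hom[OF h]
  have cl: "0 \<in> h ` carrier A" "1 \<in> h ` carrier A"
    "\<And>u. u \<in> h ` carrier A \<Longrightarrow> 1 - u \<in> h ` carrier A"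
    "\<And>u v. u \<in> h ` carrier A \<Longrightarrow> v \<in> h ` carrier A \<Longrightarrow> min (u + v) 1 \<in> h ` carrier A"
    "\<And>u. u \<in> h ` carrier A \<Longrightarrow> 0 \<le> u \<and> u \<le> 1"
  proof -
    show "0 \<in> h ` carrier A" using hom(1) closed(2) by force
    then show "1 - u \<in> h ` carrier A" if "u \<in> h ` carrier A" for u
      using that hom(2) closed(3) by force
    from this[OF \<open>0 \<in> h ` carrier A\<close>] show "1 \<in> h ` carrier A" by simp
    show "min (u + v) 1 \<in> h ` carrier A" if "u \<in> h ` carrier A" "v \<in> h ` carrier A" for u v
      using that hom(3) closed(1) by (force simp flip: hom(3))
    show "0 \<le> u \<and> u \<le> 1" if "u \<in> h ` carrier A" for u
      using that hom(4,5) by auto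
  qed
  interpret std: mv_algebra std_mv by (rule mv_algebra_std_mv)
  have sub: "u \<in> carrier std_mv" if "u \<in> h ` carrier A" for u
    using cl(5)[OF that] by (simp add: std_mv_def)
  have mv: "mv_algebra ?B"
  proof (rule mv_algebraI)
    show "oplus ?B x y = oplus ?B y x" if "x \<in> carrier ?B" "y \<in> carrier ?B" for x y
      using that by (simp add: std.oplus_commute[of x y] sub)
    show "oplus ?B x (neg ?B (oplus ?B x (neg ?B y))) = oplus ?B y (neg ?B (oplus ?B y (neg ?B x)))"
      if "x \<in> carrier ?B" "y \<in> carrier ?B" for x y
      using that by (simp add: std.lukasiewicz[of x y] sub)
    show "oplus ?B x y \<in> carrier ?B" if "x \<in> carrier ?B" "y \<in> carrier ?B" for x y
      using cl(4)[of x y] that by (simp add: std_mv_def)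
    show "neg ?B x \<in> carrier ?B" if "x \<in> carrier ?B" for x
      using cl(3)[of x] that by (simp add: std_mv_def)
    show "zero ?B \<in> carrier ?B" using cl(1) by (simp add: std_mv_def)
  qed (simp_all add: sub std.oplus_assoc std.oplus_zero std.neg_neg std.oplus_top)
  have ne: "carrier ?B \<noteq> {zero ?B}" using cl(2) by (auto simp: std_mv_def)
  have "J = {zero ?B} \<or> J = carrier ?B" if J: "mv_ideal ?B J" for J
  proof (rule disjCI)
    have sub: "J \<subseteq> h ` carrier A" and J0: "0 \<in> J"
      and Jp: "\<And>u v. u \<in> J \<Longrightarrow> v \<in> J \<Longrightarrow> min (u + v) 1 \<in> J"
      and "\<And>u v. u \<in> h ` carrier A \<Longrightarrow> v \<in> J \<Longrightarrow> min (1 - u + v) 1 = 1 \<Longrightarrow> u \<in> J"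
      using J by (auto simp: mv_ideal_def std_mv_def mv_le_def)
    then have Jd: "u \<in> J" if "u \<in> h ` carrier A" "v \<in> J" "u \<le> v" for u v
      using that by (simp add: min_def)
    assume "J \<noteq> carrier ?B"
    then have "J \<noteq> h ` carrier A" by simp
    have "u = 0" if "u \<in> J" for u
    proof (rule ccontr)
      assume "u \<noteq> 0"
      then have "0 < u" using cl(5)[of u] sub that by auto
      then obtain n :: nat where n: "1 < of_nat n * u"
        using reals_Archimedean3 by blast
      have "min (of_nat n * u) 1 \<in> J" for n
      proof (induction n)
        case (Suc n)
        have "min (min (of_nat n * u) 1 + u) 1 = min (of_nat (Suc n) * u) 1"
          using \<open>0 < u\<close> by (auto simp: algebra_simps min_def)
        then show ?case using Jp[OF Suc \<open>u \<in> J\<close>] by simp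
      qed (simp add: J0)
      from this[of n] have "1 \<in> J" using n by simp
      then have "h ` carrier A \<subseteq> J" using Jd cl(5) by blast
      then show False using sub \<open>J \<noteq> h ` carrier A\<close> by blast
    qed
    then show "J = {zero ?B}" using J0 by (auto simp: std_mv_def)
  qed
  then show ?thesis using mv ne by (simp add: simple_mv_def)
qed

section \<open>Semisimple quotients in terms of homomorphisms\<close>

lemma mv_algebra_quot:
  assumes A: "mv_algebra A" and r: "mv_congruence A r"
  shows "mv_algebra (mv_quot A r)"
proof -
  interpret mv_algebra A by fact
  have car: "carrier (mv_quot A r) = carrier A // r" "zero (mv_quot A r) = r `` {zero A}"
    by (simp_all add: mv_quot_def)
  note q = mv_quot_simps[OF r]
  show ?thesis
  proof (rule mv_algebraI; (unfold car)?; (elim quotientE)?)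
    fix x y z X Y Z
    assume "x \<in> carrier A" "X = r `` {x}" "y \<in> carrier A" "Y = r `` {y}"
    then show "oplus (mv_quot A r) X Y \<in> carrier A // r"
      "oplus (mv_quot A r) X Y = oplus (mv_quot A r) Y X"
      "oplus (mv_quot A r) X (neg (mv_quot A r) (oplus (mv_quot A r) X (neg (mv_quot A r) Y))) =
       oplus (mv_quot A r) Y (neg (mv_quot A r) (oplus (mv_quot A r) Y (neg (mv_quot A r) X)))"
      by (simp_all add: q closed quotientI oplus_commute[of x y] lukasiewicz)
    assume "z \<in> carrier A" "Z = r `` {z}"
    then show "oplus (mv_quot A r) (oplus (mv_quot A r) X Y) Z =
      oplus (mv_quot A r) X (oplus (mv_quot A r) Y Z)"
      using \<open>x \<in> carrier A\<close> \<open>X = r `` {x}\<close> \<open>y \<in> carrier A\<close> \<open>Y = r `` {y}\<close>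
      by (simp add: q closed oplus_assoc)
  next
    fix x X assume "x \<in> carrier A" "X = r `` {x}"
    then show "neg (mv_quot A r) X \<in> carrier A // r"
      "oplus (mv_quot A r) X (r `` {zero A}) = X"
      "neg (mv_quot A r) (neg (mv_quot A r) X) = X"
      "oplus (mv_quot A r) X (neg (mv_quot A r) (r `` {zero A})) = neg (mv_quot A r) (r `` {zero A})"
      by (simp_all add: q closed quotientI oplus_zero neg_neg neg_zero oplus_one)
  qed (simp add: quotientI closed)
qed

text \<open>Project to a simple factor in which the classes of \<open>b\<close> and \<open>c\<close>
  differ and compose with its homomorphism into the unit interval. The latter is injective: two
  elements with the same value have their truncated differences in the kernel, which is
  zero.\<close>

lemma semisimple_quot_separates:
  assumes A: "mv_algebra A" and r: "mv_congruence A r" and ss: "semisimple_mv (mv_quot A r)"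
    and b: "b \<in> carrier A" and c: "c \<in> carrier A" and bc: "(b, c) \<notin> r"
  obtains h where "h \<in> mv_hom A std_mv" "h b \<noteq> h c" "\<And>x y. (x, y) \<in> r \<Longrightarrow> h x = h y"
proof -
  interpret mv_algebra A by fact
  have eq: "equiv (carrier A) r" using r by (simp add: mv_congruence_def)
  note q = mv_quot_simps[OF r]
  obtain I :: "'a set set set" and B :: "'a set set \<Rightarrow> 'a set set mv" and e
    where simple: "\<And>i. i \<in> I \<Longrightarrow> simple_mv (B i)" and e: "subdirect_embedding (mv_quot A r) I B e"
    using ss unfolding semisimple_mv_def by blast
  have e_hom: "e \<in> mv_hom (mv_quot A r) (mv_prod I B)" and inj: "inj_on e (carrier A // r)"
    using e by (auto simp: subdirect_embedding_def mv_quot_def)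
  have cl: "r `` {x} \<in> carrier (mv_quot A r)" if "x \<in> carrier A" for x
    using that by (simp add: mv_quot_def quotientI)
  have ext: "e (r `` {x}) \<in> (\<Pi>\<^sub>E i\<in>I. carrier (B i))" if "x \<in> carrier A" for x
    using e_hom cl[OF that] by (auto simp: mv_hom_def mv_prod_def)
  have "r `` {b} \<noteq> r `` {c}" using bc eq_equiv_class[OF _ eq c] by blast
  then have "e (r `` {b}) \<noteq> e (r `` {c})" using inj_onD[OF inj _ quotientI[OF b] quotientI[OF c]] by blast
  then obtain i where i: "i \<in> I" "e (r `` {b}) i \<noteq> e (r `` {c}) i"
    using PiE_ext[OF ext[OF b] ext[OF c]] by blast
  obtain \<phi> where \<phi>: "\<phi> \<in> mv_hom (B i) std_mv"
    and ker: "\<And>x. x \<in> carrier (B i) \<Longrightarrow> \<phi> x = 0 \<longleftrightarrow> x = zero (B i)"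
    using simple_mv_hom_std[OF simple[OF i(1)]] by blast
  interpret B: mv_algebra "B i" using simple[OF i(1)] by (simp add: simple_mv_def)
  define h where "h x = \<phi> (e (r `` {x}) i)" for x
  have ei: "e (r `` {x}) i \<in> carrier (B i)" if "x \<in> carrier A" for x
    using ext[OF that] i(1) by (auto simp: PiE_def)
  have "\<phi> u \<noteq> \<phi> v" if uv: "u \<in> carrier (B i)" "v \<in> carrier (B i)" "u \<noteq> v" for u v
  proof
    assume "\<phi> u = \<phi> v"
    moreover have "mv_minus (B i) u v \<in> carrier (B i)" "mv_minus (B i) v u \<in> carrier (B i)"
      using uv by (simp_all add: mv_minus_def B.closed)
    ultimately have "mv_minus (B i) u v = zero (B i)" "mv_minus (B i) v u = zero (B i)"
      using ker[of "mv_minus (B i) u v"] ker[of "mv_minus (B i) v u"] uv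
      by (simp_all add: B.std_hom_minus[OF \<phi>])
    then show False using B.minus_eq_zero_iff uv by blast
  qed
  then have "h b \<noteq> h c" using i(2) ei b c by (simp add: h_def)
  moreover have "h \<in> mv_hom A std_mv"
  proof -
    have z: "e (r `` {zero A}) i = zero (B i)"
      using e_hom i(1) by (simp add: mv_hom_def mv_prod_def mv_quot_def)
    have n: "e (r `` {neg A x}) i = neg (B i) (e (r `` {x}) i)" if x: "x \<in> carrier A" for x
    proof -
      have "e (neg (mv_quot A r) (r `` {x})) = neg (mv_prod I B) (e (r `` {x}))"
        using e_hom cl[OF x] by (simp add: mv_hom_def)
      then show ?thesis using i(1) x by (simp add: q mv_prod_def)
    qed
    have p: "e (r `` {oplus A x y}) i = oplus (B i) (e (r `` {x}) i) (e (r `` {y}) i)"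
      if x: "x \<in> carrier A" and y: "y \<in> carrier A" for x y
    proof -
      have "e (oplus (mv_quot A r) (r `` {x}) (r `` {y})) = oplus (mv_prod I B) (e (r `` {x})) (e (r `` {y}))"
        using e_hom cl[OF x] cl[OF y] by (simp add: mv_hom_def)
      then show ?thesis using i(1) x y by (simp add: q mv_prod_def)
    qed
    have "h x \<in> carrier std_mv" if "x \<in> carrier A" for x
      using \<phi> ei[OF that] by (auto simp: h_def mv_hom_def)
    moreover have "h (zero A) = zero std_mv"
      using \<phi> by (simp add: h_def z mv_hom_def)
    moreover have "h (neg A x) = neg std_mv (h x)" if "x \<in> carrier A" for x
      using \<phi> that ei by (simp add: h_def n mv_hom_def)
    moreover have "h (oplus A x y) = oplus std_mv (h x) (h y)" if "x \<in> carrier A" "y \<in> carrier A" for x y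
      using \<phi> that ei by (simp add: h_def p mv_hom_def)
    ultimately show ?thesis by (auto simp: mv_hom_def)
  qed
  moreover have "h x = h y" if "(x, y) \<in> r" for x y
    using equiv_class_eq[OF eq that] by (simp add: h_def)
  ultimately show thesis using that by blast
qed

text \<open>\<open>H\<close> is a parameter since it is all of \<open>mv_hom A std_mv\<close> in one
  direction of the theorem and the set of point evaluations of \<open>\<M>(X)\<close> in the
  other.\<close>

locale mv_separated = mv_algebra +
  fixes H :: "('a \<Rightarrow> real) set"
  assumes homs: "H \<subseteq> mv_hom A std_mv"
    and separated: "x \<in> carrier A \<Longrightarrow> y \<in> carrier A \<Longrightarrow> (\<And>h. h \<in> H \<Longrightarrow> h x = h y) \<Longrightarrow> x = y"
begin

lemmas hom_simps = std_hom[OF subsetD[OF homs]]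

lemma le_iff_homs:
  assumes c: "x \<in> carrier A" "y \<in> carrier A"
  shows "mv_le A x y \<longleftrightarrow> (\<forall>h\<in>H. h x \<le> h y)"
proof
  assume "mv_le A x y"
  show "\<forall>h\<in>H. h x \<le> h y"
  proof
    fix h assume h: "h \<in> H"
    have "min (1 - h x + h y) 1 = 1"
      using \<open>mv_le A x y\<close> c hom_simps(2)[OF h, of "zero A"] hom_simps(2)[OF h, of x]
        hom_simps(3)[OF h, of "neg A x" y] hom_simps(1)[OF h]
      by (simp add: mv_le_def closed)
    then show "h x \<le> h y" by (simp add: min_def split: if_splits)
  qed
next
  assume "\<forall>h\<in>H. h x \<le> h y"
  then have "h (oplus A (neg A x) y) = h (neg A (zero A))" if "h \<in> H" for h
    using c that by (simp add: hom_simps(1-3)[OF that] closed)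
  then show "mv_le A x y" unfolding mv_le_def using c by (intro separated) (auto simp: closed)
qed

lemma principal_ideal_eq:
  assumes a: "a \<in> carrier A"
  shows "principal_ideal A a = {x \<in> carrier A. \<exists>m::nat. \<forall>h\<in>H. h x \<le> m * h a}" (is "_ = ?K")
proof
  have "mv_ideal A ?K"
    unfolding mv_ideal_def
  proof (intro conjI ballI impI)
    show "zero A \<in> ?K" by (auto simp: closed dest: hom_simps(1) intro!: exI[of _ 0])
    show "oplus A x y \<in> ?K" if xy: "x \<in> ?K" "y \<in> ?K" for x y
    proof -
      obtain m n :: nat where mn: "\<forall>h\<in>H. h x \<le> m * h a" "\<forall>h\<in>H. h y \<le> n * h a"
        using xy by blast
      have "h (oplus A x y) \<le> real (m + n) * h a" if h: "h \<in> H" for h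
      proof -
        have "h x + h y \<le> m * h a + n * h a" using mn h by (intro add_mono) auto
        then show ?thesis using xy by (simp add: hom_simps(3)[OF h] algebra_simps)
      qed
      then have "\<forall>h\<in>H. h (oplus A x y) \<le> real (m + n) * h a" by blast
      moreover have "oplus A x y \<in> carrier A" using xy by (simp add: closed)
      ultimately show ?thesis by blast
    qed
    show "x \<in> ?K" if "x \<in> carrier A" "y \<in> ?K" "mv_le A x y" for x y
      using that le_iff_homs[of x y] by (fastforce intro: order_trans)
  qed blast
  moreover have "a \<in> ?K" using a by (auto intro!: exI[of _ 1])
  ultimately show "principal_ideal A a \<subseteq> ?K" by (auto simp: principal_ideal_def)
  show "?K \<subseteq> principal_ideal A a"
    unfolding principal_ideal_def
  proof (intro subsetI InterI; elim CollectE conjE exE)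
    fix x J and m :: nat
    assume x: "x \<in> carrier A" "\<forall>h\<in>H. h x \<le> m * h a" and J: "mv_ideal A J" "a \<in> J"
    \<comment> \<open>The \<open>n\<close>-fold truncated sum of \<open>a\<close>; its value at
      \<open>h\<close> is \<open>n * h a\<close>, cut off at 1.\<close>
    define ma where "ma n = ((oplus A a) ^^ n) (zero A)" for n
    have ma: "ma n \<in> J \<and> (\<forall>h\<in>H. h (ma n) = min (n * h a) 1)" for n
    proof (induction n)
      case 0
      show ?case using J hom_simps(1) by (simp add: ma_def mv_ideal_def)
    next
      case (Suc n)
      have "h (ma (Suc n)) = min (real (Suc n) * h a) 1" if "h \<in> H" for h
      proof -
        have "ma n \<in> carrier A" using Suc J by (auto simp: mv_ideal_def)
        then have "h (ma (Suc n)) = min (h a + h (ma n)) 1"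
          using hom_simps(3)[OF that a] by (simp add: ma_def)
        also have "h (ma n) = min (n * h a) 1" using Suc that by blast
        also have "min (h a + min (n * h a) 1) 1 = min (real (Suc n) * h a) 1"
          using hom_simps(4)[OF that a] by (auto simp: distrib_right min_def)
        finally show ?thesis .
      qed
      then show ?case using Suc J by (simp add: ma_def mv_ideal_def)
    qed
    have "h x \<le> h (ma m)" if "h \<in> H" for h
    proof -
      have "h (ma m) = min (m * h a) 1" using ma that by blast
      then show ?thesis using x that hom_simps(5)[OF that x(1)] by simp
    qed
    moreover have "ma m \<in> carrier A" using ma[of m] J by (auto simp: mv_ideal_def)
    ultimately have "mv_le A x (ma m)" using le_iff_homs[of x "ma m"] x(1) by blast
    then show "x \<in> J" using J ma[of m] x(1) unfolding mv_ideal_def by blast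
  qed
qed

lemma ideal_cong_eq:
  assumes a: "a \<in> carrier A"
  shows "ideal_cong A (principal_ideal A a) =
    {(x, y). x \<in> carrier A \<and> y \<in> carrier A \<and> (\<exists>m::nat. \<forall>h\<in>H. \<bar>h x - h y\<bar> \<le> m * h a)}"
proof -
  have "oplus A (mv_minus A x y) (mv_minus A y x) \<in> principal_ideal A a \<longleftrightarrow>
    (\<exists>m::nat. \<forall>h\<in>H. \<bar>h x - h y\<bar> \<le> m * h a)"
    if "x \<in> carrier A" "y \<in> carrier A" for x y
  proof -
    have "(\<forall>h\<in>H. h (oplus A (mv_minus A x y) (mv_minus A y x)) \<le> m * h a) \<longleftrightarrow>
      (\<forall>h\<in>H. \<bar>h x - h y\<bar> \<le> m * h a)" for m
      by (intro ball_cong HOL.refl) (simp only: hom_simps(7)[OF _ that])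
    moreover have "oplus A (mv_minus A x y) (mv_minus A y x) \<in> carrier A"
      using that by (simp add: mv_minus_def closed)
    ultimately show ?thesis by (simp add: principal_ideal_eq[OF a])
  qed
  then show ?thesis by (auto simp: ideal_cong_def)
qed

lemma mv_congruence_principal:
  assumes a: "a \<in> carrier A"
  shows "mv_congruence A (ideal_cong A (principal_ideal A a))" (is "mv_congruence A ?r")
  unfolding mv_congruence_def
proof (intro conjI)
  note r = ideal_cong_eq[OF a]
  show "equiv (carrier A) ?r"
  proof (rule equivI)
    show "?r \<subseteq> carrier A \<times> carrier A" by (auto simp: r)
    show "refl_on (carrier A) ?r"
      by (rule refl_onI) (auto simp: r intro!: exI[of _ 0])
    show "sym ?r" by (auto simp: sym_def r abs_minus_commute)
    show "trans ?r"
    proof (rule transI)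
      fix x y z assume "(x, y) \<in> ?r" "(y, z) \<in> ?r"
      then obtain m n :: nat where c: "x \<in> carrier A" "y \<in> carrier A" "z \<in> carrier A"
        and "\<forall>h\<in>H. \<bar>h x - h y\<bar> \<le> m * h a" "\<forall>h\<in>H. \<bar>h y - h z\<bar> \<le> n * h a"
        unfolding r by blast
      then have "\<forall>h\<in>H. \<bar>h x - h z\<bar> \<le> real (m + n) * h a"
        by (fastforce simp: algebra_simps)
      then show "(x, z) \<in> ?r" unfolding r using c by blast
    qed
  qed
  show "\<forall>(x, y)\<in>?r. (neg A x, neg A y) \<in> ?r"
  proof clarify
    fix x y
    have neg_dist: "\<bar>h (neg A x) - h (neg A y)\<bar> = \<bar>h x - h y\<bar>"
      if "h \<in> H" "x \<in> carrier A" "y \<in> carrier A" for h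
      using that(2,3) by (simp add: hom_simps(2)[OF that(1)] abs_minus_commute)
    moreover assume "(x, y) \<in> ?r"
    ultimately show "(neg A x, neg A y) \<in> ?r"
      unfolding r by (simp add: closed cong: ball_cong)
  qed
  show "\<forall>(x, x')\<in>?r. \<forall>(y, y')\<in>?r. (oplus A x y, oplus A x' y') \<in> ?r"
  proof clarify
    fix x x' y y' assume "(x, x') \<in> ?r" "(y, y') \<in> ?r"
    then obtain m n :: nat where c: "x \<in> carrier A" "x' \<in> carrier A" "y \<in> carrier A" "y' \<in> carrier A"
      and mn: "\<forall>h\<in>H. \<bar>h x - h x'\<bar> \<le> m * h a" "\<forall>h\<in>H. \<bar>h y - h y'\<bar> \<le> n * h a"
      unfolding r by blast
    have "\<bar>h (oplus A x y) - h (oplus A x' y')\<bar> \<le> real (m + n) * h a" if h: "h \<in> H" for h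
    proof -
      have "\<bar>min (h x + h y) 1 - min (h x' + h y') 1\<bar> \<le> \<bar>h x - h x'\<bar> + \<bar>h y - h y'\<bar>"
        by linarith
      also have "\<dots> \<le> m * h a + n * h a" using mn h by (intro add_mono) auto
      finally show ?thesis using c by (simp add: hom_simps(3)[OF h] algebra_simps)
    qed
    then show "(oplus A x y, oplus A x' y') \<in> ?r" unfolding r using c closed(1) by blast
  qed
qed

text \<open>The quotient by the ideal of \<open>a\<close> is embedded by the homomorphisms in
  \<open>H\<close> that vanish at \<open>a\<close>. Injectivity is the hypothesis applied to the
  distance of \<open>x\<close> and \<open>y\<close>, which vanishes at all of them if
  \<open>g\<close> identifies the two classes.\<close>

lemma strongly_semisimpleI:
  assumes *: "\<And>a b. a \<in> carrier A \<Longrightarrow> b \<in> carrier A \<Longrightarrow> (\<And>h. h \<in> H \<Longrightarrow> h a = 0 \<Longrightarrow> h b = 0) \<Longrightarrow>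
    \<exists>m::nat. \<forall>h\<in>H. h b \<le> m * h a"
  shows "strongly_semisimple_mv A"
  unfolding strongly_semisimple_mv_def mv_quot_ideal_def
proof
  fix a assume a: "a \<in> carrier A"
  define r where "r = ideal_cong A (principal_ideal A a)"
  have r: "mv_congruence A r" unfolding r_def by (rule mv_congruence_principal[OF a])
  have eq: "equiv (carrier A) r" using r by (simp add: mv_congruence_def)
  note q = mv_quot_simps[OF r]
  define Z where "Z = {h \<in> H. h a = 0}"
  \<comment> \<open>Each factor is the image of its homomorphism, so that the projections are onto,
    as a subdirect product demands.\<close>
  define B where "B h = std_mv\<lparr>carrier := h ` carrier A\<rparr>" for h
  define g where "g X = (\<lambda>h\<in>Z. h (SOME x. x \<in> X))" for X
  have rZ: "h x = h y" if "(x, y) \<in> r" "h \<in> Z" for h x y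
    using that unfolding r_def ideal_cong_eq[OF a] Z_def by fastforce
  have g: "g (r `` {x}) = (\<lambda>h\<in>Z. h x)" if x: "x \<in> carrier A" for x
  proof -
    define y where "y = (SOME y. y \<in> r `` {x})"
    have "x \<in> r `` {x}" using equiv_class_self[OF eq x] .
    then have "y \<in> r `` {x}" unfolding y_def by (rule someI)
    then have "h y = h x" if "h \<in> Z" for h using rZ[of x y h] that by simp
    then show ?thesis unfolding g_def y_def[symmetric] by (rule restrict_ext)
  qed
  have "simple_mv (B h)" if "h \<in> Z" for h
    unfolding B_def using that homs mv_algebra_axioms by (intro simple_mv_image_std) (auto simp: Z_def)
  moreover have "subdirect_embedding (mv_quot A r) Z B g"
    unfolding subdirect_embedding_def
  proof (intro conjI ballI)
    have car: "carrier (mv_quot A r) = carrier A // r" "zero (mv_quot A r) = r `` {zero A}"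
      by (simp_all add: mv_quot_def)
    have hZ: "h \<in> H" if "h \<in> Z" for h using that by (simp add: Z_def)
    show "g \<in> mv_hom (mv_quot A r) (mv_prod Z B)"
      unfolding mv_hom_def
    proof (intro CollectI conjI ballI funcsetI; (unfold car)?; (elim quotientE)?)
      fix x X assume "x \<in> carrier A" "X = r `` {x}"
      then show "g X \<in> carrier (mv_prod Z B)"
        "g (neg (mv_quot A r) X) = neg (mv_prod Z B) (g X)"
        by (auto simp: g q mv_prod_def B_def closed std_mv_def fun_eq_iff intro!: hom_simps(2) hZ)
    next
      fix x y X Y assume "x \<in> carrier A" "X = r `` {x}" "y \<in> carrier A" "Y = r `` {y}"
      then show "g (oplus (mv_quot A r) X Y) = oplus (mv_prod Z B) (g X) (g Y)"
        by (auto simp: g q mv_prod_def B_def closed std_mv_def fun_eq_iff intro!: hom_simps(3) hZ)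
    next
      show "g (r `` {zero A}) = zero (mv_prod Z B)"
        by (auto simp: g mv_prod_def B_def closed std_mv_def fun_eq_iff intro!: hom_simps(1) hZ)
    qed
    show "inj_on g (carrier (mv_quot A r))"
      unfolding car
    proof (rule inj_onI; elim quotientE)
      fix x y X Y assume "g X = g Y" and c: "x \<in> carrier A" "X = r `` {x}" "y \<in> carrier A" "Y = r `` {y}"
      then have eqZ: "h x = h y" if "h \<in> Z" for h
        using that by (auto simp: g fun_eq_iff restrict_def split: if_splits)
      define b where "b = oplus A (mv_minus A x y) (mv_minus A y x)"
      have b: "b \<in> carrier A" using c by (simp add: b_def mv_minus_def closed)
      have hb: "h b = \<bar>h x - h y\<bar>" if "h \<in> H" for h
        using c by (simp add: b_def hom_simps(7)[OF that])
      have "\<exists>m::nat. \<forall>h\<in>H. h b \<le> m * h a"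
      proof (rule *[OF a b])
        fix h assume "h \<in> H" "h a = 0"
        then show "h b = 0" using hb[of h] eqZ[of h] by (simp add: Z_def)
      qed
      then have "\<exists>m::nat. \<forall>h\<in>H. \<bar>h x - h y\<bar> \<le> m * h a"
        using hb by (simp cong: ball_cong)
      then have "(x, y) \<in> r" unfolding r_def ideal_cong_eq[OF a] using c by blast
      then show "X = Y" using c equiv_class_eq[OF eq] by simp
    qed
    fix h assume h: "h \<in> Z"
    have "(\<lambda>X. g X h) ` (carrier A // r) = h ` carrier A"
    proof
      show "(\<lambda>X. g X h) ` (carrier A // r) \<subseteq> h ` carrier A"
        using h by (auto elim!: quotientE simp: g)
      show "h ` carrier A \<subseteq> (\<lambda>X. g X h) ` (carrier A // r)"
      proof
        fix u assume "u \<in> h ` carrier A"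
        then obtain x where "x \<in> carrier A" "u = h x" by blast
        then have "r `` {x} \<in> carrier A // r" "u = g (r `` {x}) h" using h by (simp_all add: g quotientI)
        then show "u \<in> (\<lambda>X. g X h) ` (carrier A // r)" by blast
      qed
    qed
    then show "(\<lambda>X. g X h) ` carrier (mv_quot A r) = carrier (B h)"
      by (simp add: car B_def)
  qed
  ultimately show "semisimple_mv (mv_quot A r)"
    using semisimple_mvI[OF mv_algebra_quot[OF mv_algebra_axioms r]] by blast
qed

end

text \<open>For separation: the congruence of the ideal of zero is equality, so \<open>A\<close>
  itself is one of the semisimple quotients. For domination: an undominated \<open>b\<close> is not
  congruent to zero, so some homomorphism that respects the congruence is nonzero at
  \<open>b\<close>; it vanishes at \<open>a\<close>, which is congruent to zero.\<close>

lemma strongly_semisimple_homs: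
  assumes A: "mv_algebra A" and ss: "strongly_semisimple_mv A"
  shows "mv_separated A (mv_hom A std_mv)"
    and "\<And>a b. a \<in> carrier A \<Longrightarrow> b \<in> carrier A \<Longrightarrow>
      (\<And>h. h \<in> mv_hom A std_mv \<Longrightarrow> h a = 0 \<Longrightarrow> h b = 0) \<Longrightarrow>
      \<exists>m::nat. \<forall>h\<in>mv_hom A std_mv. h b \<le> m * h a"
proof -
  interpret mv_algebra A by fact
  have "mv_ideal A {zero A}"
    unfolding mv_ideal_def using closed oplus_zero le_zero by auto
  then have p: "principal_ideal A (zero A) = {zero A}"
    by (auto simp: principal_ideal_def mv_ideal_def)
  have z: "u = zero A" if "u \<in> carrier A" "v \<in> carrier A" "oplus A u v = zero A" for u v
    using le_oplus[OF that(1,2)] le_zero[OF that(1)] that(3) by simp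
  have r: "ideal_cong A {zero A} = Id_on (carrier A)"
  proof -
    have "oplus A (mv_minus A x y) (mv_minus A y x) = zero A \<longleftrightarrow> x = y"
      if c: "x \<in> carrier A" "y \<in> carrier A" for x y
    proof -
      have m: "mv_minus A x y \<in> carrier A" "mv_minus A y x \<in> carrier A"
        using c by (simp_all add: mv_minus_def closed)
      have "oplus A (mv_minus A x y) (mv_minus A y x) = zero A \<longleftrightarrow>
        mv_minus A x y = zero A \<and> mv_minus A y x = zero A"
        using z[OF m] z[OF m(2,1)] oplus_commute[OF m] oplus_zero zero_closed by metis
      then show ?thesis using minus_eq_zero_iff c by simp
    qed
    then show ?thesis by (auto simp: ideal_cong_def)
  qed
  have cong: "mv_congruence A (Id_on (carrier A))"
    unfolding mv_congruence_def
    by (auto simp: closed intro!: equivI refl_onI symI transI)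
  show sep: "mv_separated A (mv_hom A std_mv)"
  proof unfold_locales
    fix x y assume c: "x \<in> carrier A" "y \<in> carrier A" and eq: "\<And>h. h \<in> mv_hom A std_mv \<Longrightarrow> h x = h y"
    have "semisimple_mv (mv_quot A (Id_on (carrier A)))"
      using ss closed(2) unfolding strongly_semisimple_mv_def mv_quot_ideal_def by (metis p r)
    then show "x = y"
      using semisimple_quot_separates[OF A cong _ c] eq by (metis Id_onE Id_onI c(1) Pair_inject)
  qed simp
  then interpret mv_separated A "mv_hom A std_mv" .
  fix a b assume a: "a \<in> carrier A" and b: "b \<in> carrier A"
    and ab: "\<And>h. h \<in> mv_hom A std_mv \<Longrightarrow> h a = 0 \<Longrightarrow> h b = 0"
  let ?r = "ideal_cong A (principal_ideal A a)"
  show "\<exists>m::nat. \<forall>h\<in>mv_hom A std_mv. h b \<le> m * h a"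
  proof (rule ccontr)
    assume no: "\<not> ?thesis"
    have "(b, zero A) \<notin> ?r"
    proof
      assume "(b, zero A) \<in> ?r"
      then obtain m :: nat where m: "\<forall>h\<in>mv_hom A std_mv. \<bar>h b - h (zero A)\<bar> \<le> m * h a"
        unfolding ideal_cong_eq[OF a] by blast
      have "h b \<le> real m * h a" if "h \<in> mv_hom A std_mv" for h
        using bspec[OF m that] hom_simps(1)[OF that] by simp
      then show False using no by blast
    qed
    moreover have "semisimple_mv (mv_quot A ?r)"
      using ss a by (simp add: strongly_semisimple_mv_def mv_quot_ideal_def)
    ultimately obtain h where h: "h \<in> mv_hom A std_mv" "h b \<noteq> h (zero A)"
      "\<And>x y. (x, y) \<in> ?r \<Longrightarrow> h x = h y"
      using semisimple_quot_separates[OF A mv_congruence_principal[OF a] _ b closed(2)] by blast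
    have "\<bar>h a - h (zero A)\<bar> \<le> real 1 * h a" if "h \<in> mv_hom A std_mv" for h
      using hom_simps(1)[OF that] hom_simps(4)[OF that a] by simp
    then have "(a, zero A) \<in> ?r"
      unfolding ideal_cong_eq[OF a] using a closed(2) by blast
    then have "h a = 0" using h(3) hom_simps(1)[OF h(1)] by simp
    then show False using ab h(1,2) hom_simps(1)[OF h(1)] by simp
  qed
qed

section \<open>Rational affine functions and simplices\<close>

lemma coord_inner_simps:
  "coord_inner C (a + b) y = coord_inner C a y + coord_inner C b y"
  "coord_inner C y (a + b) = coord_inner C y a + coord_inner C y b"
  "coord_inner C (a - b) y = coord_inner C a y - coord_inner C b y"
  "coord_inner C y (a - b) = coord_inner C y a - coord_inner C y b"
  "coord_inner C (c *\<^sub>R a) y = c * coord_inner C a y"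
  "coord_inner C y (c *\<^sub>R a) = c * coord_inner C y a"
  "coord_inner C y 0 = 0" "coord_inner C 0 y = 0"
  by (simp_all add: coord_inner_def scaleR_fun_def algebra_simps sum.distrib sum_subtractf
      sum_distrib_left)

lemma coord_inner_sum:
  "coord_inner C (\<Sum>j\<in>J. f j) y = (\<Sum>j\<in>J. coord_inner C (f j) y)"
  "coord_inner C y (\<Sum>j\<in>J. f j) = (\<Sum>j\<in>J. coord_inner C y (f j))"
  by (induction J rule: infinite_finite_induct)
    (simp_all only: coord_inner_simps sum.insert sum.infinite sum.empty simp_thms)

lemma coord_inner_commute: "coord_inner C v w = coord_inner C w v"
  by (simp add: coord_inner_def mult.commute)

lemma coord_space_closed:
  "0 \<in> coord_space C"
  "x \<in> coord_space C \<Longrightarrow> y \<in> coord_space C \<Longrightarrow> x + y \<in> coord_space C"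
  "x \<in> coord_space C \<Longrightarrow> y \<in> coord_space C \<Longrightarrow> x - y \<in> coord_space C"
  "x \<in> coord_space C \<Longrightarrow> c *\<^sub>R x \<in> coord_space C"
  by (auto simp: coord_space_def scaleR_fun_def)

lemma coord_space_sum: "(\<And>i. i \<in> I \<Longrightarrow> f i \<in> coord_space C) \<Longrightarrow> (\<Sum>i\<in>I. f i) \<in> coord_space C"
  by (induction I rule: infinite_finite_induct)
    (simp_all only: coord_space_closed sum.insert sum.infinite sum.empty simp_thms insert_iff)

lemma scaleR_fun_apply: "(c *\<^sub>R f) x = c * f x" for f :: "'a \<Rightarrow> real"
  by (simp add: scaleR_fun_def)

lemma sum_fun_apply: "(\<Sum>i\<in>I. f i) x = (\<Sum>i\<in>I. f i x)" for f :: "'i \<Rightarrow> 'a \<Rightarrow> real"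
  by (induction I rule: infinite_finite_induct) simp_all

lemma convex_hull_coord_space:
  assumes "V \<subseteq> coord_space C"
  shows "convex hull V \<subseteq> coord_space C"
  using assms
  by (rule hull_minimal) (simp add: convex_def coord_space_closed)

section \<open>Rational affine functions and barycentric coordinates\<close>

definition rat_affine :: "'i set \<Rightarrow> (('i \<Rightarrow> real) \<Rightarrow> real) \<Rightarrow> bool" where
  "rat_affine C l \<longleftrightarrow> (\<exists>b m. b \<in> \<rat> \<and> (\<forall>i\<in>C. m i \<in> \<rat>) \<and> l = (\<lambda>y. b + coord_inner C m y))"

lemma rat_affine_const: "b \<in> \<rat> \<Longrightarrow> rat_affine C (\<lambda>y. b)"
  unfolding rat_affine_def by (rule exI[of _ b], rule exI[of _ 0]) (simp add: coord_inner_simps)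

lemma rat_affine_inner: "(\<And>i. i \<in> C \<Longrightarrow> m i \<in> \<rat>) \<Longrightarrow> rat_affine C (\<lambda>y. coord_inner C m y)"
  unfolding rat_affine_def by (rule exI[of _ 0], rule exI[of _ m]) simp

lemma rat_affine_add:
  assumes "rat_affine C k" "rat_affine C l"
  shows "rat_affine C (\<lambda>y. k y + l y)"
proof -
  obtain b m b' m' where "b \<in> \<rat>" "\<forall>i\<in>C. m i \<in> \<rat>" "k = (\<lambda>y. b + coord_inner C m y)"
    "b' \<in> \<rat>" "\<forall>i\<in>C. m' i \<in> \<rat>" "l = (\<lambda>y. b' + coord_inner C m' y)"
    using assms unfolding rat_affine_def by blast
  then show ?thesis unfolding rat_affine_def
    by (intro exI[of _ "b + b'"] exI[of _ "m + m'"]) (auto simp: coord_inner_simps)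
qed

lemma rat_affine_scale:
  assumes "rat_affine C l" "c \<in> \<rat>"
  shows "rat_affine C (\<lambda>y. c * l y)"
proof -
  obtain b m where "b \<in> \<rat>" "\<forall>i\<in>C. m i \<in> \<rat>" "l = (\<lambda>y. b + coord_inner C m y)"
    using assms unfolding rat_affine_def by blast
  then show ?thesis using assms(2) unfolding rat_affine_def
    by (intro exI[of _ "c * b"] exI[of _ "c *\<^sub>R m"])
      (auto simp: coord_inner_simps scaleR_fun_apply distrib_left)
qed

lemma rat_affine_minus: "rat_affine C l \<Longrightarrow> rat_affine C (\<lambda>y. - l y)"
  using rat_affine_scale[of C l "-1"] by simp

lemma rat_affine_diff: "rat_affine C k \<Longrightarrow> rat_affine C l \<Longrightarrow> rat_affine C (\<lambda>y. k y - l y)"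
  using rat_affine_add[OF _ rat_affine_minus] by simp

lemma rat_affine_sum: "(\<And>i. i \<in> I \<Longrightarrow> rat_affine C (l i)) \<Longrightarrow> rat_affine C (\<lambda>y. \<Sum>i\<in>I. l i y)"
  by (induction I rule: infinite_finite_induct) (auto intro: rat_affine_const rat_affine_add)

lemma coord_inner_unit:
  assumes "finite C" "i \<in> C"
  shows "coord_inner C (\<lambda>j. if j = i then 1 else 0) y = y i"
proof -
  have "coord_inner C (\<lambda>j. if j = i then 1 else 0) y = (\<Sum>j\<in>C. if j = i then y j else 0)"
    unfolding coord_inner_def by (intro sum.cong) auto
  then show ?thesis using assms by simp
qed

lemma rat_affine_coord:
  assumes "finite C" "i \<in> C"
  shows "rat_affine C (\<lambda>y. y i)"
  using rat_affine_inner[of C "\<lambda>j. if j = i then 1 else 0"]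
  by (simp add: coord_inner_unit[OF assms])

lemma rat_affine_affine_comb:
  assumes "rat_affine C l" "sum c S = 1"
  shows "l (\<Sum>w\<in>S. c w *\<^sub>R w) = (\<Sum>w\<in>S. c w * l w)"
proof -
  obtain b m where l: "l = (\<lambda>y. b + coord_inner C m y)"
    using assms unfolding rat_affine_def by blast
  have "(\<Sum>w\<in>S. c w * l w) = sum c S * b + (\<Sum>w\<in>S. c w * coord_inner C m w)"
    by (simp add: l algebra_simps sum.distrib sum_distrib_left)
  then show ?thesis using assms(2) by (simp add: l coord_inner_sum coord_inner_simps)
qed

lemma rat_affine_rational:
  assumes "rat_affine C l" "\<And>i. i \<in> C \<Longrightarrow> x i \<in> \<rat>"
  shows "l x \<in> \<rat>"
  using assms unfolding rat_affine_def by (auto simp: coord_inner_def intro!: Rats_add Rats_sum)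

text \<open>Barycentric coordinates of an affine basis \<open>W\<close> of the whole space
  \<open>coord_space C\<close>, as rational affine functions. A full basis is kept even for a
  simplex of lower dimension: the basis points outside it supply the equations of its affine
  hull.\<close>

definition affine_coords :: "'i set \<Rightarrow> ('i \<Rightarrow> real) set \<Rightarrow> (('i \<Rightarrow> real) \<Rightarrow> ('i \<Rightarrow> real) \<Rightarrow> real) \<Rightarrow> bool" where
  "affine_coords C W \<beta> \<longleftrightarrow> finite W \<and> W \<subseteq> coord_space C \<and> (\<forall>w\<in>W. rat_affine C (\<beta> w)) \<and>
     (\<forall>y\<in>coord_space C. (\<Sum>w\<in>W. \<beta> w y) = 1 \<and> (\<Sum>w\<in>W. \<beta> w y *\<^sub>R w) = y) \<and>
     (\<forall>w\<in>W. \<forall>w'\<in>W. \<beta> w w' = (if w = w' then 1 else 0))"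

lemma affine_coordsD:
  assumes "affine_coords C W \<beta>"
  shows "finite W" "W \<subseteq> coord_space C" "w \<in> W \<Longrightarrow> rat_affine C (\<beta> w)"
    "y \<in> coord_space C \<Longrightarrow> (\<Sum>w\<in>W. \<beta> w y) = 1"
    "y \<in> coord_space C \<Longrightarrow> (\<Sum>w\<in>W. \<beta> w y *\<^sub>R w) = y"
    "w \<in> W \<Longrightarrow> w' \<in> W \<Longrightarrow> \<beta> w w' = (if w = w' then 1 else 0)"
  using assms unfolding affine_coords_def by blast+

lemma affine_coords_standard:
  assumes C: "finite C"
  shows "\<exists>W \<beta>. affine_coords C W \<beta> \<and> (\<forall>w\<in>W. \<forall>i\<in>C. w i \<in> \<rat>) \<and>
    (\<forall>y\<in>unit_cube C. \<forall>w\<in>W. 0 \<le> \<beta> w y)"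
proof -
  \<comment> \<open>On the cube the coordinates sum to at most \<open>card C\<close>, so the simplex
    with vertices 0 and \<open>N\<close> times the unit vectors contains it. The summand 1 keeps
    \<open>N\<close> positive when \<open>C\<close> is empty.\<close>
  define N :: real where "N = of_nat (card C) + 1"
  have N: "N > 0" "N \<in> \<rat>" by (simp_all add: N_def add_pos_nonneg add.commute)
  define e :: "'a \<Rightarrow> 'a \<Rightarrow> real" where "e i = (\<lambda>j. if j = i then N else 0)" for i
  have e_neq: "e i \<noteq> e k" if "i \<noteq> k" for i k
  proof
    assume "e i = e k"
    then have "e i i = e k i" by simp
    then show False using that N by (simp add: e_def)
  qed
  then have inj: "inj_on e C" by (meson inj_onI)
  have e0: "e i \<noteq> 0" for i
  proof
    assume "e i = 0"
    then have "e i i = 0" by simp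
    then show False using N by (simp add: e_def)
  qed
  have ey: "coord_inner C (e i) y = N * y i" if "i \<in> C" for i y
  proof -
    have "e i = N *\<^sub>R (\<lambda>j. if j = i then 1 else 0)" by (auto simp: e_def scaleR_fun_def)
    then show ?thesis by (simp add: coord_inner_simps coord_inner_unit[OF C that])
  qed
  define W where "W = insert 0 (e ` C)"
  \<comment> \<open>The vertex \<open>e i\<close> has entry \<open>N\<close>, so
    \<open>coord_inner C (e i) y\<close> is \<open>N * y i\<close>, and dividing by
    \<open>N * N\<close> leaves \<open>y i / N\<close>.\<close>
  define \<beta> where "\<beta> w y = (if w = 0 then 1 - (\<Sum>i\<in>C. y i) / N else coord_inner C w y / (N * N))" for w y
  have \<beta>e: "\<beta> (e i) y = y i / N" if "i \<in> C" for i y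
    using N by (simp add: \<beta>_def e0 ey[OF that])
  have sumW: "(\<Sum>w\<in>W. f w) = f 0 + (\<Sum>i\<in>C. f (e i))" for f :: "('a \<Rightarrow> real) \<Rightarrow> 'b::comm_monoid_add"
  proof -
    have "0 \<notin> e ` C" using e0 by (metis imageE)
    then show ?thesis unfolding W_def using C inj by (simp add: sum.reindex)
  qed
  have Wrat: "\<forall>w\<in>W. \<forall>i\<in>C. w i \<in> \<rat>" using N by (auto simp: W_def e_def)
  have "affine_coords C W \<beta>"
    unfolding affine_coords_def
  proof (intro conjI ballI)
    show "finite W" using C by (simp add: W_def)
    show "W \<subseteq> coord_space C" by (auto simp: W_def e_def coord_space_def)
    show "rat_affine C (\<beta> w)" if "w \<in> W" for w
    proof (cases "w = 0")
      case True
      have "rat_affine C (\<lambda>y. 1 - (1 / N) * (\<Sum>i\<in>C. y i))"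
        using N by (intro rat_affine_diff rat_affine_scale rat_affine_const rat_affine_sum rat_affine_coord C) auto
      then show ?thesis using True by (simp add: \<beta>_def[abs_def])
    next
      case False
      have "rat_affine C (\<lambda>y. (1 / (N * N)) * coord_inner C w y)"
        using N Wrat that by (intro rat_affine_scale rat_affine_inner) auto
      then show ?thesis using False by (simp add: \<beta>_def[abs_def])
    qed
    fix y assume y: "y \<in> coord_space C"
    show "(\<Sum>w\<in>W. \<beta> w y) = 1"
      by (simp add: sumW \<beta>e) (simp add: \<beta>_def sum_divide_distrib)
    have "(\<Sum>i\<in>C. (y i / N) *\<^sub>R e i) j = y j" for j
    proof -
      have "(\<Sum>i\<in>C. (y i / N) *\<^sub>R e i) j = (\<Sum>i\<in>C. if i = j then y i else 0)"
        unfolding sum_fun_apply using N by (intro sum.cong) (auto simp: scaleR_fun_def e_def)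
      then show ?thesis using C y by (auto simp: coord_space_def)
    qed
    then have "(\<Sum>i\<in>C. (y i / N) *\<^sub>R e i) = y" by (rule ext)
    then show "(\<Sum>w\<in>W. \<beta> w y *\<^sub>R w) = y"
      by (simp add: sumW \<beta>e)
  next
    fix w w' assume w: "w \<in> W" "w' \<in> W"
    have 1: "(\<Sum>i\<in>C. e k i) = N" if "k \<in> C" for k
      using C that by (simp add: e_def)
    consider "w = 0" "w' = 0" | k where "w = 0" "k \<in> C" "w' = e k" | i where "i \<in> C" "w = e i" "w' = 0"
      | i k where "i \<in> C" "w = e i" "k \<in> C" "w' = e k"
      using w by (auto simp: W_def)
    then show "\<beta> w w' = (if w = w' then 1 else 0)"
    proof cases
      case 1
      then show ?thesis by (simp add: \<beta>_def)
    next
      case (2 k)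
      then show ?thesis using 1[OF 2(2)] N e0[of k] by (simp add: \<beta>_def)
    next
      case (3 i)
      then show ?thesis by (simp add: \<beta>e e0)
    next
      case (4 i k)
      then show ?thesis using e_neq[of i k] N by (cases "i = k") (simp_all add: \<beta>e, simp_all add: e_def)
    qed
  qed
  moreover have "0 \<le> \<beta> w y" if y: "y \<in> unit_cube C" and w: "w \<in> W" for y w
  proof -
    have "(\<Sum>i\<in>C. y i) \<le> (\<Sum>i\<in>C. 1)" using y by (intro sum_mono) (simp add: unit_cube_def)
    then have "(\<Sum>i\<in>C. y i) / N \<le> 1" using N by (simp add: N_def)
    then have "0 \<le> \<beta> 0 y" by (simp add: \<beta>_def)
    moreover have "0 \<le> \<beta> (e i) y" if "i \<in> C" for i
      using \<beta>e[OF that] y that N by (simp add: unit_cube_def)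
    ultimately show ?thesis using w by (auto simp: W_def)
  qed
  ultimately show ?thesis using Wrat by blast
qed

lemma affine_coords_independent:
  assumes W: "affine_coords C W \<beta>"
  shows "\<not> affine_dependent W"
proof
  note fin = affine_coordsD(1)[OF W] and rat = affine_coordsD(3)[OF W] and delta = affine_coordsD(6)[OF W]
  assume "affine_dependent W"
  then obtain v where v: "v \<in> W" "v \<in> affine hull (W - {v})" by (auto simp: affine_dependent_def)
  then obtain c where c: "sum c (W - {v}) = 1" "(\<Sum>w\<in>W - {v}. c w *\<^sub>R w) = v"
    using affine_hull_finite[of "W - {v}"] fin by auto
  have "\<beta> v v = (\<Sum>w\<in>W - {v}. c w * \<beta> v w)"
    using rat_affine_affine_comb[OF rat[OF v(1)] c(1)] c(2) by simp
  also have "\<dots> = 0" using delta[OF v(1)] by (intro sum.neutral) auto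
  finally show False using delta[OF v(1) v(1)] by simp
qed

text \<open>Steinitz exchange. Some \<open>w\<close> outside \<open>V\<close> has
  \<open>\<beta> w v\<close> nonzero, since otherwise \<open>v\<close> would be an affine
  combination of \<open>V\<close>; this \<open>w\<close> is replaced by \<open>v\<close>.\<close>

lemma affine_coords_exchange:
  assumes W: "affine_coords C W \<beta>" and V: "V \<subseteq> W"
    and v: "v \<in> coord_space C" "\<And>i. i \<in> C \<Longrightarrow> v i \<in> \<rat>" "v \<notin> affine hull V"
  shows "\<exists>W' \<beta>'. affine_coords C W' \<beta>' \<and> insert v V \<subseteq> W'"
proof -
  note fin = affine_coordsD(1)[OF W] and sub = affine_coordsD(2)[OF W] and rat = affine_coordsD(3)[OF W]
    and one = affine_coordsD(4)[OF W] and id = affine_coordsD(5)[OF W] and delta = affine_coordsD(6)[OF W]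
  have "\<exists>w\<in>W - V. \<beta> w v \<noteq> 0"
  proof (rule ccontr)
    assume "\<not> ?thesis"
    then have z: "\<forall>w\<in>W - V. \<beta> w v = 0" by blast
    have "(\<Sum>w\<in>V. \<beta> w v) = (\<Sum>w\<in>W. \<beta> w v)" "(\<Sum>w\<in>V. \<beta> w v *\<^sub>R w) = (\<Sum>w\<in>W. \<beta> w v *\<^sub>R w)"
      by (intro sum.mono_neutral_left fin V; simp add: z)+
    then have "v \<in> affine hull V"
      using affine_hull_finite[OF finite_subset[OF V fin]] one[OF v(1)] id[OF v(1)] by force
    then show False using v(3) by simp
  qed
  then obtain w where w: "w \<in> W" "w \<notin> V" "\<beta> w v \<noteq> 0" by blast
  define W1 where "W1 = W - {w}"
  have vW1: "v \<notin> W1"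
  proof
    assume "v \<in> W1"
    then have "\<beta> w v = 0" using delta[OF w(1), of v] by (simp add: W1_def split: if_splits)
    then show False using w(3) by simp
  qed
  have W1: "finite W1" "W1 \<subseteq> W" using fin by (auto simp: W1_def)
  have split: "(\<Sum>u\<in>W. f u) = f w + (\<Sum>u\<in>W1. f u)" for f :: "('a \<Rightarrow> real) \<Rightarrow> 'b::comm_monoid_add"
    unfolding W1_def using sum.remove[OF fin w(1)] .
  \<comment> \<open>\<open>t\<close> is the coordinate at the new point \<open>v\<close>;
    subtracting \<open>\<beta> u v * t y\<close> makes the old coordinates vanish at
    \<open>v\<close>.\<close>
  define t where "t y = \<beta> w y / \<beta> w v" for y
  define \<beta>' where "\<beta>' u y = (if u = v then t y else \<beta> u y - \<beta> u v * t y)" for u y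
  have sum': "(\<Sum>u\<in>insert v W1. f (\<beta>' u y) u) = f (t y) v + (\<Sum>u\<in>W1. f (\<beta> u y - \<beta> u v * t y) u)"
    for f :: "real \<Rightarrow> ('a \<Rightarrow> real) \<Rightarrow> 'b::comm_monoid_add" and y
  proof -
    have "(\<Sum>u\<in>W1. f (\<beta>' u y) u) = (\<Sum>u\<in>W1. f (\<beta> u y - \<beta> u v * t y) u)"
      using vW1 by (intro sum.cong) (auto simp: \<beta>'_def)
    then show ?thesis using vW1 W1 by (simp add: \<beta>'_def)
  qed
  have rv: "\<beta> u v \<in> \<rat>" if "u \<in> W" for u using rat_affine_rational[OF rat[OF that] v(2)] .
  have rt: "rat_affine C t"
    using rat_affine_scale[OF rat[OF w(1)], of "1 / \<beta> w v"] rv[OF w(1)] by (simp add: t_def[abs_def])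
  have "affine_coords C (insert v W1) \<beta>'"
    unfolding affine_coords_def
  proof (intro conjI ballI)
    show "finite (insert v W1)" "insert v W1 \<subseteq> coord_space C" using W1 sub v(1) by auto
    show "rat_affine C (\<beta>' u)" if "u \<in> insert v W1" for u
    proof (cases "u = v")
      case False
      have "rat_affine C (\<lambda>y. \<beta> u y - \<beta> u v * t y)"
        by (intro rat_affine_diff rat_affine_scale rat rt rv) (use that False W1 in auto)
      then show ?thesis using False by (simp add: \<beta>'_def[abs_def])
    qed (simp add: \<beta>'_def[abs_def] rt)
    fix y assume y: "y \<in> coord_space C"
    have tw: "\<beta> w y = t y * \<beta> w v" using w by (simp add: t_def)
    have s1: "(\<Sum>u\<in>W1. \<beta> u y) = 1 - \<beta> w y" "(\<Sum>u\<in>W1. \<beta> u v) = 1 - \<beta> w v"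
      using split[of "\<lambda>u. \<beta> u y"] split[of "\<lambda>u. \<beta> u v"] one[OF y] one[OF v(1)] by simp_all
    have "(\<Sum>u\<in>insert v W1. \<beta>' u y) = t y + ((\<Sum>u\<in>W1. \<beta> u y) - (\<Sum>u\<in>W1. \<beta> u v) * t y)"
      using sum'[of "\<lambda>a u. a"] by (simp add: sum_subtractf sum_distrib_right)
    then show "(\<Sum>u\<in>insert v W1. \<beta>' u y) = 1"
      unfolding s1 tw by (simp add: algebra_simps)
    have s2: "(\<Sum>u\<in>W1. \<beta> u y *\<^sub>R u) = y - \<beta> w y *\<^sub>R w" "(\<Sum>u\<in>W1. \<beta> u v *\<^sub>R u) = v - \<beta> w v *\<^sub>R w"
      using split[of "\<lambda>u. \<beta> u y *\<^sub>R u"] split[of "\<lambda>u. \<beta> u v *\<^sub>R u"] id[OF y] id[OF v(1)]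
      by (simp_all add: algebra_simps)
    have "(\<Sum>u\<in>insert v W1. \<beta>' u y *\<^sub>R u) =
        t y *\<^sub>R v + ((\<Sum>u\<in>W1. \<beta> u y *\<^sub>R u) - t y *\<^sub>R (\<Sum>u\<in>W1. \<beta> u v *\<^sub>R u))"
      using sum'[of "\<lambda>a u. a *\<^sub>R u"]
      by (simp add: sum_subtractf scaleR_diff_left scaleR_sum_right mult.commute)
    then show "(\<Sum>u\<in>insert v W1. \<beta>' u y *\<^sub>R u) = y"
      unfolding s2 tw by (simp add: algebra_simps)
  next
    fix a b assume ab: "a \<in> insert v W1" "b \<in> insert v W1"
    have t1: "t v = 1" using w by (simp add: t_def)
    have t0: "t b = 0" if "b \<in> W1" for b
      using that delta[of w b] w by (auto simp: t_def W1_def)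
    show "\<beta>' a b = (if a = b then 1 else 0)"
      using ab vW1 t1 t0 delta[of a b] subsetD[OF W1(2), of a] subsetD[OF W1(2), of b]
      by (auto simp: \<beta>'_def)
  qed
  moreover have "insert v V \<subseteq> insert v W1" using V w by (auto simp: W1_def)
  ultimately show ?thesis by blast
qed

lemma affine_coords_extend:
  assumes C: "finite C" and V: "finite V" "V \<subseteq> coord_space C" "\<And>v i. v \<in> V \<Longrightarrow> i \<in> C \<Longrightarrow> v i \<in> \<rat>"
    "\<not> affine_dependent V"
  shows "\<exists>W \<beta>. affine_coords C W \<beta> \<and> V \<subseteq> W"
  using V
proof (induction V rule: finite_induct)
  case empty
  then show ?case using affine_coords_standard[OF C] by auto
next
  case (insert v V)
  have "\<not> affine_dependent V" using insert.prems(3) affine_independent_subset by blast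
  then obtain W \<beta> where "affine_coords C W \<beta>" "V \<subseteq> W" using insert by blast
  moreover have "v \<notin> affine hull V"
    using insert.prems(3) insert.hyps by (auto simp: affine_dependent_def)
  ultimately show ?case using insert.prems by (intro affine_coords_exchange) auto
qed

text \<open>Membership in a simplex becomes finitely many rational affine equations and
  inequalities. In this form it passes to limits, survives small steps and can be expressed by a
  term.\<close>

lemma affine_coords_convex_hull:
  assumes W: "affine_coords C W \<beta>" and V: "V \<subseteq> W" and y: "y \<in> coord_space C"
  shows "y \<in> convex hull V \<longleftrightarrow> (\<forall>w\<in>V. 0 \<le> \<beta> w y) \<and> (\<forall>w\<in>W - V. \<beta> w y = 0)"
proof -
  note fin = affine_coordsD(1)[OF W] and rat = affine_coordsD(3)[OF W] and one = affine_coordsD(4)[OF W y]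
    and id = affine_coordsD(5)[OF W y] and delta = affine_coordsD(6)[OF W]
  have finV: "finite V" using V fin finite_subset by blast
  show ?thesis
  proof
    assume "y \<in> convex hull V"
    then obtain c where c: "\<forall>v\<in>V. 0 \<le> c v" "sum c V = 1" "(\<Sum>v\<in>V. c v *\<^sub>R v) = y"
      by (auto simp: convex_hull_finite[OF finV])
    have "\<beta> w y = (if w \<in> V then c w else 0)" if w: "w \<in> W" for w
    proof -
      have "\<beta> w y = (\<Sum>v\<in>V. c v * \<beta> w v)"
        using rat_affine_affine_comb[OF rat[OF w] c(2)] c(3) by simp
      also have "\<dots> = (\<Sum>v\<in>V. if v = w then c v else 0)"
        using V w by (intro sum.cong) (auto simp: delta subset_iff)
      finally show ?thesis using finV by simp
    qed
    then show "(\<forall>w\<in>V. 0 \<le> \<beta> w y) \<and> (\<forall>w\<in>W - V. \<beta> w y = 0)" using c(1) V by auto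
  next
    assume *: "(\<forall>w\<in>V. 0 \<le> \<beta> w y) \<and> (\<forall>w\<in>W - V. \<beta> w y = 0)"
    have "(\<Sum>w\<in>V. \<beta> w y) = (\<Sum>w\<in>W. \<beta> w y)" "(\<Sum>w\<in>V. \<beta> w y *\<^sub>R w) = (\<Sum>w\<in>W. \<beta> w y *\<^sub>R w)"
      by (intro sum.mono_neutral_left fin V; simp add: *)+
    then show "y \<in> convex hull V" using * one id by (auto simp: convex_hull_finite[OF finV])
  qed
qed

lemma affine_independent_insert_hull:
  fixes V :: "'a::real_vector set"
  assumes V: "finite V" "\<not> affine_dependent V" and z: "z \<notin> affine hull V"
  shows "\<not> affine_dependent (insert z V)"
proof
  have zV: "z \<notin> V" using z hull_inc[of z V] by blast
  assume "affine_dependent (insert z V)"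
  then obtain U where U: "sum U (insert z V) = 0" "\<exists>v\<in>insert z V. U v \<noteq> 0"
    "(\<Sum>v\<in>insert z V. U v *\<^sub>R v) = 0"
    using affine_dependent_explicit_finite[of "insert z V"] V(1) by auto
  show False
  proof (cases "U z = 0")
    case True
    then have "affine_dependent V"
      using U V(1) zV affine_dependent_explicit_finite[OF V(1)] by auto
    then show False using V(2) by simp
  next
    case False
    have "(\<Sum>v\<in>V. U v *\<^sub>R v) = - U z *\<^sub>R z" using U(3) V(1) zV by (simp add: eq_neg_iff_add_eq_0 add.commute)
    then have "(\<Sum>v\<in>V. (- U v / U z) *\<^sub>R v) = z"
      using False scaleR_sum_right[of "- 1 / U z" "\<lambda>v. U v *\<^sub>R v" V] by simp
    moreover have "sum (\<lambda>v. - U v / U z) V = 1"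
      using U(1) V(1) zV False by (simp add: sum_divide_distrib[symmetric] sum_negf field_simps)
    ultimately have "z \<in> affine hull V" by (auto simp: affine_hull_finite[OF V(1)])
    then show False using z by simp
  qed
qed

section \<open>Covers by rational simplices on which a term is affine\<close>

definition rat_vertices :: "'i set \<Rightarrow> ('i \<Rightarrow> real) set \<Rightarrow> bool" where
  "rat_vertices C V \<longleftrightarrow> finite V \<and> V \<subseteq> coord_space C \<and> (\<forall>v\<in>V. \<forall>i\<in>C. v i \<in> \<rat>) \<and>
     \<not> affine_dependent V"

lemma rational_simplex_iff: "rational_simplex C S \<longleftrightarrow> (\<exists>V. rat_vertices C V \<and> S = convex hull V)"
  by (auto simp: rational_simplex_def rat_vertices_def)

lemma rat_vertices_subset: "rat_vertices C V \<Longrightarrow> U \<subseteq> V \<Longrightarrow> rat_vertices C U"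
  unfolding rat_vertices_def using affine_independent_subset finite_subset by blast

text \<open>The members of a cover may overlap in any way; its use is to provide one simplex that
  contains infinitely many points of a given sequence.\<close>

definition rat_covered :: "'i set \<Rightarrow> (('i \<Rightarrow> real) set \<Rightarrow> bool) \<Rightarrow> ('i \<Rightarrow> real) set \<Rightarrow> bool" where
  "rat_covered C P S \<longleftrightarrow>
     (\<exists>\<T>. finite \<T> \<and> (\<forall>T\<in>\<T>. rational_simplex C T \<and> T \<subseteq> S \<and> P T) \<and> S \<subseteq> \<Union>\<T>)"

lemma rat_covered_base: "rational_simplex C S \<Longrightarrow> P S \<Longrightarrow> rat_covered C P S"
  unfolding rat_covered_def by (rule exI[of _ "{S}"]) simp

lemma rat_covered_union:
  assumes "finite \<T>" "\<And>T. T \<in> \<T> \<Longrightarrow> T \<subseteq> S \<and> rat_covered C P T" "S \<subseteq> \<Union>\<T>"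
  shows "rat_covered C P S"
proof -
  have "\<exists>\<U>. finite \<U> \<and> (\<forall>U\<in>\<U>. rational_simplex C U \<and> U \<subseteq> T \<and> P U) \<and> T \<subseteq> \<Union>\<U>" if "T \<in> \<T>" for T
    using assms(2)[OF that] unfolding rat_covered_def by blast
  then obtain \<U> where \<U>: "\<And>T. T \<in> \<T> \<Longrightarrow>
      finite (\<U> T) \<and> (\<forall>U\<in>\<U> T. rational_simplex C U \<and> U \<subseteq> T \<and> P U) \<and> T \<subseteq> \<Union>(\<U> T)"
    by metis
  have "finite (\<Union>(\<U> ` \<T>))" using assms(1) \<U> by blast
  moreover have "\<forall>U\<in>\<Union>(\<U> ` \<T>). rational_simplex C U \<and> U \<subseteq> S \<and> P U"
    using assms(2) \<U> by blast
  moreover have "S \<subseteq> \<Union>(\<Union>(\<U> ` \<T>))" using assms(3) \<U> by blast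
  ultimately show ?thesis unfolding rat_covered_def by blast
qed

lemma rat_covered_trans:
  assumes "rat_covered C P S"
    and "\<And>T. rational_simplex C T \<Longrightarrow> T \<subseteq> S \<Longrightarrow> P T \<Longrightarrow> rat_covered C Q T"
  shows "rat_covered C Q S"
proof -
  obtain \<T> where "finite \<T>" "\<forall>T\<in>\<T>. rational_simplex C T \<and> T \<subseteq> S \<and> P T" "S \<subseteq> \<Union>\<T>"
    using assms(1) unfolding rat_covered_def by blast
  then show ?thesis using assms(2) by (intro rat_covered_union[of \<T>]) auto
qed

lemma rat_affine_hull_nonneg:
  assumes l: "rat_affine C l" and "\<And>v. v \<in> V \<Longrightarrow> 0 \<le> l v" "y \<in> convex hull V"
  shows "0 \<le> l y"
proof -
  obtain b m where l: "l = (\<lambda>y. b + coord_inner C m y)"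
    using l unfolding rat_affine_def by blast
  have "convex {y. 0 \<le> l y}"
  proof (rule convexI)
    fix x y and u v :: real assume *: "x \<in> {y. 0 \<le> l y}" "y \<in> {y. 0 \<le> l y}" "0 \<le> u" "0 \<le> v" "u + v = 1"
    have "u * b + v * b = (u + v) * b" by (simp add: algebra_simps)
    then have "l (u *\<^sub>R x + v *\<^sub>R y) = u * l x + v * l y"
      using *(5) by (simp add: l coord_inner_simps distrib_left)
    then show "u *\<^sub>R x + v *\<^sub>R y \<in> {y. 0 \<le> l y}" using * by simp
  qed
  then have "convex hull V \<subseteq> {y. 0 \<le> l y}" using assms(2) by (intro hull_minimal) auto
  then show ?thesis using assms(3) by blast
qed

text \<open>\<open>v\<close> is an affine combination of the new point and \<open>w\<close>, so the
  new point is not in the affine hull of the remaining vertices.\<close>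

lemma rat_vertices_edge:
  assumes V: "rat_vertices C V" and vw: "v \<in> V" "w \<in> V" "v \<noteq> w"
    and ab: "a \<in> \<rat>" "b \<in> \<rat>" "0 < a" "a + b = 1"
  shows "rat_vertices C (insert (a *\<^sub>R v + b *\<^sub>R w) (V - {v}))"
proof -
  let ?z = "a *\<^sub>R v + b *\<^sub>R w"
  have fin: "finite V" and ind: "\<not> affine_dependent V" using V by (auto simp: rat_vertices_def)
  have "?z \<notin> affine hull (V - {v})"
  proof
    assume z: "?z \<in> affine hull (V - {v})"
    have w: "w \<in> affine hull (V - {v})" using vw by (intro hull_inc) auto
    have "(1 / a) *\<^sub>R ?z + (- b / a) *\<^sub>R w = v"
      using ab by (simp add: scaleR_add_right)
    moreover have "1 / a + - b / a = 1" using ab by (simp add: field_simps)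
    ultimately have "v \<in> affine hull (V - {v})"
      using mem_affine[OF affine_affine_hull z w] by metis
    then show False using ind vw(1) by (auto simp: affine_dependent_def)
  qed
  then have "\<not> affine_dependent (insert ?z (V - {v}))"
    using fin affine_independent_subset[OF ind, of "V - {v}"]
    by (intro affine_independent_insert_hull) auto
  moreover have "?z \<in> coord_space C" using V vw by (auto simp: rat_vertices_def intro!: coord_space_closed)
  moreover have "?z i \<in> \<rat>" if "i \<in> C" for i
    using V vw that ab by (auto simp: rat_vertices_def scaleR_fun_apply)
  ultimately show ?thesis using V by (auto simp: rat_vertices_def)
qed

text \<open>With \<open>z\<close> the new point, \<open>v = (z - b w) / a\<close>. So the weight
  \<open>c v\<close> at \<open>v\<close> becomes \<open>c v / a\<close> at \<open>z\<close> and
  lowers the weight at \<open>w\<close> by \<open>c v * b / a\<close>; the last hypothesis keeps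
  that weight nonnegative.\<close>

lemma convex_hull_edge:
  assumes fin: "finite V" and vw: "v \<in> V" "w \<in> V" "v \<noteq> w"
    and ab: "0 < a" "a + b = 1"
    and c: "\<And>u. u \<in> V \<Longrightarrow> 0 \<le> c u" "sum c V = (1::real)" "c v * b \<le> c w * a"
  shows "(\<Sum>u\<in>V. c u *\<^sub>R u) \<in> convex hull (insert (a *\<^sub>R v + b *\<^sub>R w) (V - {v}))"
proof -
  let ?z = "a *\<^sub>R v + b *\<^sub>R w"
  define U where "U = V - {v} - {w}"
  have split: "sum f V = f v + (f w + sum f U)" for f :: "'a \<Rightarrow> 'b::comm_monoid_add"
    unfolding U_def using fin vw by (simp add: sum.remove[of V v] sum.remove[of "V - {v}" w])
  define d where "d u = (if u = v then c v / a else if u = w then c w - c v * b / a else c u)" for u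
  define x where "x u = (if u = v then ?z else u)" for u
  have U: "sum d U = sum c U" "(\<Sum>u\<in>U. d u *\<^sub>R x u) = (\<Sum>u\<in>U. c u *\<^sub>R u)"
    by (intro sum.cong; auto simp: d_def x_def U_def)+
  have "sum d V = 1"
  proof -
    have "c v / a - c v * b / a = c v * (1 - b) / a"
      by (simp add: right_diff_distrib diff_divide_distrib)
    also have "1 - b = a" using ab(2) by simp
    finally have "c v / a - c v * b / a = c v" using ab(1) by simp
    then show ?thesis using c(2) vw(3) unfolding split U by (simp add: d_def)
  qed
  moreover have "0 \<le> d u" if "u \<in> V" for u
  proof -
    have "c v * b / a \<le> c w" using c(3) ab(1) by (simp add: pos_divide_le_eq)
    moreover have "0 \<le> c v / a" using c(1)[OF vw(1)] ab(1) by simp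
    ultimately show ?thesis using c(1)[OF that] by (simp add: d_def)
  qed
  moreover have "x u \<in> convex hull (insert ?z (V - {v}))" if "u \<in> V" for u
    using that by (intro hull_inc) (auto simp: x_def)
  ultimately have "(\<Sum>u\<in>V. d u *\<^sub>R x u) \<in> convex hull (insert ?z (V - {v}))"
    by (intro convex_sum fin convex_convex_hull)
  moreover have "(\<Sum>u\<in>V. d u *\<^sub>R x u) = (\<Sum>u\<in>V. c u *\<^sub>R u)"
  proof -
    have "d v *\<^sub>R x v + d w *\<^sub>R x w = (c v / a) *\<^sub>R ?z + (c w - c v * b / a) *\<^sub>R w"
      using vw by (simp add: d_def x_def)
    also have "\<dots> = c v *\<^sub>R v + c w *\<^sub>R w"
      using ab(1) by (simp add: scaleR_add_right scaleR_diff_left)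
    finally show ?thesis unfolding split U by (simp only: add.assoc[symmetric])
  qed
  ultimately show ?thesis by simp
qed

text \<open>An edge along which \<open>l\<close> changes sign is cut at the zero of \<open>l\<close>. Both halves of the simplex
  have fewer such edges.\<close>

lemma rat_covered_sign:
  assumes S: "rational_simplex C S" and l: "rat_affine C l"
  shows "rat_covered C (\<lambda>T. (\<forall>y\<in>T. 0 \<le> l y) \<or> (\<forall>y\<in>T. l y \<le> 0)) S"
proof -
  let ?P = "\<lambda>T. (\<forall>y\<in>T. 0 \<le> l y) \<or> (\<forall>y\<in>T. l y \<le> 0)"
  define E where "E V = {(v, w) \<in> V \<times> V. 0 < l v \<and> l w < 0}" for V
  have "rat_covered C ?P (convex hull V)" if "rat_vertices C V" for V
    using that
  proof (induction "card (E V)" arbitrary: V rule: less_induct)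
    case less
    have fin: "finite V" using less.prems by (simp add: rat_vertices_def)
    have finE: "finite (E V)" using fin by (auto simp: E_def intro: finite_subset[of _ "V \<times> V"])
    show ?case
    proof (cases "E V = {}")
      case True
      then have "(\<forall>v\<in>V. 0 \<le> l v) \<or> (\<forall>v\<in>V. 0 \<le> - l v)" by (force simp: E_def)
      moreover have "\<forall>y\<in>convex hull V. 0 \<le> l y" if "\<forall>v\<in>V. 0 \<le> l v"
        using rat_affine_hull_nonneg[OF l, of V] that by blast
      moreover have "\<forall>y\<in>convex hull V. 0 \<le> - l y" if "\<forall>v\<in>V. 0 \<le> - l v"
        using rat_affine_hull_nonneg[OF rat_affine_minus[OF l], of V] that by blast
      ultimately have "?P (convex hull V)" by fastforce
      then show ?thesis using less.prems by (intro rat_covered_base) (auto simp: rational_simplex_iff)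
    next
      case False
      then obtain v w where vw: "v \<in> V" "w \<in> V" "0 < l v" "l w < 0" by (auto simp: E_def)
      then have "v \<noteq> w" by auto
      \<comment> \<open>The weights of the zero of \<open>l\<close> on the edge. They are rational
        because \<open>l\<close> takes rational values at the vertices.\<close>
      define a where "a = - l w / (l v - l w)"
      define b where "b = l v / (l v - l w)"
      have ab: "0 < a" "0 < b" "a + b = 1"
      proof -
        have D: "0 < l v - l w" using vw by simp
        show "0 < a" "0 < b" unfolding a_def b_def using vw D by (intro divide_pos_pos; simp)+
        have "a + b = (- l w + l v) / (l v - l w)"
          unfolding a_def b_def by (rule add_divide_distrib[symmetric])
        then show "a + b = 1" using D by simp
      qed
      have rat: "l u \<in> \<rat>" if "u \<in> V" for u
        using less.prems that by (intro rat_affine_rational[OF l]) (auto simp: rat_vertices_def)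
      have abr: "a \<in> \<rat>" "b \<in> \<rat>" using rat[OF vw(1)] rat[OF vw(2)] by (auto simp: a_def b_def)
      define z where "z = a *\<^sub>R v + b *\<^sub>R w"
      have zc: "z = b *\<^sub>R w + a *\<^sub>R v" by (simp add: z_def add.commute)
      have lz: "l z = 0"
      proof -
        have "l (\<Sum>u\<in>{v, w}. (if u = v then a else b) *\<^sub>R u) = (\<Sum>u\<in>{v, w}. (if u = v then a else b) * l u)"
          using \<open>v \<noteq> w\<close> ab by (intro rat_affine_affine_comb[OF l]) simp
        then have "l z = a * l v + b * l w" using \<open>v \<noteq> w\<close> by (simp add: z_def)
        also have "\<dots> = 0" by (simp add: a_def b_def)
        finally show ?thesis .
      qed
      define V1 where "V1 = insert z (V - {v})"
      define V2 where "V2 = insert z (V - {w})"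
      have rv: "rat_vertices C V1" "rat_vertices C V2"
        unfolding V1_def V2_def
        using rat_vertices_edge[OF less.prems vw(1,2) \<open>v \<noteq> w\<close> abr ab(1,3)]
          rat_vertices_edge[OF less.prems vw(2,1) _ abr(2,1) ab(2)] ab(3) \<open>v \<noteq> w\<close>
        by (simp_all add: z_def[symmetric] zc[symmetric] add.commute)
      have lz': "p \<noteq> z" if "l p \<noteq> 0" for p using that lz by metis
      \<comment> \<open>The new vertex is a zero of \<open>l\<close>, so it belongs to no edge with
        a sign change, and the edge from \<open>v\<close> to \<open>w\<close> disappears with
        \<open>v\<close>.\<close>
      have "E V1 \<subseteq> E V - {(v, w)}"
        using lz' by (force simp only: E_def V1_def mem_Collect_eq case_prod_conv insert_iff Diff_iff mem_Sigma_iff)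
      moreover have "E V2 \<subseteq> E V - {(v, w)}"
        using lz' by (force simp only: E_def V2_def mem_Collect_eq case_prod_conv insert_iff Diff_iff mem_Sigma_iff)
      moreover have "(v, w) \<in> E V" using vw by (simp add: E_def)
      ultimately have "E V1 \<subset> E V" "E V2 \<subset> E V" by blast+
      then have cov: "rat_covered C ?P (convex hull V1)" "rat_covered C ?P (convex hull V2)"
        using less.hyps[OF psubset_card_mono[OF finE]] rv by auto
      have zV: "z \<in> convex hull V"
        unfolding z_def using ab vw
        by (intro convexD[OF convex_convex_hull] hull_inc) auto
      have "insert z (V - A) \<subseteq> convex hull V" for A
        using zV by (simp add: order_trans[OF Diff_subset hull_subset])
      then have sub: "convex hull V1 \<subseteq> convex hull V" "convex hull V2 \<subseteq> convex hull V"
        unfolding V1_def V2_def by (simp_all add: hull_minimal)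
      have "convex hull V \<subseteq> convex hull V1 \<union> convex hull V2"
      proof
        fix y assume "y \<in> convex hull V"
        then obtain c where c: "\<forall>u\<in>V. 0 \<le> c u" "sum c V = 1" "(\<Sum>u\<in>V. c u *\<^sub>R u) = y"
          by (auto simp: convex_hull_finite[OF fin])
        show "y \<in> convex hull V1 \<union> convex hull V2"
        proof (cases "c v * b \<le> c w * a")
          case True
          then show ?thesis
            using convex_hull_edge[OF fin vw(1,2) \<open>v \<noteq> w\<close> ab(1,3), of c] c by (simp add: V1_def z_def)
        next
          case False
          then show ?thesis
            using convex_hull_edge[OF fin vw(2,1) _ ab(2), of a c] c ab(3) \<open>v \<noteq> w\<close>
            by (simp add: V2_def z_def add.commute)
        qed
      qed
      then show ?thesis
        using cov sub by (intro rat_covered_union[of "{convex hull V1, convex hull V2}"]) auto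
    qed
  qed
  then show ?thesis using S by (auto simp: rational_simplex_iff)
qed

text \<open>Clipping the coordinates extends the term function from the cube to a piecewise linear
  function on the whole space with values in the unit interval.\<close>

definition clipped_eval :: "'i mv_term \<Rightarrow> ('i \<Rightarrow> real) \<Rightarrow> real" where
  "clipped_eval t y = mv_eval std_mv (\<lambda>i. max 0 (min 1 (y i))) t"

lemma clipped_eval_bounds: "0 \<le> clipped_eval t y" "clipped_eval t y \<le> 1"
  using mv_eval_closed[OF mv_algebra_std_mv, of t "\<lambda>i. max 0 (min 1 (y i))"]
  by (auto simp: std_mv_def clipped_eval_def)

lemma clipped_eval_cube:
  assumes "y \<in> unit_cube C" "set_mv_term t \<subseteq> C"
  shows "clipped_eval t y = mv_eval std_mv y t"
  unfolding clipped_eval_def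
  by (rule mv_eval_cong) (use assms in \<open>auto simp: unit_cube_def\<close>)

text \<open>Induction on the term, refining the cover wherever truncation can switch: at the zeros
  of \<open>y i\<close> and \<open>1 - y i\<close> for a variable, and of
  \<open>1 - (k y + l y)\<close> for a sum with affine pieces \<open>k\<close> and
  \<open>l\<close>.\<close>

lemma rat_covered_term:
  assumes C: "finite C" and t: "set_mv_term t \<subseteq> C" and S: "rational_simplex C S"
  shows "rat_covered C (\<lambda>T. \<exists>l. rat_affine C l \<and> (\<forall>y\<in>T. clipped_eval t y = l y)) S"
proof -
  let ?P = "\<lambda>t T. \<exists>l. rat_affine C l \<and> (\<forall>y\<in>T. clipped_eval t y = l y)"
  have P: "rat_covered C (?P t) T" if "rational_simplex C T" "rat_affine C l"
    "\<And>y. y \<in> T \<Longrightarrow> clipped_eval t y = l y" for t l T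
    using that by (intro rat_covered_base) auto
  show ?thesis
    using t S
  proof (induction t arbitrary: S)
    case (Var i)
    then have ri: "rat_affine C (\<lambda>y. y i)" using rat_affine_coord[OF C] by simp
    have ri1: "rat_affine C (\<lambda>y. 1 - y i)" by (intro rat_affine_diff rat_affine_const ri) auto
    show ?case
    proof (rule rat_covered_trans[OF rat_covered_sign[OF Var.prems(2) ri]])
      fix T assume T: "rational_simplex C T" "(\<forall>y\<in>T. 0 \<le> y i) \<or> (\<forall>y\<in>T. y i \<le> 0)"
      show "rat_covered C (?P (Var i)) T"
        using T(2)
      proof
        assume "\<forall>y\<in>T. y i \<le> 0"
        then show ?thesis by (intro P[OF T(1) rat_affine_const[of 0]]) (auto simp: clipped_eval_def)
      next
        assume 0: "\<forall>y\<in>T. 0 \<le> y i"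
        show ?thesis
        proof (rule rat_covered_trans[OF rat_covered_sign[OF T(1) ri1]])
          fix U assume U: "rational_simplex C U" "U \<subseteq> T" "(\<forall>y\<in>U. 0 \<le> 1 - y i) \<or> (\<forall>y\<in>U. 1 - y i \<le> 0)"
          show "rat_covered C (?P (Var i)) U"
            using U(3)
          proof
            assume "\<forall>y\<in>U. 0 \<le> 1 - y i"
            then show ?thesis using 0 U(2) by (intro P[OF U(1) ri]) (auto simp: clipped_eval_def)
          next
            assume "\<forall>y\<in>U. 1 - y i \<le> 0"
            then show ?thesis by (intro P[OF U(1) rat_affine_const[of 1]]) (auto simp: clipped_eval_def)
          qed
        qed
      qed
    qed
  next
    case Zero
    then show ?case by (intro P[OF _ rat_affine_const[of 0]]) (auto simp: clipped_eval_def std_mv_def)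
  next
    case (Neg s)
    have "rat_covered C (?P s) S" using Neg by simp
    then show ?case
    proof (rule rat_covered_trans)
      fix T assume T: "rational_simplex C T" "?P s T"
      then obtain l where "rat_affine C l" "\<forall>y\<in>T. clipped_eval s y = l y" by blast
      then show "rat_covered C (?P (Neg s)) T"
        by (intro P[OF T(1) rat_affine_diff[OF rat_affine_const[of 1]]]) (auto simp: clipped_eval_def std_mv_def)
    qed
  next
    case (Oplus s t)
    have "rat_covered C (?P s) S" using Oplus by simp
    then show ?case
    proof (rule rat_covered_trans)
      fix T assume T: "rational_simplex C T" "T \<subseteq> S" "?P s T"
      obtain k where k: "rat_affine C k" "\<forall>y\<in>T. clipped_eval s y = k y" using T by blast
      have "rat_covered C (?P t) T" using Oplus T by simp
      then show "rat_covered C (?P (Oplus s t)) T"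
      proof (rule rat_covered_trans)
        fix U assume U: "rational_simplex C U" "U \<subseteq> T" "?P t U"
        obtain l where l: "rat_affine C l" "\<forall>y\<in>U. clipped_eval t y = l y" using U by blast
        have kl: "rat_affine C (\<lambda>y. k y + l y)" by (intro rat_affine_add k l)
        have ev: "clipped_eval (Oplus s t) y = min (k y + l y) 1" if "y \<in> U" for y
          using k(2) l(2) that U(2) by (auto simp: clipped_eval_def std_mv_def)
        show "rat_covered C (?P (Oplus s t)) U"
        proof (rule rat_covered_trans[OF rat_covered_sign[OF U(1) rat_affine_diff[OF rat_affine_const[of 1] kl]]])
          fix D assume D: "rational_simplex C D" "D \<subseteq> U"
            "(\<forall>y\<in>D. 0 \<le> 1 - (k y + l y)) \<or> (\<forall>y\<in>D. 1 - (k y + l y) \<le> 0)"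
          show "rat_covered C (?P (Oplus s t)) D"
            using D(3)
          proof
            assume "\<forall>y\<in>D. 0 \<le> 1 - (k y + l y)"
            then show ?thesis using ev D(2) by (intro P[OF D(1) kl]) auto
          next
            assume "\<forall>y\<in>D. 1 - (k y + l y) \<le> 0"
            then show ?thesis using ev D(2) by (intro P[OF D(1) rat_affine_const[of 1]]) auto
          qed
        qed simp
      qed
    qed
  qed
qed

lemma cube_in_rational_simplex:
  assumes C: "finite C"
  obtains S where "rational_simplex C S" "unit_cube C \<subseteq> S"
proof -
  obtain W \<beta> where W: "affine_coords C W \<beta>" "\<forall>w\<in>W. \<forall>i\<in>C. w i \<in> \<rat>"
    "\<forall>y\<in>unit_cube C. \<forall>w\<in>W. 0 \<le> \<beta> w y"
    using affine_coords_standard[OF C] by (elim exE conjE)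
  have "rat_vertices C W"
    using W affine_coords_independent[OF W(1)] by (auto simp: rat_vertices_def affine_coords_def)
  moreover have "unit_cube C \<subseteq> convex hull W"
    using W(3) affine_coords_convex_hull[OF W(1) subset_refl] by (auto simp: unit_cube_def)
  ultimately show thesis using that by (auto simp: rational_simplex_iff)
qed

section \<open>Frames along a sequence\<close>

lemma tendsto_fun_iff:
  fixes f :: "'a \<Rightarrow> 'i \<Rightarrow> 'b::topological_space"
  shows "(f \<longlongrightarrow> g) F \<longleftrightarrow> (\<forall>i. ((\<lambda>x. f x i) \<longlongrightarrow> g i) F)"
proof -
  have "(f \<longlongrightarrow> g) F \<longleftrightarrow> limitin (product_topology (\<lambda>i. euclidean) UNIV) f g F"
    by (simp add: euclidean_product_topology)
  also have "\<dots> \<longleftrightarrow> (\<forall>i. ((\<lambda>x. f x i) \<longlongrightarrow> g i) F)"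
    by (subst limitin_componentwise) (simp add: PiE_def)
  finally show ?thesis .
qed

lemma tendsto_coord_inner:
  fixes f :: "'a \<Rightarrow> 'i \<Rightarrow> real"
  assumes "(f \<longlongrightarrow> g) F"
  shows "((\<lambda>x. coord_inner C m (f x)) \<longlongrightarrow> coord_inner C m g) F"
  unfolding coord_inner_def
  using assms by (intro tendsto_intros) (simp add: tendsto_fun_iff)

lemma tendsto_rat_affine:
  assumes "rat_affine C l" "(f \<longlongrightarrow> g) F"
  shows "((\<lambda>x. l (f x)) \<longlongrightarrow> l g) F"
  using assms unfolding rat_affine_def by (auto intro!: tendsto_intros tendsto_coord_inner)

lemma bounded_coords_subseq:
  fixes s :: "nat \<Rightarrow> 'i \<Rightarrow> real"
  assumes C: "finite C" and s: "\<And>n. s n \<in> coord_space C" "\<And>n i. i \<in> C \<Longrightarrow> \<bar>s n i\<bar> \<le> B"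
  obtains r y where "strict_mono (r :: nat \<Rightarrow> nat)" "y \<in> coord_space C" "(s \<circ> r) \<longlonglongrightarrow> y"
proof -
  have "\<exists>r y. strict_mono (r :: nat \<Rightarrow> nat) \<and> (\<forall>i\<in>D. (\<lambda>n. s (r n) i) \<longlonglongrightarrow> y i)" if "D \<subseteq> C" for D
    using finite_subset[OF that C] that
  proof (induction D rule: finite_induct)
    case empty
    have "strict_mono (\<lambda>n::nat. n)" by (simp add: strict_mono_def)
    then show ?case by blast
  next
    case (insert j D)
    then obtain r y where r: "strict_mono r" "\<forall>i\<in>D. (\<lambda>n. s (r n) i) \<longlonglongrightarrow> y i" by blast
    have "bounded (range (\<lambda>n. s (r n) j))"
      unfolding bounded_iff using s(2)[of j] insert.prems by (auto intro!: exI[of _ B])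
    then obtain a q where q: "strict_mono q" "((\<lambda>n. s (r n) j) \<circ> q) \<longlonglongrightarrow> a"
      using bounded_imp_convergent_subsequence by blast
    have "(\<lambda>n. s ((r \<circ> q) n) i) \<longlonglongrightarrow> (y(j := a)) i" if "i \<in> insert j D" for i
      using q that LIMSEQ_subseq_LIMSEQ[OF bspec[OF r(2)] q(1), of i] insert.hyps
      by (cases "i = j") (auto simp: o_def)
    then show ?case using strict_mono_o[OF r(1) q(1)] by blast
  qed
  then obtain r y where r: "strict_mono (r :: nat \<Rightarrow> nat)" "\<forall>i\<in>C. (\<lambda>n. s (r n) i) \<longlonglongrightarrow> y i" by blast
  define z where "z i = (if i \<in> C then y i else 0)" for i
  have "(\<lambda>n. s (r n) i) \<longlonglongrightarrow> z i" for i
    using r(2) s(1) by (auto simp: z_def coord_space_def)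
  then have "(s \<circ> r) \<longlonglongrightarrow> z" by (simp add: tendsto_fun_iff)
  moreover have "z \<in> coord_space C" by (simp add: z_def coord_space_def)
  ultimately show thesis using that r(1) by blast
qed

section \<open>Orders of magnitude along an orthonormal frame\<close>

definition orth_residue :: "'i set \<Rightarrow> (nat \<Rightarrow> 'i \<Rightarrow> real) \<Rightarrow> nat \<Rightarrow> ('i \<Rightarrow> real) \<Rightarrow> ('i \<Rightarrow> real)" where
  "orth_residue C u l v = v - (\<Sum>j=1..l. coord_inner C v (u j) *\<^sub>R u j)"

text \<open>The convergence condition of a tangent, for displacements \<open>d n\<close>. With
  \<open>k = 0\<close> allowed, a frame can be grown from the empty one.\<close>

definition frame :: "'i set \<Rightarrow> nat \<Rightarrow> (nat \<Rightarrow> 'i \<Rightarrow> real) \<Rightarrow> (nat \<Rightarrow> 'i \<Rightarrow> real) \<Rightarrow> bool" where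
  "frame C k u d \<longleftrightarrow> orthonormal_tuple C k u \<and>
     (\<forall>l\<in>{1..k}. (\<lambda>n. coord_normalize C (orth_residue C u (l - 1) (d n))) \<longlonglongrightarrow> u l)"

lemma tangent_iff_frame:
  assumes C: "finite C"
  shows "tangent C X k u x \<longleftrightarrow> 1 \<le> k \<and> x \<in> coord_space C \<and>
    (\<exists>s. (\<forall>n. s n \<in> X) \<and> s \<longlonglongrightarrow> x \<and> (\<forall>n. s n - x \<notin> span (u ` {1..k})) \<and> frame C k u (\<lambda>n. s n - x))"
proof -
  have "v - orth_proj C (span (u ` {1..l - 1})) v = orth_residue C u (l - 1) v"
    if "orthonormal_tuple C k u" "l \<in> {1..k}" for v l
  proof -
    have "l - 1 \<le> k" using that(2) by auto
    then show ?thesis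
      unfolding orth_residue_def by (subst orth_proj_span[OF C that(1)]) auto
  qed
  then have "(\<forall>l\<in>{1..k}. (\<lambda>n. coord_normalize C (s n - x - orth_proj C (span (u ` {1..l - 1})) (s n - x))) \<longlonglongrightarrow> u l) \<longleftrightarrow>
      (\<forall>l\<in>{1..k}. (\<lambda>n. coord_normalize C (orth_residue C u (l - 1) (s n - x))) \<longlonglongrightarrow> u l)"
    if "orthonormal_tuple C k u" for s
    using that by (intro ball_cong HOL.refl) (simp only:)
  then show ?thesis
    by (cases "orthonormal_tuple C k u") (simp_all only: tangent_def frame_def simp_thms)
qed

lemma orthonormal_inner:
  assumes u: "orthonormal_tuple C k u" and ij: "i \<in> {1..k}" "j \<in> {1..k}"
  shows "coord_inner C (u i) (u j) = (if i = j then 1 else 0)"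
proof -
  have "coord_inner C (u i) (u i) = (L2_set (u i) C)\<^sup>2"
    by (simp add: coord_inner_def L2_set_def power2_eq_square sum_nonneg)
  then show ?thesis using u ij by (auto simp: orthonormal_tuple_def)
qed

lemma orth_residue_orthogonal:
  assumes u: "orthonormal_tuple C k u" and j: "j \<in> {1..k}"
  shows "coord_inner C (orth_residue C u k v) (u j) = 0"
proof -
  have "(\<Sum>i=1..k. coord_inner C v (u i) * coord_inner C (u i) (u j)) =
    (\<Sum>i=1..k. if i = j then coord_inner C v (u i) else 0)"
    by (intro sum.cong) (simp_all add: orthonormal_inner[OF u _ j])
  then show ?thesis using j by (simp add: orth_residue_def coord_inner_simps coord_inner_sum)
qed

lemma orth_residue_coord_space:
  assumes "orthonormal_tuple C k u" "l \<le> k" "v \<in> coord_space C"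
  shows "orth_residue C u l v \<in> coord_space C"
  unfolding orth_residue_def using assms
  by (intro coord_space_closed coord_space_sum) (auto simp: orthonormal_tuple_def)

lemma coord_inner_normalize:
  assumes "finite C"
  shows "coord_inner C m v = L2_set v C * coord_inner C m (coord_normalize C v)"
proof (cases "L2_set v C = 0")
  case True
  then show ?thesis using assms by (simp add: L2_set_eq_0_iff coord_inner_def)
qed (simp add: coord_normalize_def coord_inner_simps)

lemma coord_inner_residue:
  assumes "\<And>j. j \<in> {1..l} \<Longrightarrow> coord_inner C m (u j) = 0"
  shows "coord_inner C m (orth_residue C u l v) = coord_inner C m v"
  using assms by (simp add: orth_residue_def coord_inner_simps coord_inner_sum)

text \<open>A functional that vanishes on the directions before \<open>u l\<close> does not see the
  part of \<open>d n\<close> along them. Its value is thus the norm of the residue times a factor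
  that tends to its slope along \<open>u l\<close>; all comparisons of size rest on this.\<close>

lemma frame_factor:
  assumes C: "finite C" and f: "frame C k u d" and l: "l \<in> {1..k}"
    and m: "\<And>j. j \<in> {1..<l} \<Longrightarrow> coord_inner C m (u j) = 0"
  shows "coord_inner C m (d n) = L2_set (orth_residue C u (l - 1) (d n)) C *
      coord_inner C m (coord_normalize C (orth_residue C u (l - 1) (d n)))"
    and "(\<lambda>n. coord_inner C m (coord_normalize C (orth_residue C u (l - 1) (d n))))
      \<longlonglongrightarrow> coord_inner C m (u l)"
proof -
  have "coord_inner C m (orth_residue C u (l - 1) (d n)) = coord_inner C m (d n)"
    using m by (intro coord_inner_residue) auto
  then show "coord_inner C m (d n) = L2_set (orth_residue C u (l - 1) (d n)) C *
      coord_inner C m (coord_normalize C (orth_residue C u (l - 1) (d n)))"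
    using coord_inner_normalize[OF C] by metis
  show "(\<lambda>n. coord_inner C m (coord_normalize C (orth_residue C u (l - 1) (d n))))
      \<longlonglongrightarrow> coord_inner C m (u l)"
    using f l by (intro tendsto_coord_inner) (auto simp: frame_def)
qed

lemma frame_subseq:
  assumes "frame C k u d" "strict_mono r"
  shows "frame C k u (\<lambda>n. d (r n))"
  unfolding frame_def
proof (intro conjI ballI)
  show "orthonormal_tuple C k u" using assms(1) by (simp add: frame_def)
  fix l assume "l \<in> {1..k}"
  then have "(\<lambda>n. coord_normalize C (orth_residue C u (l - 1) (d n))) \<longlonglongrightarrow> u l"
    using assms(1) by (simp add: frame_def)
  from LIMSEQ_subseq_LIMSEQ[OF this assms(2)]
  show "(\<lambda>n. coord_normalize C (orth_residue C u (l - 1) (d (r n)))) \<longlonglongrightarrow> u l"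
    by (simp only: o_def)
qed

text \<open>Bessel's inequality for the coordinate vectors, summed over \<open>C\<close>; the left
  sides add up to the squared norms of the \<open>u j\<close>, that is to \<open>k\<close>.\<close>

lemma orthonormal_tuple_card:
  assumes C: "finite C" and u: "orthonormal_tuple C k u"
  shows "k \<le> card C"
proof -
  have bessel: "(\<Sum>j=1..k. (u j i)\<^sup>2) \<le> 1" if "i \<in> C" for i
  proof -
    define e where "e = (\<lambda>j. if j = i then 1 else 0 :: real)"
    have e: "coord_inner C e y = y i" for y
      unfolding e_def by (rule coord_inner_unit[OF C that])
    let ?w = "orth_residue C u k e"
    have "coord_inner C ?w ?w = coord_inner C ?w e"
      by (subst (2) orth_residue_def)
        (simp add: coord_inner_simps coord_inner_sum orth_residue_orthogonal[OF u])
    also have "coord_inner C ?w e = ?w i" using coord_inner_commute e by metis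
    also have "?w i = 1 - (\<Sum>j=1..k. u j i * u j i)"
      unfolding orth_residue_def e by (simp add: e_def sum_fun_apply scaleR_fun_apply)
    moreover have "0 \<le> coord_inner C ?w ?w" by (simp add: coord_inner_def sum_nonneg)
    ultimately show ?thesis by (simp add: power2_eq_square)
  qed

  have "real k = (\<Sum>j=1..k. coord_inner C (u j) (u j))"
    by (simp add: orthonormal_inner[OF u])
  also have "\<dots> = (\<Sum>i\<in>C. \<Sum>j=1..k. (u j i)\<^sup>2)"
    unfolding coord_inner_def power2_eq_square by (rule sum.swap)
  also have "\<dots> \<le> (\<Sum>i\<in>C. 1)" by (intro sum_mono bessel)
  finally show ?thesis by simp
qed

text \<open>By compactness a subsequence of the normalised residues converges. Its limit is again a
  unit vector orthogonal to \<open>u 1, ..., u k\<close>, and the earlier limits persist along the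
  subsequence.\<close>

lemma frame_extend:
  assumes C: "finite C" and f: "frame C k u d" and d: "\<And>n. d n \<in> coord_space C"
    and nz: "\<And>n. orth_residue C u k (d n) \<noteq> 0"
  obtains r w where "strict_mono (r :: nat \<Rightarrow> nat)" "frame C (Suc k) (u(Suc k := w)) (\<lambda>n. d (r n))"
proof -
  have u: "orthonormal_tuple C k u" using f by (simp add: frame_def)
  define N where "N n = coord_normalize C (orth_residue C u k (d n))" for n
  have res: "orth_residue C u k (d n) \<in> coord_space C" for n
    using orth_residue_coord_space[OF u le_refl d] .
  have Nc: "N n \<in> coord_space C" for n
    unfolding N_def coord_normalize_def using res by (intro coord_space_closed)
  have L: "L2_set (orth_residue C u k (d n)) C \<noteq> 0" for n
    using nz[of n] res[of n] by (auto simp: L2_set_eq_0_iff[OF C] coord_space_def fun_eq_iff)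
  have N1: "L2_set (N n) C = 1" for n
  proof -
    have "L2_set (N n) C = inverse (L2_set (orth_residue C u k (d n)) C) * L2_set (orth_residue C u k (d n)) C"
      unfolding N_def coord_normalize_def scaleR_fun_def real_scaleR_def
      by (rule L2_set_right_distrib[symmetric]) simp
    then show ?thesis using L[of n] by simp
  qed
  have bd: "\<bar>N n i\<bar> \<le> 1" if "i \<in> C" for n i
  proof -
    have "\<bar>N n i\<bar> \<le> L2_set (\<lambda>i. \<bar>N n i\<bar>) C" using C that by (rule member_le_L2_set)
    then show ?thesis using N1[of n] by (simp add: L2_set_def)
  qed
  obtain r w where r: "strict_mono (r :: nat \<Rightarrow> nat)" and w: "w \<in> coord_space C" "(N \<circ> r) \<longlonglongrightarrow> w"
    by (rule bounded_coords_subseq[OF C Nc bd])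
  have wi: "(\<lambda>n. N (r n) i) \<longlonglongrightarrow> w i" for i using w(2) by (simp add: tendsto_fun_iff)
  have "(\<lambda>n. L2_set (N (r n)) C) \<longlonglongrightarrow> L2_set w C"
    unfolding L2_set_def by (intro tendsto_intros wi)
  then have w1: "L2_set w C = 1" using N1 by (simp add: LIMSEQ_const_iff)
  have wu: "coord_inner C (u j) w = 0" if "j \<in> {1..k}" for j
  proof -
    have "coord_inner C (u j) (N n) = 0" for n
      unfolding N_def coord_normalize_def
      using orth_residue_orthogonal[OF u that] by (simp add: coord_inner_simps coord_inner_commute)
    then have "(\<lambda>n. 0) \<longlonglongrightarrow> coord_inner C (u j) w"
      using tendsto_coord_inner[OF w(2), of C "u j"] by simp
    then show ?thesis by (simp add: LIMSEQ_const_iff)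
  qed
  let ?u = "u(Suc k := w)"
  have "orthonormal_tuple C (Suc k) ?u"
    using u w(1) w1 wu unfolding orthonormal_tuple_def
    by (auto simp: le_Suc_eq coord_inner_commute[of C w])
  moreover have "(\<lambda>n. coord_normalize C (orth_residue C ?u (l - 1) (d (r n)))) \<longlonglongrightarrow> ?u l"
    if l: "l \<in> {1..Suc k}" for l
  proof -
    have eq: "orth_residue C ?u (l - 1) v = orth_residue C u (l - 1) v" for v
      unfolding orth_residue_def using l
      by (intro arg_cong2[where f = minus] HOL.refl sum.cong) auto
    show ?thesis
    proof (cases "l = Suc k")
      case True
      then show ?thesis unfolding eq using w(2) by (simp add: N_def[abs_def] o_def)
    next
      case False
      then have "l \<in> {1..k}" using l by auto
      then have "(\<lambda>n. coord_normalize C (orth_residue C u (l - 1) (d (r n)))) \<longlonglongrightarrow> u l"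
        using frame_subseq[OF f r] unfolding frame_def by blast
      then show ?thesis unfolding eq using False by simp
    qed
  qed
  ultimately have "frame C (Suc k) ?u (\<lambda>n. d (r n))" by (auto simp: frame_def)
  then show thesis using that r by blast
qed

text \<open>The slopes of \<open>l\<close> along \<open>u 1, u 2, \<dots>\<close> decide, lexicographically, the sign of \<open>l\<close> at the points
  near \<open>x\<close> of a sequence with frame \<open>u\<close>. The definition is a form of lexicographic nonnegativity.\<close>

definition lex_nonneg :: "nat \<Rightarrow> (nat \<Rightarrow> 'i \<Rightarrow> real) \<Rightarrow> ('i \<Rightarrow> real) \<Rightarrow> (('i \<Rightarrow> real) \<Rightarrow> real) \<Rightarrow> bool" where
  "lex_nonneg k u x l \<longleftrightarrow> 0 \<le> l x \<and>
     (\<forall>p\<in>{1..k}. l x = 0 \<and> (\<forall>j\<in>{1..<p}. l (u j) = l 0) \<longrightarrow> l 0 \<le> l (u p))"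

text \<open>\<open>m\<close> is the gradient of \<open>l\<close>. The slope along \<open>v\<close>
  is \<open>l v - l 0\<close>, so the comparisons with \<open>l 0\<close> in
  \<open>lex_nonneg\<close> are statements about slopes.\<close>

lemma rat_affine_slope:
  assumes "rat_affine C l"
  shows "\<exists>m. \<forall>x y. l y = l x + coord_inner C m (y - x)"
proof -
  obtain b m where "l = (\<lambda>y. b + coord_inner C m y)"
    using assms unfolding rat_affine_def by blast
  then show ?thesis by (intro exI[of _ m]) (simp add: coord_inner_simps)
qed

text \<open>If \<open>l\<close> vanishes at \<open>x\<close> and has slope zero before
  \<open>u p\<close>, then \<open>frame_factor\<close> writes \<open>l (s n)\<close> as a residue
  norm times a factor that tends to the slope along \<open>u p\<close>.\<close>

lemma lex_nonneg_of_seq: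
  assumes C: "finite C" and f: "frame C k u (\<lambda>n. s n - x)" and s: "s \<longlonglongrightarrow> x"
    and l: "rat_affine C l" and nn: "\<And>n. 0 \<le> l (s n)"
  shows "lex_nonneg k u x l"
  unfolding lex_nonneg_def
proof (intro conjI ballI impI)
  show "0 \<le> l x"
    by (rule LIMSEQ_le_const[OF tendsto_rat_affine[OF l s]]) (use nn in blast)
  fix p assume p: "p \<in> {1..k}" and 0: "l x = 0 \<and> (\<forall>j\<in>{1..<p}. l (u j) = l 0)"
  obtain m where "\<forall>x y. l y = l x + coord_inner C m (y - x)"
    using rat_affine_slope[OF l] by (elim exE)
  then have m: "l (x + v) = l x + coord_inner C m v" "l v = l 0 + coord_inner C m v"
    "l y = l x + coord_inner C m (y - x)" for x y v
    by (metis add_diff_cancel_left' diff_zero)+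
  let ?N = "\<lambda>n. coord_inner C m (coord_normalize C (orth_residue C u (p - 1) (s n - x)))"
  let ?L = "\<lambda>n. L2_set (orth_residue C u (p - 1) (s n - x)) C"
  have mz: "coord_inner C m (u j) = 0" if "j \<in> {1..<p}" for j using 0 that m(2)[of "u j"] by simp
  have lim: "?N \<longlonglongrightarrow> coord_inner C m (u p)"
    by (rule frame_factor(2)[OF C f p mz])
  have "0 \<le> ?N n" for n
  proof -
    have "l (s n) = ?L n * ?N n"
      using m(3)[of "s n" x] 0 frame_factor(1)[OF C f p mz, of n] by simp
    then have "0 \<le> ?L n * ?N n" using nn[of n] by simp
    \<comment> \<open>A zero residue normalises to the zero vector, since
      \<open>inverse 0 = 0\<close>.\<close>
    moreover have "?N n = 0" if "?L n = 0"
      using that by (simp add: coord_normalize_def coord_inner_simps)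
    ultimately show ?thesis using L2_set_nonneg by (metis linorder_not_le mult_less_0_iff order_less_le)
  qed
  then have "0 \<le> coord_inner C m (u p)" by (intro LIMSEQ_le_const[OF lim]) blast
  then show "l 0 \<le> l (u p)" using m(2)[of "u p"] by simp
qed

text \<open>The step lengths are chosen one after another. A function that is positive at the point
  reached so far stays positive for a small next step; one that vanishes there has vanished all
  along, so its next slope is nonnegative. The clause about zeros drives this induction and later
  shows that a function with a nonzero slope does not vanish on the path.\<close>

lemma lex_nonneg_small_steps:
  assumes fin: "finite \<Phi>" and l: "\<And>l. l \<in> \<Phi> \<Longrightarrow> rat_affine C l" "\<And>l. l \<in> \<Phi> \<Longrightarrow> lex_nonneg k u x l"
  shows "\<exists>c. (\<forall>p\<in>{1..k}. 0 < c p) \<and>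
    (\<forall>l\<in>\<Phi>. \<forall>p\<le>k. 0 \<le> l (x + (\<Sum>j=1..p. c j *\<^sub>R u j)) \<and>
      (l (x + (\<Sum>j=1..p. c j *\<^sub>R u j)) = 0 \<longrightarrow> l x = 0 \<and> (\<forall>j\<in>{1..p}. l (u j) = l 0)))"
  using l
proof (induction k)
  case 0
  then show ?case by (auto simp: lex_nonneg_def)
next
  case (Suc k)
  let ?z = "\<lambda>c p. x + (\<Sum>j=1..p. c j *\<^sub>R u j)"
  have "lex_nonneg k u x l" if "l \<in> \<Phi>" for l
    using Suc.prems(2)[OF that] by (auto simp: lex_nonneg_def)
  with Suc.prems(1) have "\<exists>c. (\<forall>p\<in>{1..k}. 0 < c p) \<and> (\<forall>l\<in>\<Phi>. \<forall>p\<le>k. 0 \<le> l (?z c p) \<and>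
      (l (?z c p) = 0 \<longrightarrow> l x = 0 \<and> (\<forall>j\<in>{1..p}. l (u j) = l 0)))"
    by (rule Suc.IH)
  then obtain c where c1: "\<forall>p\<in>{1..k}. 0 < c p"
    and c2: "\<forall>l\<in>\<Phi>. \<forall>p\<le>k. 0 \<le> l (?z c p) \<and>
      (l (?z c p) = 0 \<longrightarrow> l x = 0 \<and> (\<forall>j\<in>{1..p}. l (u j) = l 0))"
    by (elim exE conjE)
  have c: "0 \<le> l (?z c p)" "l (?z c p) = 0 \<longrightarrow> l x = 0 \<and> (\<forall>j\<in>{1..p}. l (u j) = l 0)"
    if "l \<in> \<Phi>" "p \<le> k" for l p
    using c2 that by simp_all
  let ?w = "u (Suc k)"
  define Q where "Q l e \<longleftrightarrow> 0 \<le> l (?z c k + e *\<^sub>R ?w) \<and>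
    (l (?z c k + e *\<^sub>R ?w) = 0 \<longrightarrow> l (?z c k) = 0 \<and> l ?w = l 0)" for l :: "('a \<Rightarrow> real) \<Rightarrow> real" and e :: real
  have "eventually (Q l) (at_right 0)" if "l \<in> \<Phi>" for l
  proof -
    have lP: "rat_affine C l" by (rule Suc.prems(1)[OF that])
    obtain m where "\<forall>x y. l y = l x + coord_inner C m (y - x)"
      using rat_affine_slope[OF lP] by (elim exE)
    then have m: "l (x + v) = l x + coord_inner C m v" "l v = l 0 + coord_inner C m v"
      "l y = l x + coord_inner C m (y - x)" for x y v
      by (metis add_diff_cancel_left' diff_zero)+
    have step: "l (?z c k + e *\<^sub>R ?w) = l (?z c k) + e * coord_inner C m ?w" for e
      by (simp add: m(1) coord_inner_simps)
    show ?thesis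
    proof (cases "l (?z c k) = 0")
      case True
      then have "l x = 0 \<and> (\<forall>j\<in>{1..k}. l (u j) = l 0)" using c(2)[OF that le_refl] by blast
      then have "l 0 \<le> l ?w"
        using Suc.prems(2)[OF that] by (auto simp: lex_nonneg_def atLeastLessThanSuc_atLeastAtMost)
      then have "0 \<le> coord_inner C m ?w" using m(2)[of ?w] by simp
      then have "Q l e" if "0 < e" for e
        unfolding Q_def step using that True m(2)[of ?w] by simp
      then show ?thesis by (simp add: eventually_at_filter)
    next
      case False
      then have pos: "0 < l (?z c k)" using c(1)[OF that le_refl] by simp
      have "((\<lambda>e. l (?z c k) + e * coord_inner C m ?w) \<longlongrightarrow> l (?z c k) + 0 * coord_inner C m ?w) (at_right 0)"
        by (intro tendsto_intros)
      then have "eventually (\<lambda>e. 0 < l (?z c k) + e * coord_inner C m ?w) (at_right 0)"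
        using pos by (intro order_tendstoD(1)) auto
      then show ?thesis unfolding Q_def step by eventually_elim simp
    qed
  qed
  then have "eventually (\<lambda>e. \<forall>l\<in>\<Phi>. Q l e) (at_right 0)"
    using fin by (simp add: eventually_ball_finite)
  moreover have "eventually (\<lambda>e. 0 < e) (at_right (0::real))" by (simp add: eventually_at_filter)
  ultimately have "eventually (\<lambda>e. 0 < e \<and> (\<forall>l\<in>\<Phi>. Q l e)) (at_right (0::real))"
    by (simp add: eventually_conj_iff)
  then obtain e where e: "0 < e" "\<And>l. l \<in> \<Phi> \<Longrightarrow> Q l e"
    using eventually_happens by force
  let ?c = "c(Suc k := e)"
  have zc: "?z ?c p = ?z c p" if "p \<le> k" for p
    using that by (intro arg_cong2[where f = plus] HOL.refl sum.cong) auto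
  have zS: "?z ?c (Suc k) = ?z c k + e *\<^sub>R ?w"
    using zc[of k] by (simp add: add.assoc)
  have "0 \<le> l (?z ?c p) \<and> (l (?z ?c p) = 0 \<longrightarrow> l x = 0 \<and> (\<forall>j\<in>{1..p}. l (u j) = l 0))"
    if l: "l \<in> \<Phi>" and p: "p \<le> Suc k" for l p
  proof (cases "p = Suc k")
    case True
    have "l x = 0 \<and> (\<forall>j\<in>{1..Suc k}. l (u j) = l 0)" if "l (?z c k) = 0" "l ?w = l 0"
      using c(2)[OF l le_refl] that by (auto simp: le_Suc_eq)
    then show ?thesis using e(2)[OF l] unfolding Q_def True zS by blast
  next
    case False
    then have "p \<le> k" using p by simp
    then show ?thesis using c[OF l] zc[of p] by simp
  qed
  moreover have "\<forall>p\<in>{1..Suc k}. 0 < ?c p" using c1 e(1) by auto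
  ultimately show ?case by blast
qed

text \<open>When the earlier slopes and \<open>l x\<close> vanish, the value at the
  \<open>p\<close>-th point is \<open>c p\<close> times the slope along \<open>u p\<close>.\<close>

lemma lex_nonneg_of_steps:
  assumes l: "rat_affine C l" and c: "\<And>p. p \<in> {1..k} \<Longrightarrow> 0 < c p"
    and nn: "\<And>p. p \<le> k \<Longrightarrow> 0 \<le> l (x + (\<Sum>j=1..p. c j *\<^sub>R u j))"
  shows "lex_nonneg k u x l"
  unfolding lex_nonneg_def
proof (intro conjI ballI impI)
  show "0 \<le> l x" using nn[of 0] by simp
  fix p assume p: "p \<in> {1..k}" and 0: "l x = 0 \<and> (\<forall>j\<in>{1..<p}. l (u j) = l 0)"
  obtain m where "\<forall>x y. l y = l x + coord_inner C m (y - x)"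
    using rat_affine_slope[OF l] by (elim exE)
  then have m: "l (x + v) = l x + coord_inner C m v" "l v = l 0 + coord_inner C m v"
    "l y = l x + coord_inner C m (y - x)" for x y v
    by (metis add_diff_cancel_left' diff_zero)+
  have mz: "coord_inner C m (u j) = 0" if "j \<in> {1..<p}" for j using 0 that m(2)[of "u j"] by simp
  have "l (x + (\<Sum>j=1..p. c j *\<^sub>R u j)) = (\<Sum>j=1..p. c j * coord_inner C m (u j))"
    using 0 by (simp add: m(1) coord_inner_sum coord_inner_simps)
  also have "\<dots> = c p * coord_inner C m (u p)"
    using p mz by (cases p) (simp_all add: atLeastLessThanSuc_atLeastAtMost)
  finally have "0 \<le> c p * coord_inner C m (u p)" using nn[of p] p by simp
  then have "0 \<le> coord_inner C m (u p)" using c[OF p] by (simp add: zero_le_mult_iff)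
  then show "l 0 \<le> l (u p)" using m(2)[of "u p"] by simp
qed

section \<open>Clipped affine functions as terms\<close>

abbreviation unit_clip :: "real \<Rightarrow> real" where "unit_clip a \<equiv> max 0 (min 1 a)"

text \<open>All integer constants \<open>b\<close> are treated at once because the closure steps
  change the constant: negation goes from \<open>b\<close> to \<open>1 - b\<close>, and adding a
  coordinate uses both \<open>b\<close> and \<open>b + 1\<close>.\<close>

definition int_affine_definable :: "'i set \<Rightarrow> (('i \<Rightarrow> real) \<Rightarrow> real) \<Rightarrow> bool" where
  "int_affine_definable C f \<longleftrightarrow> (\<forall>b::int. \<exists>t. set_mv_term t \<subseteq> C \<and>
     (\<forall>y\<in>unit_cube C. mv_eval std_mv y t = unit_clip (b + f y)))"

lemma std_mv_eval_simps:
  "oplus std_mv a b = min (a + b) 1" "neg std_mv a = 1 - a" "zero std_mv = 0"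
  by (simp_all add: std_mv_def)

lemma int_affine_definable_zero: "int_affine_definable C (\<lambda>y. 0)"
  unfolding int_affine_definable_def
proof
  fix b :: int
  show "\<exists>t. set_mv_term t \<subseteq> C \<and> (\<forall>y\<in>unit_cube C. mv_eval std_mv y t = unit_clip (of_int b + 0))"
  proof (cases "b \<le> 0")
    case True
    then show ?thesis by (intro exI[of _ Zero]) (simp add: std_mv_eval_simps)
  next
    case False
    then show ?thesis by (intro exI[of _ "Neg Zero"]) (simp add: std_mv_eval_simps)
  qed
qed

lemma int_affine_definable_uminus:
  assumes "int_affine_definable C f"
  shows "int_affine_definable C (\<lambda>y. - f y)"
  unfolding int_affine_definable_def
proof
  fix b :: int
  obtain t where t: "set_mv_term t \<subseteq> C" "\<forall>y\<in>unit_cube C. mv_eval std_mv y t = unit_clip (of_int (1 - b) + f y)"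
    using assms unfolding int_affine_definable_def by blast
  then show "\<exists>t. set_mv_term t \<subseteq> C \<and> (\<forall>y\<in>unit_cube C. mv_eval std_mv y t = unit_clip (b + - f y))"
    by (intro exI[of _ "Neg t"]) (auto simp: std_mv_eval_simps)
qed

text \<open>For \<open>0 \<le> x \<le> 1\<close> the clipped sum is \<open>(a + x)\<^sup>\<sharp> = (a\<^sup>\<sharp> \<oplus> x) \<odot> (a + 1)\<^sup>\<sharp>\<close>.\<close>

lemma int_affine_definable_add_coord:
  assumes f: "int_affine_definable C f" and i: "i \<in> C"
  shows "int_affine_definable C (\<lambda>y. f y + y i)"
  unfolding int_affine_definable_def
proof
  fix b :: int
  obtain s where s: "set_mv_term s \<subseteq> C" "\<forall>y\<in>unit_cube C. mv_eval std_mv y s = unit_clip (b + f y)"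
    using f unfolding int_affine_definable_def by blast
  obtain t where t: "set_mv_term t \<subseteq> C"
    "\<forall>y\<in>unit_cube C. mv_eval std_mv y t = unit_clip (of_int (b + 1) + f y)"
    using f unfolding int_affine_definable_def by blast
  have "mv_eval std_mv y (Neg (Oplus (Neg (Oplus s (Var i))) (Neg t))) = unit_clip (b + (f y + y i))"
    if y: "y \<in> unit_cube C" for y
  proof -
    have y01: "0 \<le> y i" "y i \<le> 1" using y i by (auto simp: unit_cube_def)
    have "1 - min (1 - min (unit_clip a + x) 1 + (1 - unit_clip (a + 1))) 1 = unit_clip (a + x)"
      if "0 \<le> x" "x \<le> 1" for a x :: real
      using that by (auto simp: max_def min_def)
    note this[OF y01, of "b + f y"]
    moreover have "mv_eval std_mv y s = unit_clip (b + f y)" using s(2) y by blast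
    moreover have "mv_eval std_mv y t = unit_clip (b + f y + 1)"
      using bspec[OF t(2) y] by (simp only: of_int_add of_int_1 add_ac)
    ultimately show ?thesis by (simp only: mv_eval.simps std_mv_eval_simps add.assoc)
  qed
  moreover have T: "set_mv_term (Neg (Oplus (Neg (Oplus s (Var i))) (Neg t))) \<subseteq> C"
    using s(1) t(1) i by simp
  ultimately show "\<exists>t. set_mv_term t \<subseteq> C \<and> (\<forall>y\<in>unit_cube C. mv_eval std_mv y t = unit_clip (b + (f y + y i)))"
    using T by blast
qed

lemma int_affine_definable_add_multiple:
  assumes f: "int_affine_definable C f" and i: "i \<in> C"
  shows "int_affine_definable C (\<lambda>y. f y + of_int n * y i)"
proof (induction n rule: int_induct[of _ 0])
  case base
  show ?case using f by simp
next
  case (step1 n)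
  then show ?case using int_affine_definable_add_coord[OF step1(2) i] by (simp add: algebra_simps)
next
  case (step2 n)
  \<comment> \<open>Subtracting a coordinate is adding it between two negations.\<close>
  have "int_affine_definable C (\<lambda>y. - (- (f y + of_int n * y i) + y i))"
    by (intro int_affine_definable_uminus int_affine_definable_add_coord step2 i)
  then show ?case by (simp add: algebra_simps)
qed

lemma int_affine_definable_sum:
  assumes "finite D" "D \<subseteq> C"
  shows "int_affine_definable C (\<lambda>y. \<Sum>i\<in>D. of_int (m i) * y i)"
  using assms
proof (induction D rule: finite_induct)
  case empty
  then show ?case by (simp add: int_affine_definable_zero)
next
  case (insert j D)
  then have "int_affine_definable C (\<lambda>y. (\<Sum>i\<in>D. of_int (m i) * y i) + of_int (m j) * y j)"
    by (intro int_affine_definable_add_multiple) auto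
  then show ?case using insert.hyps by (simp add: add.commute)
qed

section \<open>From rational coefficients to terms\<close>

lemma common_denominator:
  assumes "finite Q" "Q \<subseteq> \<rat>"
  shows "\<exists>N::nat. N \<ge> 1 \<and> (\<forall>q\<in>Q. real N * q \<in> \<int>)"
  using assms
proof (induction Q rule: finite_induct)
  case empty
  show ?case by (intro exI[of _ 1]) simp
next
  case (insert q Q)
  then obtain N :: nat where N: "N \<ge> 1" "\<forall>q\<in>Q. real N * q \<in> \<int>" by auto
  have "q \<in> \<rat>" using insert.prems by simp
  then obtain i :: int and n :: nat where n: "n \<noteq> 0" "q = of_int i / of_nat n"
    unfolding Rats_eq_int_div_nat by blast
  have "real (n * N) * r \<in> \<int>" if "r \<in> insert q Q" for r
  proof (cases "r = q")
    case True
    then have "real (n * N) * r = of_int (int N * i)" using n by simp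
    then show ?thesis using Ints_of_int by metis
  next
    case False
    then have "real N * r \<in> \<int>" using N that by blast
    then have "real n * (real N * r) \<in> \<int>" by (rule Ints_mult[OF Ints_of_nat])
    then show ?thesis by (simp add: mult.assoc)
  qed
  moreover have "n * N \<ge> 1" using n N by simp
  ultimately show ?case by blast
qed

text \<open>\<open>N\<close> clears the denominators. It stays in the statement because the affine
  pieces of a term function have integer coefficients, so \<open>unit_clip (l y)\<close> itself need
  not be such a function.\<close>

lemma rat_affine_clip_term:
  assumes C: "finite C" and l: "rat_affine C l"
  shows "\<exists>t N. set_mv_term t \<subseteq> C \<and> N \<ge> (1::nat) \<and>
    (\<forall>y\<in>unit_cube C. mv_eval std_mv y t = unit_clip (N * l y))"
proof -
  obtain b m where bm: "b \<in> \<rat>" "\<forall>i\<in>C. m i \<in> \<rat>" "l = (\<lambda>y. b + coord_inner C m y)"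
    using l unfolding rat_affine_def by blast
  obtain N :: nat where N: "N \<ge> 1" "\<forall>q\<in>insert b (m ` C). real N * q \<in> \<int>"
    using common_denominator[of "insert b (m ` C)"] C bm by auto
  then have b: "of_int \<lfloor>real N * b\<rfloor> = real N * b" by (metis insertI1 of_int_floor)
  have m: "of_int \<lfloor>real N * m i\<rfloor> = real N * m i" if "i \<in> C" for i
    using N(2) that by (metis imageI insertI2 of_int_floor)
  obtain t where t: "set_mv_term t \<subseteq> C" "\<forall>y\<in>unit_cube C. mv_eval std_mv y t =
      unit_clip (of_int \<lfloor>real N * b\<rfloor> + (\<Sum>i\<in>C. of_int \<lfloor>real N * m i\<rfloor> * y i))"
    using int_affine_definable_sum[OF C subset_refl, of "\<lambda>i. \<lfloor>real N * m i\<rfloor>"]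
    unfolding int_affine_definable_def by blast
  have "of_int \<lfloor>real N * b\<rfloor> + (\<Sum>i\<in>C. of_int \<lfloor>real N * m i\<rfloor> * y i) = N * l y" for y
  proof -
    have "(\<Sum>i\<in>C. of_int \<lfloor>real N * m i\<rfloor> * y i) = (\<Sum>i\<in>C. N * (m i * y i))"
      by (intro sum.cong) (simp_all add: m)
    then show ?thesis by (simp add: bm(3) b coord_inner_def distrib_left sum_distrib_left)
  qed
  then show ?thesis using t N(1) by auto
qed

text \<open>The term is the truncated sum of the terms for the single functions, and
  \<open>K\<close> adds up their factors \<open>N\<close>. The zero set will be a simplex; the upper
  bound keeps the term small where the inequalities are only slightly violated.\<close>

lemma positive_parts_term:
  assumes C: "finite C" and fin: "finite \<Phi>" and l: "\<And>l. l \<in> \<Phi> \<Longrightarrow> rat_affine C l"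
  shows "\<exists>t K. set_mv_term t \<subseteq> C \<and> 0 \<le> (K::real) \<and> (\<forall>y\<in>unit_cube C.
    (mv_eval std_mv y t = 0 \<longleftrightarrow> (\<forall>l\<in>\<Phi>. l y \<le> 0)) \<and>
    0 \<le> mv_eval std_mv y t \<and> mv_eval std_mv y t \<le> K * (\<Sum>l\<in>\<Phi>. max 0 (l y)))"
  using fin l
proof (induction \<Phi> rule: finite_induct)
  case empty
  show ?case by (intro exI[of _ Zero] exI[of _ 0]) (simp add: std_mv_eval_simps)
next
  case (insert l \<Phi>)
  then obtain t K where t: "set_mv_term t \<subseteq> C" "0 \<le> (K::real)"
    "\<And>y. y \<in> unit_cube C \<Longrightarrow> (mv_eval std_mv y t = 0 \<longleftrightarrow> (\<forall>l\<in>\<Phi>. l y \<le> 0))"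
    "\<And>y. y \<in> unit_cube C \<Longrightarrow> 0 \<le> mv_eval std_mv y t"
    "\<And>y. y \<in> unit_cube C \<Longrightarrow> mv_eval std_mv y t \<le> K * (\<Sum>l\<in>\<Phi>. max 0 (l y))"
    by (metis insertI2)
  obtain s N where s: "set_mv_term s \<subseteq> C" "N \<ge> (1::nat)"
    "\<And>y. y \<in> unit_cube C \<Longrightarrow> mv_eval std_mv y s = unit_clip (N * l y)"
    using rat_affine_clip_term[OF C, of l] insert.prems by blast
  have "(mv_eval std_mv y (Oplus t s) = 0 \<longleftrightarrow> (\<forall>l\<in>insert l \<Phi>. l y \<le> 0)) \<and>
    0 \<le> mv_eval std_mv y (Oplus t s) \<and>
    mv_eval std_mv y (Oplus t s) \<le> (K + N) * (\<Sum>l\<in>insert l \<Phi>. max 0 (l y))"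
    if y: "y \<in> unit_cube C" for y
  proof -
    let ?S = "\<Sum>l\<in>\<Phi>. max 0 (l y)"
    have S: "0 \<le> ?S" by (intro sum_nonneg) simp
    have "N * l y \<le> 0 \<longleftrightarrow> l y \<le> 0" using s(2) by (simp add: mult_le_0_iff)
    then have 0: "mv_eval std_mv y s = 0 \<longleftrightarrow> l y \<le> 0" using s(3)[OF y] by (auto simp: max_def min_def)
    have "unit_clip (N * l y) \<le> N * max 0 (l y)"
    proof (cases "0 \<le> l y")
      case False
      then have "N * l y \<le> 0" by (simp add: mult_nonneg_nonpos)
      then show ?thesis by simp
    qed simp
    then have "mv_eval std_mv y t + mv_eval std_mv y s \<le> K * ?S + N * max 0 (l y)"
      unfolding s(3)[OF y] by (intro add_mono t(5)[OF y])
    then have "mv_eval std_mv y (Oplus t s) \<le> K * ?S + N * max 0 (l y)"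
      by (simp only: mv_eval.simps std_mv_eval_simps min.coboundedI1)
    also have "\<dots> \<le> (K + N) * (max 0 (l y) + ?S)"
      using t(2) S by (simp add: algebra_simps)
    finally have "mv_eval std_mv y (Oplus t s) \<le> (K + N) * (\<Sum>l\<in>insert l \<Phi>. max 0 (l y))"
      using insert.hyps by simp
    moreover have "0 \<le> mv_eval std_mv y s" using s(3)[OF y] by simp
    ultimately show ?thesis
      using t(3,4)[OF y] 0 by (auto simp: std_mv_eval_simps min_def)
  qed
  moreover have "0 \<le> K + N" using t(2) by simp
  moreover have "set_mv_term (Oplus t s) \<subseteq> C" using t(1) s(1) by simp
  ultimately show ?case by blast
qed

section \<open>Outgoing tangents and strong semisimplicity of closed sets\<close>

lemma face_of_convex_hull_vertex:
  fixes V :: "'a::real_vector set"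
  assumes fin: "finite V" and F: "F face_of convex hull V" and y: "(\<Sum>u\<in>V. c u *\<^sub>R u) \<in> F"
    and c: "\<And>u. u \<in> V \<Longrightarrow> 0 \<le> c u" "sum c V = (1::real)" and v: "v \<in> V" "0 < c v"
  shows "v \<in> F"
proof -
  let ?y = "\<Sum>u\<in>V. c u *\<^sub>R u" and ?a = "1 - c v"
  have rest: "sum c (V - {v}) = ?a" using c(2) sum.remove[OF fin v(1), of c] by simp
  have y_eq: "?y = c v *\<^sub>R v + (\<Sum>u\<in>V - {v}. c u *\<^sub>R u)" by (rule sum.remove[OF fin v(1)])
  have "0 \<le> ?a" using rest c(1) by (metis Diff_iff sum_nonneg)
  show ?thesis
  proof (cases "?a = 0")
    case True
    then have "\<forall>u\<in>V - {v}. c u = 0"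
      using rest fin c(1) sum_nonneg_eq_0_iff[of "V - {v}" c] by simp
    then have "?y = v" using y_eq True by simp
    then show ?thesis using y by simp
  next
    case False
    \<comment> \<open>The remaining weights, normalised; the point lies strictly between
      \<open>w\<close> and \<open>v\<close>, unless these coincide.\<close>
    define w where "w = (\<Sum>u\<in>V - {v}. (c u / ?a) *\<^sub>R u)"
    have a: "0 < ?a" using False \<open>0 \<le> ?a\<close> by simp
    have "w \<in> convex hull (V - {v})"
      unfolding w_def using fin a c(1) rest
      by (intro convex_sum convex_convex_hull) (auto simp: sum_divide_distrib[symmetric] intro: hull_inc)
    then have w: "w \<in> convex hull V" using hull_mono[of "V - {v}" V convex] by blast
    have "?a *\<^sub>R w = (\<Sum>u\<in>V - {v}. c u *\<^sub>R u)"
      unfolding w_def scaleR_sum_right using a by (intro sum.cong) auto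
    then have eq: "?y = ?a *\<^sub>R w + c v *\<^sub>R v" using y_eq by simp
    show ?thesis
    proof (cases "v = w")
      case True
      then have "?y = v" using eq by (simp add: scaleR_left_diff_distrib)
      then show ?thesis using y by simp
    next
      case False
      have "?y \<in> open_segment w v"
        using eq False a v(2) by (auto simp: in_segment intro!: exI[of _ "c v"])
      then show ?thesis using face_ofD[OF F _ w hull_inc[OF v(1)] y] by blast
    qed
  qed
qed

lemma first_nonzero_index:
  fixes k :: nat
  assumes "p \<in> {1..k}" "P p"
  obtains l where "l \<in> {1..k}" "P l" "\<And>j. j \<in> {1..<l} \<Longrightarrow> \<not> P j"
proof -
  define l where "l = (LEAST j. 1 \<le> j \<and> P j)"
  have "1 \<le> l \<and> P l" unfolding l_def by (rule LeastI[of _ p]) (use assms in auto)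
  moreover have "l \<le> p" unfolding l_def by (rule Least_le) (use assms in auto)
  moreover have "\<not> P j" if "j \<in> {1..<l}" for j
    using not_less_Least[of j "\<lambda>j. 1 \<le> j \<and> P j"] that by (auto simp: l_def)
  ultimately show thesis using that[of l] assms(1) by auto
qed

text \<open>Along the sequence \<open>l\<close> may become negative, but only to smaller order than
  the residue left before \<open>u p\<close>. If \<open>l x\<close> is positive or some slope before
  \<open>u p\<close> is nonzero, \<open>l\<close> is eventually positive; otherwise
  \<open>frame_factor\<close> applies at \<open>p\<close> with a nonnegative slope.\<close>

lemma lex_nonneg_lower_bound:
  assumes C: "finite C" and f: "frame C k u (\<lambda>n. s n - x)" and s: "s \<longlonglongrightarrow> x"
    and l: "rat_affine C l" "lex_nonneg k u x l" and p: "p \<in> {1..k}" and \<epsilon>: "0 < \<epsilon>"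
  shows "eventually (\<lambda>n. - \<epsilon> * L2_set (orth_residue C u (p - 1) (s n - x)) C \<le> l (s n)) sequentially"
proof -
  obtain m where "\<forall>x y. l y = l x + coord_inner C m (y - x)"
    using rat_affine_slope[OF l(1)] by (elim exE)
  then have m: "l y = l x + coord_inner C m (y - x)" "l v = l 0 + coord_inner C m v" for y v
    by (metis diff_zero)+
  let ?L = "\<lambda>p n. L2_set (orth_residue C u (p - 1) (s n - x)) C"
  let ?N = "\<lambda>p n. coord_inner C m (coord_normalize C (orth_residue C u (p - 1) (s n - x)))"
  have L: "0 \<le> ?L p n" for p n by simp
  have low: "- \<epsilon> * ?L p n \<le> 0" for n using L[of p n] \<epsilon> by simp
  show ?thesis
  proof (cases "l x = 0")
    case False
    then have "0 < l x" using l(2) by (simp add: lex_nonneg_def)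
    then have "eventually (\<lambda>n. 0 < l (s n)) sequentially"
      using tendsto_rat_affine[OF l(1) s] by (rule order_tendstoD(1)[rotated])
    then show ?thesis
    proof eventually_elim
      case (elim n)
      then show ?case using low[of n] by linarith
    qed
  next
    case True
    have slope: "0 \<le> coord_inner C m (u q)" if "q \<in> {1..k}" "\<And>j. j \<in> {1..<q} \<Longrightarrow> coord_inner C m (u j) = 0" for q
    proof -
      have "l (u j) = l 0" if "j \<in> {1..<q}" for j
        using m(2)[of "u j"] \<open>\<And>j. j \<in> {1..<q} \<Longrightarrow> coord_inner C m (u j) = 0\<close>[OF that] by simp
      then have "l 0 \<le> l (u q)" using l(2) True that(1) unfolding lex_nonneg_def by blast
      then show ?thesis using m(2)[of "u q"] by simp
    qed
    have factor: "l (s n) = ?L q n * ?N q n" "?N q \<longlonglongrightarrow> coord_inner C m (u q)"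
      if "q \<in> {1..k}" "\<And>j. j \<in> {1..<q} \<Longrightarrow> coord_inner C m (u j) = 0" for q n
      using frame_factor[OF C f that] m(1)[of "s n"] True by simp_all
    show ?thesis
    proof (cases "\<forall>j\<in>{1..<p}. coord_inner C m (u j) = 0")
      case zero: True
      then have "eventually (\<lambda>n. - \<epsilon> < ?N p n) sequentially"
        using factor(2)[OF p] slope[OF p] \<epsilon> by (intro order_tendstoD(1)[of "?N p"]) auto
      then show ?thesis
      proof eventually_elim
        case (elim n)
        then have "?L p n * - \<epsilon> \<le> ?L p n * ?N p n" using L by (intro mult_left_mono) auto
        then show ?case using factor(1)[OF p, of n] zero by (simp add: mult.commute)
      qed
    next
      case False
      then obtain j0 where j0: "j0 \<in> {1..<p}" "coord_inner C m (u j0) \<noteq> 0" by blast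
      then have "j0 \<in> {1..k}" using p by auto
      then obtain q where q: "q \<in> {1..k}" "coord_inner C m (u q) \<noteq> 0"
        "\<And>j. j \<in> {1..<q} \<Longrightarrow> \<not> coord_inner C m (u j) \<noteq> 0"
        using first_nonzero_index[of j0 k "\<lambda>j. coord_inner C m (u j) \<noteq> 0"] j0(2) by blast
      then have qz: "\<And>j. j \<in> {1..<q} \<Longrightarrow> coord_inner C m (u j) = 0" by blast
      have fq: "l (s n) = ?L q n * ?N q n" "?N q \<longlonglongrightarrow> coord_inner C m (u q)" for n
        by (rule factor; use q(1) qz in simp)+
      have "0 < coord_inner C m (u q)" using slope[OF q(1) qz] q(2) by simp
      then have "eventually (\<lambda>n. 0 < ?N q n) sequentially"
        by (rule order_tendstoD(1)[OF fq(2)])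
      then show ?thesis
      proof eventually_elim
        case (elim n)
        then have "0 \<le> ?L q n * ?N q n" using L[of q n] by (intro mult_nonneg_nonneg) auto
        then show ?case using fq(1)[of n] low[of n] by linarith
      qed
    qed
  qed
qed

lemma outgoing_tangent_imp_not_dominated:
  assumes C: "finite C" and Y: "Y \<subseteq> unit_cube C" "closed Y"
    and tan: "tangent C Y k u x" and out: "rationally_outgoing C Y k u x"
  shows "\<exists>a b. set_mv_term a \<subseteq> C \<and> set_mv_term b \<subseteq> C \<and>
    (\<forall>y\<in>Y. mv_eval std_mv y a = 0 \<longrightarrow> mv_eval std_mv y b = 0) \<and>
    (\<forall>M::nat. \<exists>y\<in>Y. mv_eval std_mv y b > M * mv_eval std_mv y a)"
proof -
  obtain s where k: "1 \<le> k" and xc: "x \<in> coord_space C" and sY: "\<And>n. s n \<in> Y" and s: "s \<longlonglongrightarrow> x"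
    and f: "frame C k u (\<lambda>n. s n - x)"
    using tan unfolding tangent_iff_frame[OF C] by blast
  have uc: "u j \<in> coord_space C" if "j \<in> {1..k}" for j
    using f that by (auto simp: frame_def orthonormal_tuple_def)
  have cube: "Y \<subseteq> coord_space C" using Y(1) by (auto simp: unit_cube_def)
  have xY: "x \<in> Y" using closed_sequentially[OF Y(2)] sY s by blast
  obtain S F c where S: "rational_simplex C S" and F: "F face_of S" and c: "\<And>l. l \<in> {1..k} \<Longrightarrow> 0 < c l"
    and T: "convex hull ((\<lambda>l. x + (\<Sum>j=1..l. c j *\<^sub>R u j)) ` {0..k}) \<subseteq> S"
      "\<not> convex hull ((\<lambda>l. x + (\<Sum>j=1..l. c j *\<^sub>R u j)) ` {0..k}) \<subseteq> F"
    and FS: "F \<inter> Y = S \<inter> Y"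
    using out unfolding rationally_outgoing_def Let_def by blast
  define z where "z l = x + (\<Sum>j=1..l. c j *\<^sub>R u j)" for l
  let ?T = "(\<lambda>l. x + (\<Sum>j=1..l. c j *\<^sub>R u j)) ` {0..k}"
  have zT: "z l \<in> ?T" if "l \<le> k" for l using that unfolding z_def by (intro imageI) simp
  have zS: "z l \<in> S" if "l \<le> k" for l using hull_inc[OF zT[OF that], of convex] T(1) by blast
  have "convex F" using F by (simp add: face_of_def)
  then have "\<not> ?T \<subseteq> F" using T(2) hull_minimal[of ?T F convex] by blast
  then obtain y where "y \<in> ?T" "y \<notin> F" by blast
  then obtain q where "q \<in> {0..k}" "y = z q" unfolding z_def by (elim imageE)
  with \<open>y \<notin> F\<close> have q: "q \<le> k" "z q \<notin> F" by simp_all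
  obtain V where V: "rat_vertices C V" and SV: "S = convex hull V"
    using S by (auto simp: rational_simplex_iff)
  have "\<exists>W \<beta>. affine_coords C W \<beta> \<and> V \<subseteq> W"
    by (rule affine_coords_extend[OF C]) (use V in \<open>auto simp: rat_vertices_def\<close>)
  then obtain W \<beta> where W: "affine_coords C W \<beta>" and VW: "V \<subseteq> W" by blast
  note finW = affine_coordsD(1)[OF W] and rat = affine_coordsD(3)[OF W]
    and one = affine_coordsD(4)[OF W] and id = affine_coordsD(5)[OF W]
  have finV: "finite V" using VW finW finite_subset by blast
  have Sc: "S \<subseteq> coord_space C"
    unfolding SV using V by (intro convex_hull_coord_space) (simp add: rat_vertices_def)
  have S_iff: "y \<in> S \<longleftrightarrow> (\<forall>w\<in>V. 0 \<le> \<beta> w y) \<and> (\<forall>w\<in>W - V. \<beta> w y = 0)" if "y \<in> coord_space C" for y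
    unfolding SV by (rule affine_coords_convex_hull[OF W VW that])
  have V_sum: "(\<Sum>w\<in>V. \<beta> w y) = 1" "(\<Sum>w\<in>V. \<beta> w y *\<^sub>R w) = y" if "y \<in> S" for y
  proof -
    have y: "y \<in> coord_space C" using that Sc by blast
    then have "\<forall>w\<in>W - V. \<beta> w y = 0" using S_iff that by blast
    then have "(\<Sum>w\<in>V. \<beta> w y) = (\<Sum>w\<in>W. \<beta> w y)" "(\<Sum>w\<in>V. \<beta> w y *\<^sub>R w) = (\<Sum>w\<in>W. \<beta> w y *\<^sub>R w)"
      by (intro sum.mono_neutral_left finW VW; simp)+
    then show "(\<Sum>w\<in>V. \<beta> w y) = 1" "(\<Sum>w\<in>V. \<beta> w y *\<^sub>R w) = y" using one[OF y] id[OF y] by simp_all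
  qed
  \<comment> \<open>On \<open>S\<close> this vanishes exactly on \<open>F\<close>, since a face
    contains every vertex that has positive weight in one of its points.\<close>
  define g where "g y = (\<Sum>v\<in>V - F. \<beta> v y)" for y
  have rg: "rat_affine C g"
    unfolding g_def using VW by (intro rat_affine_sum rat) auto
  have gF: "g y = 0" if "y \<in> F" for y
  proof -
    have y: "y \<in> S" using that F by (auto simp: face_of_def)
    have "\<beta> v y = 0" if "v \<in> V - F" for v
    proof (rule ccontr)
      assume "\<beta> v y \<noteq> 0"
      then have "0 < \<beta> v y" using S_iff y Sc that by force
      moreover have "0 \<le> \<beta> w y" if "w \<in> V" for w using S_iff y Sc that by blast
      ultimately have "v \<in> F"
        using face_of_convex_hull_vertex[OF finV F[unfolded SV], of "\<lambda>w. \<beta> w y" v]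
          V_sum[OF y] \<open>y \<in> F\<close> that by auto
      then show False using that by simp
    qed
    then show ?thesis by (simp add: g_def)
  qed
  have gS: "0 \<le> g y" if "y \<in> S" for y
    unfolding g_def using S_iff[of y] that Sc by (intro sum_nonneg) auto
  have "0 < g (z q)"
  proof (rule ccontr)
    assume "\<not> ?thesis"
    then have "g (z q) = 0" using gS[OF zS[OF q(1)]] by simp
    moreover have nn: "\<forall>v\<in>V. 0 \<le> \<beta> v (z q)" using S_iff zS[OF q(1)] Sc by blast
    ultimately have zero: "\<forall>v\<in>V - F. \<beta> v (z q) = 0"
      unfolding g_def using finV by (subst (asm) sum_nonneg_eq_0_iff) auto
    then have "(\<Sum>v\<in>V \<inter> F. \<beta> v (z q)) = (\<Sum>v\<in>V. \<beta> v (z q))"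
      "(\<Sum>v\<in>V \<inter> F. \<beta> v (z q) *\<^sub>R v) = (\<Sum>v\<in>V. \<beta> v (z q) *\<^sub>R v)"
      by (intro sum.mono_neutral_left finV; auto)+
    then have sums: "(\<Sum>v\<in>V \<inter> F. \<beta> v (z q)) = 1" "(\<Sum>v\<in>V \<inter> F. \<beta> v (z q) *\<^sub>R v) = z q"
      using V_sum[OF zS[OF q(1)]] by simp_all
    have "(\<Sum>v\<in>V \<inter> F. \<beta> v (z q) *\<^sub>R v) \<in> F"
      using finV nn sums(1) by (intro convex_sum \<open>convex F\<close>) auto
    then show False using q(2) sums(2) by simp
  qed
  \<comment> \<open>\<open>x\<close> is the first point of the path and lies in \<open>Y\<close>, so
    \<open>F \<inter> Y = S \<inter> Y\<close> puts it in \<open>F\<close>.\<close>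
  have gx: "g x = 0"
  proof -
    have "x \<in> S" using zS[of 0] by (simp add: z_def)
    then show ?thesis using FS xY gF by blast
  qed
  obtain m where "\<forall>x y. g y = g x + coord_inner C m (y - x)"
    using rat_affine_slope[OF rg] by (elim exE)
  then have m: "g y = coord_inner C m (y - x)" "g v = g 0 + coord_inner C m v" for y v
    using gx by (metis add_0 diff_zero)+
  \<comment> \<open>Otherwise \<open>g\<close> would be constant along the path from
    \<open>x\<close> to \<open>z q\<close>.\<close>
  have "\<exists>j\<in>{1..k}. coord_inner C m (u j) \<noteq> 0"
  proof (rule ccontr)
    assume "\<not> ?thesis"
    then have "g (z q) = 0"
      using q(1) by (simp add: m(1) z_def coord_inner_sum coord_inner_simps)
    then show False using \<open>0 < g (z q)\<close> by simp
  qed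
  then obtain j0 where j0: "j0 \<in> {1..k}" "coord_inner C m (u j0) \<noteq> 0" by blast
  then obtain p where p: "p \<in> {1..k}" "coord_inner C m (u p) \<noteq> 0"
    "\<And>j. j \<in> {1..<p} \<Longrightarrow> \<not> coord_inner C m (u j) \<noteq> 0"
    using first_nonzero_index[of j0 k "\<lambda>j. coord_inner C m (u j) \<noteq> 0"] by blast
  then have pz: "\<And>j. j \<in> {1..<p} \<Longrightarrow> coord_inner C m (u j) = 0" by blast
  have "lex_nonneg k u x g"
    by (rule lex_nonneg_of_steps[OF rg c]) (use gS zS in \<open>auto simp: z_def\<close>)
  moreover have "g (u j) = g 0" if "j \<in> {1..<p}" for j using m(2)[of "u j"] pz[OF that] by simp
  ultimately have "g 0 \<le> g (u p)" using p(1) gx unfolding lex_nonneg_def by blast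
  define \<sigma> where "\<sigma> = coord_inner C m (u p)"
  have \<sigma>: "0 < \<sigma>" using p(2) \<open>g 0 \<le> g (u p)\<close> m(2)[of "u p"] by (simp add: \<sigma>_def)
  let ?L = "\<lambda>n. L2_set (orth_residue C u (p - 1) (s n - x)) C"
  let ?N = "\<lambda>n. coord_inner C m (coord_normalize C (orth_residue C u (p - 1) (s n - x)))"
  have factor: "g (s n) = ?L n * ?N n" "?N \<longlonglongrightarrow> \<sigma>" for n
    using frame_factor[OF C f p(1) pz] m(1)[of "s n"] by (simp_all add: \<sigma>_def)
  \<comment> \<open>\<open>S\<close> is the set where all these functions are at most 0; each
    equation contributes two of them.\<close>
  define \<Phi> where "\<Phi> = (\<lambda>v y. - \<beta> v y) ` V \<union> \<beta> ` (W - V) \<union> (\<lambda>v y. - \<beta> v y) ` (W - V)"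
  have fin\<Phi>: "finite \<Phi>" using finV finW by (simp add: \<Phi>_def)
  have r\<Phi>: "rat_affine C h" if "h \<in> \<Phi>" for h
    using that VW rat rat_affine_minus[OF rat] by (auto simp: \<Phi>_def)
  have S\<Phi>: "y \<in> S \<longleftrightarrow> (\<forall>h\<in>\<Phi>. h y \<le> 0)" if "y \<in> coord_space C" for y
  proof -
    have "(\<forall>h\<in>\<Phi>. h y \<le> 0) \<longleftrightarrow> (\<forall>w\<in>V. 0 \<le> \<beta> w y) \<and> (\<forall>w\<in>W - V. \<beta> w y \<le> 0 \<and> 0 \<le> \<beta> w y)"
      unfolding \<Phi>_def ball_Un by auto
    then show ?thesis unfolding S_iff[OF that] by (auto simp only: eq_iff)
  qed
  obtain a K where a: "set_mv_term a \<subseteq> C" and K: "0 \<le> (K::real)"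
    and a_eval: "\<And>y. y \<in> unit_cube C \<Longrightarrow> (mv_eval std_mv y a = 0 \<longleftrightarrow> (\<forall>l\<in>\<Phi>. l y \<le> 0)) \<and>
      0 \<le> mv_eval std_mv y a \<and> mv_eval std_mv y a \<le> K * (\<Sum>l\<in>\<Phi>. max 0 (l y))"
    using positive_parts_term[OF C fin\<Phi> r\<Phi>] by blast
  obtain b N where b: "set_mv_term b \<subseteq> C" and N: "N \<ge> (1::nat)"
    and b_eval: "\<And>y. y \<in> unit_cube C \<Longrightarrow> mv_eval std_mv y b = unit_clip (N * g y)"
    using rat_affine_clip_term[OF C rg] by blast
  have "mv_eval std_mv y b = 0" if "y \<in> Y" "mv_eval std_mv y a = 0" for y
  proof -
    have "y \<in> S" using that a_eval S\<Phi> Y(1) cube by blast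
    then have "g y = 0" using FS that(1) gF by blast
    then show ?thesis using b_eval that(1) Y(1) by auto
  qed
  moreover have "\<exists>y\<in>Y. mv_eval std_mv y b > M * mv_eval std_mv y a" for M :: nat
  proof (rule ccontr)
    assume "\<not> ?thesis"
    then have le: "mv_eval std_mv (s n) b \<le> M * mv_eval std_mv (s n) a" for n
      using sY by (meson not_less)
    \<comment> \<open>\<open>M * (K * card \<Phi>)\<close> times the bound on a single violation
      must stay below \<open>\<sigma> / 2\<close> times the residue norm. The summand 1 keeps
      \<open>D\<close> positive.\<close>
    define D where "D = M * (K * card \<Phi>) + 1"
    have D: "1 \<le> D" using K by (simp add: D_def)
    define \<epsilon> where "\<epsilon> = \<sigma> / (2 * D)"
    have \<epsilon>: "0 < \<epsilon>" using \<sigma> D by (simp add: \<epsilon>_def)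
    have "eventually (\<lambda>n. h (s n) \<le> \<epsilon> * ?L n) sequentially" if h: "h \<in> \<Phi>" for h
    proof -
      have rh: "rat_affine C (\<lambda>y. - h y)" by (rule rat_affine_minus[OF r\<Phi>[OF h]])
      have "lex_nonneg k u x (\<lambda>y. - h y)"
      proof (rule lex_nonneg_of_steps[OF rh c])
        fix l assume "l \<le> k"
        then have "h (z l) \<le> 0" using S\<Phi>[of "z l"] zS Sc h by blast
        then show "0 \<le> - h (x + (\<Sum>j=1..l. c j *\<^sub>R u j))" by (simp add: z_def)
      qed simp
      from lex_nonneg_lower_bound[OF C f s rh this p(1) \<epsilon>] show ?thesis by simp
    qed
    then have "eventually (\<lambda>n. \<forall>h\<in>\<Phi>. h (s n) \<le> \<epsilon> * ?L n) sequentially"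
      using fin\<Phi> by (simp add: eventually_ball_finite)
    moreover have "eventually (\<lambda>n. \<sigma> / 2 < ?N n) sequentially"
      using \<sigma> by (intro order_tendstoD(1)[OF factor(2)]) simp
    \<comment> \<open>Near \<open>x\<close> the clip at 1 does not act on \<open>b\<close>.\<close>
    moreover have "eventually (\<lambda>n. N * g (s n) < 1) sequentially"
    proof -
      have "(\<lambda>n. N * g (s n)) \<longlonglongrightarrow> N * g x" by (intro tendsto_intros tendsto_rat_affine[OF rg s])
      then show ?thesis using gx by (intro order_tendstoD(2)) auto
    qed
    ultimately have "eventually (\<lambda>n. (\<forall>h\<in>\<Phi>. h (s n) \<le> \<epsilon> * ?L n) \<and> \<sigma> / 2 < ?N n \<and> N * g (s n) < 1) sequentially"
      by eventually_elim blast
    then obtain n where n: "\<And>h. h \<in> \<Phi> \<Longrightarrow> h (s n) \<le> \<epsilon> * ?L n" "\<sigma> / 2 < ?N n" "N * g (s n) < 1"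
      by (auto simp: eventually_sequentially)
    have "?L n \<noteq> 0"
    proof
      assume "?L n = 0"
      then have "?N n = 0" by (simp add: coord_normalize_def coord_inner_simps)
      then show False using n(2) \<sigma> by simp
    qed
    then have L: "0 < ?L n" using L2_set_nonneg[of _ C] by (metis order_less_le)
    have cs: "s n \<in> unit_cube C" using sY Y(1) by blast
    have g_low: "?L n * (\<sigma> / 2) < g (s n)" unfolding factor(1) using L n(2) by simp
    then have "0 < g (s n)" using L \<sigma> by (meson half_gt_zero less_trans mult_pos_pos)
    then have gN: "g (s n) \<le> N * g (s n)" using N by simp
    have b_eq: "mv_eval std_mv (s n) b = N * g (s n)"
      using n(3) \<open>0 < g (s n)\<close> b_eval[OF cs] by simp
    have "?L n * (\<sigma> / 2) < mv_eval std_mv (s n) b"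
      unfolding b_eq using g_low gN by linarith
    also have "\<dots> \<le> M * mv_eval std_mv (s n) a" by (rule le)
    also have "\<dots> \<le> M * (K * (\<Sum>h\<in>\<Phi>. max 0 (h (s n))))"
      using a_eval[OF cs] by (intro mult_left_mono) auto
    also have "(\<Sum>h\<in>\<Phi>. max 0 (h (s n))) \<le> (\<Sum>h\<in>\<Phi>. \<epsilon> * ?L n)"
      using n(1) \<epsilon> L by (intro sum_mono) auto
    then have "M * (K * (\<Sum>h\<in>\<Phi>. max 0 (h (s n)))) \<le> M * (K * (\<Sum>h\<in>\<Phi>. \<epsilon> * ?L n))"
      using K by (intro mult_left_mono) auto
    also have "\<dots> = M * (K * card \<Phi>) * (\<epsilon> * ?L n)" by simp
    also have "\<dots> \<le> D * (\<epsilon> * ?L n)"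
      using \<epsilon> L by (intro mult_right_mono) (auto simp: D_def)
    also have "D * (\<epsilon> * ?L n) = ?L n * (\<sigma> / 2)" using D by (simp add: \<epsilon>_def)
    finally show False by simp
  qed
  ultimately show ?thesis using a b by blast
qed

section \<open>From failing domination to an outgoing tangent\<close>

lemma rat_covered_two_terms:
  assumes C: "finite C" and a: "set_mv_term a \<subseteq> C" and b: "set_mv_term b \<subseteq> C" and S: "rational_simplex C S"
  shows "rat_covered C (\<lambda>T. \<exists>p q. rat_affine C p \<and> rat_affine C q \<and>
    (\<forall>y\<in>T. clipped_eval a y = p y \<and> clipped_eval b y = q y)) S"
proof (rule rat_covered_trans[OF rat_covered_term[OF C a S]])
  fix T assume T: "rational_simplex C T" "\<exists>l. rat_affine C l \<and> (\<forall>y\<in>T. clipped_eval a y = l y)"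
  then obtain p where p: "rat_affine C p" "\<forall>y\<in>T. clipped_eval a y = p y" by blast
  show "rat_covered C (\<lambda>T. \<exists>p q. rat_affine C p \<and> rat_affine C q \<and>
    (\<forall>y\<in>T. clipped_eval a y = p y \<and> clipped_eval b y = q y)) T"
  proof (rule rat_covered_trans[OF rat_covered_term[OF C b T(1)]])
    fix U assume U: "rational_simplex C U" "U \<subseteq> T" "\<exists>l. rat_affine C l \<and> (\<forall>y\<in>U. clipped_eval b y = l y)"
    then obtain q where "rat_affine C q" "\<forall>y\<in>U. clipped_eval b y = q y" by blast
    then have "\<exists>p q. rat_affine C p \<and> rat_affine C q \<and>
      (\<forall>y\<in>U. clipped_eval a y = p y \<and> clipped_eval b y = q y)"
      using p U(2) by blast
    then show "rat_covered C (\<lambda>T. \<exists>p q. rat_affine C p \<and> rat_affine C q \<and>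
      (\<forall>y\<in>T. clipped_eval a y = p y \<and> clipped_eval b y = q y)) U"
      by (rule rat_covered_base[OF U(1)])
  qed
qed

lemma infinite_subseq_in_cover:
  assumes fin: "finite \<T>" and cov: "\<And>n. y n \<in> \<Union>\<T>"
  obtains T r where "T \<in> \<T>" "strict_mono (r :: nat \<Rightarrow> nat)" "\<And>n. y (r n) \<in> T"
proof -
  have "(\<Union>T\<in>\<T>. {n. y n \<in> T}) = UNIV" using cov by auto
  then have "infinite (\<Union>T\<in>\<T>. {n. y n \<in> T})" using infinite_UNIV_nat by simp
  then obtain T where T: "T \<in> \<T>" "infinite {n. y n \<in> T}" using fin by (meson finite_UN)
  show thesis
  proof (rule that[OF T(1) strict_mono_enumerate[OF T(2)]])
    fix n
    show "y (enumerate {n. y n \<in> T} n) \<in> T" using enumerate_in_set[OF T(2), of n] by simp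
  qed
qed

text \<open>The tangent is chosen as long as possible subject to \<open>p\<close> being constant along it. If \<open>q\<close> were
  constant along it as well, then \<open>q\<close> and \<open>p\<close> would be of the same order along the sequence.\<close>

lemma maximal_frame:
  assumes C: "finite C" and sc: "\<And>n. s n \<in> coord_space C" and s: "s \<longlonglongrightarrow> x" and xc: "x \<in> coord_space C"
    and p: "rat_affine C p" "p x = 0" "\<And>n. 0 < p (s n)"
    and q: "rat_affine C q" "q x = 0"
    and big: "\<And>n. q (s n) > real n * p (s n)"
  shows "\<exists>r k u. strict_mono (r :: nat \<Rightarrow> nat) \<and> frame C k u (\<lambda>n. s (r n) - x) \<and>
    (\<forall>j\<in>{1..k}. p (u j) = p 0) \<and> (\<exists>j\<in>{1..k}. q (u j) \<noteq> q 0)"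
proof -
  let ?P = "\<lambda>k. \<exists>r u. strict_mono (r :: nat \<Rightarrow> nat) \<and> frame C k u (\<lambda>n. s (r n) - x) \<and>
    (\<forall>j\<in>{1..k}. p (u j) = p 0)"
  have "frame C 0 (\<lambda>_. 0) (\<lambda>n. s (id n) - x)" by (simp add: frame_def orthonormal_tuple_def)
  then have "?P 0" using strict_mono_id by fastforce
  moreover have "k \<le> card C" if "?P k" for k
    using that orthonormal_tuple_card[OF C] by (auto simp: frame_def)
  \<comment> \<open>The length of a frame is at most \<open>card C\<close>, so a longest one
    exists.\<close>
  ultimately have "?P (Greatest ?P)" "\<And>k. ?P k \<Longrightarrow> k \<le> Greatest ?P"
    using GreatestI_nat[of ?P 0 "card C"] Greatest_le_nat[of ?P _ "card C"] by blast+
  then obtain k where k: "?P k" "\<And>k'. ?P k' \<Longrightarrow> k' \<le> k" by blast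
  then obtain r u where r: "strict_mono (r :: nat \<Rightarrow> nat)" and f: "frame C k u (\<lambda>n. s (r n) - x)"
    and pu: "\<forall>j\<in>{1..k}. p (u j) = p 0"
    by blast
  obtain m where "\<forall>x y. p y = p x + coord_inner C m (y - x)"
    using rat_affine_slope[OF p(1)] by (elim exE)
  then have m: "p y = coord_inner C m (y - x)" "p v = p 0 + coord_inner C m v" for y v
    using p(2) by (metis add_0 diff_zero)+
  obtain m' where "\<forall>x y. q y = q x + coord_inner C m' (y - x)"
    using rat_affine_slope[OF q(1)] by (elim exE)
  then have m': "q y = coord_inner C m' (y - x)" "q v = q 0 + coord_inner C m' v" for y v
    using q(2) by (metis add_0 diff_zero)+
  have mu: "coord_inner C m (u j) = 0" if "j \<in> {1..k}" for j using pu that m(2)[of "u j"] by simp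
  \<comment> \<open>\<open>p\<close> is constant along \<open>u 1, ..., u k\<close>, so a zero
    residue would give \<open>p (s (r n)) = p x = 0\<close>.\<close>
  have nz: "orth_residue C u k (s (r n) - x) \<noteq> 0" for n
  proof
    assume "orth_residue C u k (s (r n) - x) = 0"
    then have "coord_inner C m (s (r n) - x) = 0"
      using coord_inner_residue[where l = k and C = C and m = m and u = u and v = "s (r n) - x"] mu
      by (simp add: coord_inner_simps)
    then show False using p(3)[of "r n"] m(1) by simp
  qed
  obtain r' w where r': "strict_mono (r' :: nat \<Rightarrow> nat)"
    and f': "frame C (Suc k) (u(Suc k := w)) (\<lambda>n. s (r (r' n)) - x)"
    by (rule frame_extend[OF C f _ nz]) (use sc xc in \<open>auto intro: coord_space_closed\<close>)
  let ?u = "u(Suc k := w)" and ?s = "\<lambda>n. s (r (r' n))"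
  have rr: "strict_mono (\<lambda>n. r (r' n))" using strict_mono_o[OF r r'] by (simp add: o_def)
  \<comment> \<open>By maximality, as otherwise the extended frame would qualify too.\<close>
  have p_w: "p w \<noteq> p 0"
  proof
    assume "p w = p 0"
    then have "\<forall>j\<in>{1..Suc k}. p (?u j) = p 0" using pu by (auto simp: le_Suc_eq)
    then have "?P (Suc k)" using rr f' by blast
    then show False using k(2) by fastforce
  qed
  let ?L = "\<lambda>n. L2_set (orth_residue C ?u k (?s n - x)) C"
  let ?N = "\<lambda>m n. coord_inner C m (coord_normalize C (orth_residue C ?u k (?s n - x)))"
  have factor: "coord_inner C m (?s n - x) = ?L n * ?N m n" "?N m \<longlonglongrightarrow> coord_inner C m w"
    if "\<And>j. j \<in> {1..k} \<Longrightarrow> coord_inner C m (u j) = 0" for m n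
    using frame_factor[OF C f', of "Suc k" m] that by auto
  have L: "0 \<le> ?L n" for n by simp
  have pos: "0 < ?L n" "0 < ?N m n" for n
  proof -
    have "p (?s n) = ?L n * ?N m n" unfolding m(1)[of "?s n"] by (rule factor(1)[OF mu])
    then have "0 < ?L n * ?N m n" using p(3)[of "r (r' n)"] by (simp only:)
    then show "0 < ?L n" "0 < ?N m n" using L[of n] by (auto simp: zero_less_mult_iff)
  qed
  have "0 \<le> coord_inner C m w"
    using pos(2) by (intro LIMSEQ_le_const[OF factor(2)[OF mu]]) (auto intro: less_imp_le)
  then have \<sigma>: "0 < coord_inner C m w" using p_w m(2)[of w] by simp
  have "\<exists>j\<in>{1..k}. q (u j) \<noteq> q 0"
  proof (rule ccontr)
    assume "\<not> ?thesis"
    then have mu': "coord_inner C m' (u j) = 0" if "j \<in> {1..k}" for j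
      using that m'(2)[of "u j"] by simp
    \<comment> \<open>The common residue norm cancels from \<open>q > n * p\<close>. The left side
      is then unbounded, since \<open>?N m n\<close> has a positive limit, while the right side
      converges.\<close>
    have gt: "real n * ?N m n < ?N m' n" for n
    proof -
      have "n \<le> r (r' n)" using rr by (rule strict_mono_imp_increasing)
      then have "real n * p (?s n) \<le> real (r (r' n)) * p (?s n)"
        using p(3) by (intro mult_right_mono) (auto intro: less_imp_le)
      also have "\<dots> < q (?s n)" by (rule big)
      finally have "?L n * (real n * ?N m n) < ?L n * ?N m' n"
        using m(1)[of "?s n"] m'(1)[of "?s n"] factor(1)[OF mu, of n] factor(1)[OF mu', of n]
        by (simp add: mult.left_commute)
      then show ?thesis using pos(1)[of n] by simp
    qed
    let ?\<sigma> = "coord_inner C m w" and ?\<tau> = "coord_inner C m' w"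
    have "eventually (\<lambda>n. ?\<sigma> / 2 < ?N m n) sequentially"
      using \<sigma> by (intro order_tendstoD(1)[OF factor(2)[OF mu]]) auto
    moreover have "eventually (\<lambda>n. ?N m' n < \<bar>?\<tau>\<bar> + 1) sequentially"
      by (intro order_tendstoD(2)[OF factor(2)[OF mu']]) auto
    moreover have "eventually (\<lambda>n. 2 * (\<bar>?\<tau>\<bar> + 1) / ?\<sigma> \<le> real n) sequentially"
      using filterlim_real_sequentially by (simp add: filterlim_at_top)
    ultimately have "eventually (\<lambda>n. False) sequentially"
    proof eventually_elim
      case (elim n)
      have "\<bar>?\<tau>\<bar> + 1 \<le> real n * (?\<sigma> / 2)" using elim(3) \<sigma> by (simp add: pos_divide_le_eq)
      also have "\<dots> \<le> real n * ?N m n" using elim(1) by (intro mult_left_mono) auto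
      also have "\<dots> < ?N m' n" by (rule gt)
      finally show ?case using elim(2) by simp
    qed
    then show False by simp
  qed
  then show ?thesis using r f pu by blast
qed

lemma face_of_zero_set:
  assumes S: "convex S" and l: "rat_affine C l" and nn: "\<And>y. y \<in> S \<Longrightarrow> 0 \<le> l y"
  shows "{y \<in> S. l y = 0} face_of S"
proof -
  obtain b m where bm: "l = (\<lambda>y. b + coord_inner C m y)"
    using l unfolding rat_affine_def by blast
  have comb: "l ((1 - t) *\<^sub>R x + t *\<^sub>R y) = (1 - t) * l x + t * l y" for t x y
    by (simp add: bm coord_inner_simps algebra_simps)
  have "convex {y \<in> S. l y = 0}"
  proof (rule convexI)
    fix x y and u v :: real
    assume *: "x \<in> {y \<in> S. l y = 0}" "y \<in> {y \<in> S. l y = 0}" "0 \<le> u" "0 \<le> v" "u + v = 1"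
    then have u: "u = 1 - v" by simp
    then show "u *\<^sub>R x + v *\<^sub>R y \<in> {y \<in> S. l y = 0}"
      using * comb[of v x y] convexD[OF S, of x y u v] unfolding u by simp
  qed
  moreover have "a \<in> {y \<in> S. l y = 0} \<and> b \<in> {y \<in> S. l y = 0}"
    if ab: "a \<in> S" "b \<in> S" and x: "x \<in> {y \<in> S. l y = 0}" "x \<in> open_segment a b" for a b x
  proof -
    obtain t where t: "0 < t" "t < 1" "x = (1 - t) *\<^sub>R a + t *\<^sub>R b" using x(2) by (auto simp: in_segment)
    have "(1 - t) * l a + t * l b = 0" using x(1) t(3) comb[of t a b] by simp
    moreover have "0 \<le> (1 - t) * l a" "0 \<le> t * l b" using t nn ab by auto
    ultimately have "(1 - t) * l a = 0" "t * l b = 0" by linarith+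
    then show ?thesis using t ab by simp
  qed
  ultimately show ?thesis unfolding face_of_def by blast
qed

lemma not_dominated_imp_outgoing_tangent:
  assumes C: "finite C" and Y: "Y \<subseteq> unit_cube C" "closed Y"
    and a: "set_mv_term a \<subseteq> C" and b: "set_mv_term b \<subseteq> C"
    and zero: "\<And>y. y \<in> Y \<Longrightarrow> mv_eval std_mv y a = 0 \<Longrightarrow> mv_eval std_mv y b = 0"
    and big: "\<And>M::nat. \<exists>y\<in>Y. mv_eval std_mv y b > M * mv_eval std_mv y a"
  shows "\<exists>k u x. tangent C Y k u x \<and> rationally_outgoing C Y k u x"
proof -
  have eval: "clipped_eval a y = mv_eval std_mv y a" "clipped_eval b y = mv_eval std_mv y b" if "y \<in> Y" for y
    using that Y(1) a b by (auto intro!: clipped_eval_cube)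
  have cY: "Y \<subseteq> coord_space C" using Y(1) by (auto simp: unit_cube_def)
  have "\<forall>M::nat. \<exists>y. y \<in> Y \<and> clipped_eval b y > M * clipped_eval a y"
    using big eval by metis
  then obtain y0 where y0: "\<And>M::nat. y0 M \<in> Y" "\<And>M::nat. clipped_eval b (y0 M) > M * clipped_eval a (y0 M)"
    by metis
  obtain S0 where S0: "rational_simplex C S0" "unit_cube C \<subseteq> S0" by (rule cube_in_rational_simplex[OF C])
  obtain \<T> where \<T>: "finite \<T>" "\<And>T. T \<in> \<T> \<Longrightarrow> rational_simplex C T"
    "\<And>T. T \<in> \<T> \<Longrightarrow> \<exists>p q. rat_affine C p \<and> rat_affine C q \<and>
      (\<forall>y\<in>T. clipped_eval a y = p y \<and> clipped_eval b y = q y)" "S0 \<subseteq> \<Union>\<T>"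
    using rat_covered_two_terms[OF C a b S0(1)] unfolding rat_covered_def by blast
  have "y0 n \<in> \<Union>\<T>" for n using y0(1) Y(1) S0(2) \<T>(4) by blast
  then obtain T r0 where T: "T \<in> \<T>" and r0: "strict_mono (r0 :: nat \<Rightarrow> nat)" and r0T: "\<And>n. y0 (r0 n) \<in> T"
    using infinite_subseq_in_cover[OF \<T>(1), of y0] by metis
  obtain p q where p: "rat_affine C p" "\<And>y. y \<in> T \<Longrightarrow> clipped_eval a y = p y"
    and q: "rat_affine C q" "\<And>y. y \<in> T \<Longrightarrow> clipped_eval b y = q y"
    using \<T>(3)[OF T] by blast
  have bd: "\<bar>y0 (r0 n) i\<bar> \<le> 1" if "i \<in> C" for n i
    using y0(1)[of "r0 n"] Y(1) that by (auto simp: unit_cube_def abs_le_iff dest!: subsetD)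
  have yc: "y0 (r0 n) \<in> coord_space C" for n using y0(1) cY by blast
  obtain r1 x where r1: "strict_mono (r1 :: nat \<Rightarrow> nat)" and xc: "x \<in> coord_space C"
    and lim: "((\<lambda>n. y0 (r0 n)) \<circ> r1) \<longlonglongrightarrow> x"
    by (rule bounded_coords_subseq[OF C yc bd])
  define s where "s n = y0 (r0 (r1 n))" for n
  have s: "s \<longlonglongrightarrow> x" using lim by (simp add: s_def[abs_def] o_def)
  have sY: "s n \<in> Y" and sT: "s n \<in> T" for n using y0(1) r0T by (auto simp: s_def)
  have sc: "s n \<in> coord_space C" for n using sY cY by blast
  have xY: "x \<in> Y" using closed_sequentially[OF Y(2)] sY s by blast
  have bnd: "0 \<le> p y" "p y \<le> 1" "0 \<le> q y" "q y \<le> 1" if "y \<in> T" for y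
    using clipped_eval_bounds[of a y] clipped_eval_bounds[of b y] p(2)[OF that] q(2)[OF that] by simp_all
  have qp: "q (s n) > real n * p (s n)" for n
  proof -
    have "n \<le> r0 (r1 n)" using strict_mono_imp_increasing[OF strict_mono_o[OF r0 r1]] by simp
    then have "real n * p (s n) \<le> real (r0 (r1 n)) * p (s n)"
      using bnd(1)[OF sT] by (intro mult_right_mono) auto
    also have "\<dots> < q (s n)" using y0(2)[of "r0 (r1 n)"] p(2)[OF sT] q(2)[OF sT] by (simp add: s_def)
    finally show ?thesis .
  qed
  \<comment> \<open>If \<open>a\<close> vanished at \<open>s n\<close>, so would \<open>b\<close>,
    against \<open>qp\<close>.\<close>
  have ps: "0 < p (s n)" for n
  proof (rule ccontr)
    assume "\<not> ?thesis"
    then have 0: "p (s n) = 0" using bnd(1)[OF sT[of n]] by simp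
    then have "q (s n) = 0" using zero[OF sY[of n]] eval[OF sY[of n]] p(2)[OF sT] q(2)[OF sT] by simp
    then show False using qp[of n] 0 by simp
  qed
  obtain V where V: "rat_vertices C V" and TV: "T = convex hull V"
    using \<T>(2)[OF T] by (auto simp: rational_simplex_iff)
  have "\<exists>W \<beta>. affine_coords C W \<beta> \<and> V \<subseteq> W"
    by (rule affine_coords_extend[OF C]) (use V in \<open>auto simp: rat_vertices_def\<close>)
  then obtain W \<beta> where W: "affine_coords C W \<beta>" and VW: "V \<subseteq> W" by blast
  note finW = affine_coordsD(1)[OF W] and rat = affine_coordsD(3)[OF W]
    and one = affine_coordsD(4)[OF W] and id = affine_coordsD(5)[OF W]
  have finV: "finite V" using VW finW finite_subset by blast
  have T_iff: "y \<in> T \<longleftrightarrow> (\<forall>w\<in>V. 0 \<le> \<beta> w y) \<and> (\<forall>w\<in>W - V. \<beta> w y = 0)" if "y \<in> coord_space C" for y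
    unfolding TV by (rule affine_coords_convex_hull[OF W VW that])
  define \<Phi> where "\<Phi> = \<beta> ` W \<union> (\<lambda>v y. - \<beta> v y) ` (W - V)"
  have fin\<Phi>: "finite \<Phi>" using finW by (simp add: \<Phi>_def)
  have r\<Phi>: "rat_affine C h" if "h \<in> \<Phi>" for h
    using that rat rat_affine_minus[OF rat] by (auto simp: \<Phi>_def)
  have T\<Phi>: "y \<in> T \<longleftrightarrow> (\<forall>h\<in>\<Phi>. 0 \<le> h y)" if "y \<in> coord_space C" for y
  proof -
    have "(\<forall>h\<in>\<Phi>. 0 \<le> h y) \<longleftrightarrow> (\<forall>w\<in>W. 0 \<le> \<beta> w y) \<and> (\<forall>w\<in>W - V. \<beta> w y \<le> 0)"
      unfolding \<Phi>_def ball_Un by auto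
    also have "\<dots> \<longleftrightarrow> (\<forall>w\<in>V. 0 \<le> \<beta> w y) \<and> (\<forall>w\<in>W - V. \<beta> w y = 0)"
      using VW by (auto simp: eq_iff)
    finally show ?thesis using T_iff[OF that] by blast
  qed
  have s\<Phi>: "0 \<le> h (s n)" if "h \<in> \<Phi>" for h n using T\<Phi>[OF sc] sT that by blast
  have xT: "x \<in> T"
    unfolding T\<Phi>[OF xc]
  proof
    fix h assume h: "h \<in> \<Phi>"
    show "0 \<le> h x" by (rule LIMSEQ_le_const[OF tendsto_rat_affine[OF r\<Phi>[OF h] s]]) (use s\<Phi>[OF h] in blast)
  qed
  \<comment> \<open>\<open>n * p (s n)\<close> is below \<open>q (s n)\<close>, which is at most
    1.\<close>
  have px: "p x = 0"
  proof -
    have "real n * p (s n) \<le> 1" for n using qp[of n] bnd(4)[OF sT[of n]] by simp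
    then have "p (s n) \<le> inverse (real n)" if "0 < n" for n
      using that by (simp add: field_simps)
    then have "eventually (\<lambda>n. p (s n) \<le> inverse (real n)) sequentially"
      by (intro eventually_sequentiallyI[of 1]) simp
    then have "p x \<le> 0"
      by (rule tendsto_le[OF sequentially_bot lim_inverse_n tendsto_rat_affine[OF p(1) s]])
    then show ?thesis using bnd(1)[OF xT] by simp
  qed
  have qx: "q x = 0" using zero[OF xY] eval[OF xY] p(2)[OF xT] q(2)[OF xT] px by simp
  obtain r k u where r: "strict_mono (r :: nat \<Rightarrow> nat)" and f: "frame C k u (\<lambda>n. s (r n) - x)"
    and pu: "\<forall>j\<in>{1..k}. p (u j) = p 0" and qu: "\<exists>j\<in>{1..k}. q (u j) \<noteq> q 0"
    using maximal_frame[OF C sc s xc p(1) px ps q(1) qx qp] by blast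
  have sr: "(\<lambda>n. s (r n)) \<longlonglongrightarrow> x" using LIMSEQ_subseq_LIMSEQ[OF s r] by (simp add: o_def)
  obtain m where "\<forall>x y. p y = p x + coord_inner C m (y - x)"
    using rat_affine_slope[OF p(1)] by (elim exE)
  then have m: "p y = coord_inner C m (y - x)" "p v = p 0 + coord_inner C m v" for y v
    using px by (metis add_0 diff_zero)+
  have mu: "coord_inner C m (u j) = 0" if "j \<in> {1..k}" for j using pu that m(2)[of "u j"] by simp
  \<comment> \<open>\<open>p\<close> vanishes on \<open>x\<close> plus the span but is positive at
    \<open>s (r n)\<close>.\<close>
  have "s (r n) - x \<notin> span (u ` {1..k})" for n
  proof
    assume "s (r n) - x \<in> span (u ` {1..k})"
    then have "coord_inner C m (s (r n) - x) = 0"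
    proof (induction rule: span_induct_alt)
      case base
      show ?case by (rule coord_inner_simps)
    next
      case (step c v w)
      then have "coord_inner C m v = 0" using mu by blast
      then show ?case using step by (simp only: coord_inner_simps)
    qed
    then show False using ps[of "r n"] m(1) by simp
  qed
  moreover have k1: "1 \<le> k" using qu by auto
  ultimately have tan: "tangent C Y k u x"
    unfolding tangent_iff_frame[OF C] using xc sY sr f by (intro conjI exI[of _ "\<lambda>n. s (r n)"]) auto
  \<comment> \<open>\<open>p\<close> is nonnegative on \<open>T\<close>, so the hull of its zeros
    among the vertices is its zero set in \<open>T\<close>, again a rational simplex.\<close>
  define V1 where "V1 = {v \<in> V. p v = 0}"
  define S where "S = convex hull V1"
  have S: "rational_simplex C S"
    using rat_vertices_subset[OF V, of V1] by (auto simp: S_def V1_def rational_simplex_iff)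
  have VT: "V \<subseteq> T" unfolding TV by (rule hull_subset)
  have ST: "S \<subseteq> T" unfolding S_def TV V1_def by (intro hull_mono) auto
  have uc: "u j \<in> coord_space C" if "j \<in> {1..k}" for j
    using f that by (auto simp: frame_def orthonormal_tuple_def)
  have pS: "p y = 0" if "y \<in> S" for y
  proof -
    have "0 \<le> - p v" if "v \<in> V1" for v using that by (simp add: V1_def)
    then have "0 \<le> - p y"
      using rat_affine_hull_nonneg[OF rat_affine_minus[OF p(1)], of V1 y] \<open>y \<in> S\<close> by (simp add: S_def)
    then show ?thesis using bnd(1)[of y] ST that by auto
  qed
  have inS: "y \<in> S" if y: "y \<in> T" "p y = 0" for y
  proof -
    have yc: "y \<in> coord_space C" using y(1) V convex_hull_coord_space[of V C] by (auto simp: TV rat_vertices_def)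
    have nn: "\<And>w. w \<in> V \<Longrightarrow> 0 \<le> \<beta> w y" and z: "\<And>w. w \<in> W - V \<Longrightarrow> \<beta> w y = 0"
      using T_iff[OF yc] y(1) by auto
    have "p (\<Sum>w\<in>W. \<beta> w y *\<^sub>R w) = (\<Sum>w\<in>W. \<beta> w y * p w)"
      by (rule rat_affine_affine_comb[OF p(1) one[OF yc]])
    also have "\<dots> = (\<Sum>w\<in>V. \<beta> w y * p w)" by (intro sum.mono_neutral_right finW VW) (simp add: z)
    finally have "(\<Sum>w\<in>V. \<beta> w y * p w) = 0" using y(2) id[OF yc] by simp
    moreover have "0 \<le> \<beta> w y * p w" if "w \<in> V" for w using nn[OF that] bnd(1) VT that by auto
    ultimately have "\<forall>w\<in>V. \<beta> w y * p w = 0" using finV by (subst (asm) sum_nonneg_eq_0_iff) auto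
    then have "\<forall>w\<in>V - V1. \<beta> w y = 0" by (auto simp: V1_def)
    then have "(\<forall>w\<in>V1. 0 \<le> \<beta> w y) \<and> (\<forall>w\<in>W - V1. \<beta> w y = 0)"
      using nn z by (auto simp: V1_def)
    then show ?thesis
      unfolding S_def using affine_coords_convex_hull[OF W _ yc, of V1] VW by (auto simp: V1_def)
  qed
  define F where "F = {y \<in> S. q y = 0}"
  have "F face_of S"
    unfolding F_def by (rule face_of_zero_set[OF _ q(1)]) (use ST bnd(3) in \<open>auto simp: S_def\<close>)
  moreover have "F \<inter> Y = S \<inter> Y"
  proof -
    have "q y = 0" if "y \<in> S" "y \<in> Y" for y
      using zero[OF that(2)] eval[OF that(2)] p(2)[of y] q(2)[of y] pS[OF that(1)] ST that(1) by auto
    then show ?thesis by (auto simp: F_def)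
  qed
  moreover have "\<exists>c. (\<forall>l\<in>{1..k}. 0 < c l) \<and>
      convex hull ((\<lambda>l. x + (\<Sum>j=1..l. c j *\<^sub>R u j)) ` {0..k}) \<subseteq> S \<and>
      \<not> convex hull ((\<lambda>l. x + (\<Sum>j=1..l. c j *\<^sub>R u j)) ` {0..k}) \<subseteq> F"
  proof -
    \<comment> \<open>\<open>q\<close> joins the functions that define \<open>T\<close>, so that a
      zero of \<open>q\<close> at \<open>z j\<close> would force all its slopes up to
      \<open>u j\<close> to vanish.\<close>
    have "lex_nonneg k u x h" if "h \<in> insert q \<Phi>" for h
      using that bnd(3)[OF sT] s\<Phi> by (intro lex_nonneg_of_seq[OF C f sr]) (auto intro: r\<Phi> q(1))
    moreover have "rat_affine C h" if "h \<in> insert q \<Phi>" for h using that r\<Phi> q(1) by auto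
    ultimately obtain c where c: "\<forall>l\<in>{1..k}. 0 < c l"
      and c\<Phi>: "\<forall>h\<in>insert q \<Phi>. \<forall>l\<le>k. 0 \<le> h (x + (\<Sum>j=1..l. c j *\<^sub>R u j)) \<and>
        (h (x + (\<Sum>j=1..l. c j *\<^sub>R u j)) = 0 \<longrightarrow> h x = 0 \<and> (\<forall>j\<in>{1..l}. h (u j) = h 0))"
      using lex_nonneg_small_steps[of "insert q \<Phi>" C k u x] fin\<Phi> by auto
    define z where "z l = x + (\<Sum>j=1..l. c j *\<^sub>R u j)" for l
    have zS: "z l \<in> S" if l: "l \<le> k" for l
    proof (rule inS)
      have "z l \<in> coord_space C"
        unfolding z_def using l by (intro coord_space_closed coord_space_sum xc uc) auto
      then show "z l \<in> T" using T\<Phi>[of "z l"] c\<Phi> l by (auto simp: z_def)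
      show "p (z l) = 0" using l by (simp add: m(1) z_def coord_inner_simps coord_inner_sum mu)
    qed
    obtain j where j: "j \<in> {1..k}" "q (u j) \<noteq> q 0" using qu by blast
    then have "q (z j) \<noteq> 0" using c\<Phi> by (force simp: z_def)
    then have "z j \<notin> F" by (simp add: F_def)
    moreover have "z j \<in> convex hull (z ` {0..k})" using j(1) by (intro hull_inc) auto
    moreover have "convex hull (z ` {0..k}) \<subseteq> S"
      by (intro hull_minimal) (use zS in \<open>auto simp: S_def\<close>)
    ultimately show ?thesis using c unfolding z_def by blast
  qed
  ultimately have "rationally_outgoing C Y k u x"
    unfolding rationally_outgoing_def Let_def using S by blast
  then show ?thesis using tan by blast
qed

section \<open>Definable maps\<close>

lemma unit_cube_compact: "compact (unit_cube I)"
proof -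
  \<comment> \<open>Coordinates outside \<open>I\<close> range over the compact set
    \<open>{0}\<close>, so Tychonoff's theorem applies to the product over all indices.\<close>
  have eq: "unit_cube I = (\<Pi>\<^sub>E i\<in>UNIV. if i \<in> I then {0..1} else {0})"
    by (fastforce simp: unit_cube_def coord_space_def PiE_def Pi_def split: if_splits)
  have "compactin (product_topology (\<lambda>i. euclidean) UNIV) (\<Pi>\<^sub>E i\<in>UNIV. if i \<in> I then {0..1} else {0::real})"
    unfolding compactin_PiE by auto
  then show ?thesis unfolding eq euclidean_product_topology by simp
qed

lemma coord_proj_image_closed:
  assumes X: "closedin (top_of_set (unit_cube I)) X"
  shows "closed (coord_proj C ` X)"
proof -
  have "compact X" using closedin_compact[OF unit_cube_compact X] .
  moreover have "continuous_on X (coord_proj C)"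
    unfolding coord_proj_def
  proof (rule continuous_on_coordinatewise_then_product)
    fix i
    show "continuous_on X (\<lambda>p. if i \<in> C then p i else 0)"
      by (cases "i \<in> C") (simp_all add: continuous_on_subset[OF continuous_on_product_coordinates])
  qed
  ultimately have "compactin euclidean (coord_proj C ` X)"
    by (simp add: compact_continuous_image)
  moreover have "Hausdorff_space (euclidean :: ('a \<Rightarrow> real) topology)"
    unfolding euclidean_product_topology[symmetric] by (simp add: Hausdorff_space_product_topology)
  ultimately show ?thesis using compactin_imp_closedin closed_closedin by blast
qed

lemma coord_proj_unit_cube:
  assumes "p \<in> unit_cube I" "C \<subseteq> I"
  shows "coord_proj C p \<in> unit_cube C"
  using assms by (auto simp: unit_cube_def coord_space_def coord_proj_def)

lemma mv_eval_coord_proj: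
  "set_mv_term t \<subseteq> C \<Longrightarrow> mv_eval B (coord_proj C p) t = mv_eval B p t"
  by (rule mv_eval_cong) (auto simp: coord_proj_def)

section \<open>Term functions on closed sets and the space of homomorphisms\<close>

lemma carrier_mv_definable:
  assumes X: "X \<subseteq> unit_cube I"
  shows "carrier (mv_definable I X) = (\<lambda>t. \<lambda>p\<in>X. mv_eval std_mv p t) ` {t. set_mv_term t \<subseteq> I}"
proof -
  have *: "definable_map I X (mv_term_cong I `` {t}) = (\<lambda>p\<in>X. mv_eval std_mv p t)"
    if t: "set_mv_term t \<subseteq> I" for t
    unfolding definable_map_def
  proof (rule restrict_ext)
    fix p assume "p \<in> X"
    then have "p \<in> I \<rightarrow> carrier std_mv" using X by (auto simp: unit_cube_def std_mv_def)
    then show "free_ext I std_mv p (mv_term_cong I `` {t}) = mv_eval std_mv p t"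
      by (rule free_mv_universal(2)[OF mv_algebra_std_mv _ t])
  qed
  have "carrier (mv_definable I X) = definable_map I X ` carrier (free_mv I)"
    by (simp add: mv_definable_def)
  also have "\<dots> = (\<lambda>t. definable_map I X (mv_term_cong I `` {t})) ` {t. set_mv_term t \<subseteq> I}"
  proof
    show "definable_map I X ` carrier (free_mv I) \<subseteq>
        (\<lambda>t. definable_map I X (mv_term_cong I `` {t})) ` {t. set_mv_term t \<subseteq> I}"
      by (auto elim!: free_mv_cases)
    show "(\<lambda>t. definable_map I X (mv_term_cong I `` {t})) ` {t. set_mv_term t \<subseteq> I} \<subseteq>
        definable_map I X ` carrier (free_mv I)"
      using mv_term_class_closed by blast
  qed
  finally show ?thesis using * by auto
qed

lemma mv_definable_simps:
  "zero (mv_definable I X) = (\<lambda>p\<in>X. 0)"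
  "neg (mv_definable I X) f = (\<lambda>p\<in>X. 1 - f p)"
  "oplus (mv_definable I X) f g = (\<lambda>p\<in>X. min (f p + g p) 1)"
  by (simp_all add: mv_definable_def mv_prod_def std_mv_def)

text \<open>Elements of \<open>A\<close> serve as variables: in \<open>A\<close> each stands for
  itself, in the unit interval for its image under \<open>h\<close>.\<close>

lemma mv_hom_eval:
  assumes A: "mv_algebra A" and h: "h \<in> mv_hom A std_mv"
  shows "set_mv_term t \<subseteq> carrier A \<Longrightarrow> h (mv_eval A (\<lambda>a. a) t) = mv_eval std_mv h t"
proof (induction t)
  case (Oplus s t)
  then have "mv_eval A (\<lambda>a. a) s \<in> carrier A" "mv_eval A (\<lambda>a. a) t \<in> carrier A"
    by (auto intro!: mv_eval_closed[OF A])
  then show ?case using Oplus h by (simp add: mv_hom_def)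
next
  case (Neg s)
  then have "mv_eval A (\<lambda>a. a) s \<in> carrier A" by (auto intro!: mv_eval_closed[OF A])
  then show ?case using Neg h by (simp add: mv_hom_def)
qed (use h in \<open>simp_all add: mv_hom_def\<close>)

lemma mv_hom_cong:
  assumes A: "mv_algebra A" and eq: "\<And>a. a \<in> carrier A \<Longrightarrow> g a = h a" and h: "h \<in> mv_hom A B"
  shows "g \<in> mv_hom A B"
proof -
  interpret mv_algebra A by fact
  show ?thesis using h by (auto simp: mv_hom_def eq oplus_closed zero_closed neg_closed)
qed

text \<open>The closed set for the direction from strong semisimplicity: all homomorphisms into the
  unit interval, a model of the maximal spectrum. Intersecting with the cube fixes the value 0
  outside the carrier, so each homomorphism occurs once.\<close>

definition hom_space :: "'a mv \<Rightarrow> ('a \<Rightarrow> real) set" where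
  "hom_space A = unit_cube (carrier A) \<inter> mv_hom A std_mv"

lemma coord_proj_hom_space:
  assumes A: "mv_algebra A" and h: "h \<in> mv_hom A std_mv"
  shows "coord_proj (carrier A) h \<in> hom_space A"
proof -
  have "coord_proj (carrier A) h \<in> mv_hom A std_mv"
    by (rule mv_hom_cong[OF A _ h]) (simp add: coord_proj_def)
  moreover have "coord_proj (carrier A) h \<in> unit_cube (carrier A)"
    using h by (auto simp: mv_hom_def std_mv_def unit_cube_def coord_space_def coord_proj_def)
  ultimately show ?thesis by (simp add: hom_space_def)
qed

lemma closedin_hom_space: "closedin (top_of_set (unit_cube (carrier A))) (hom_space A)"
proof -
  let ?Z = "{p :: 'a \<Rightarrow> real. p (zero A) = 0}"
  let ?N = "\<Inter>x\<in>carrier A. {p :: 'a \<Rightarrow> real. p (neg A x) = 1 - p x}"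
  let ?O = "\<Inter>x\<in>carrier A. \<Inter>y\<in>carrier A. {p :: 'a \<Rightarrow> real. p (oplus A x y) = min (p x + p y) 1}"
  have "closed (?Z \<inter> ?N \<inter> ?O)"
    by (intro closed_Int closed_INT ballI closed_Collect_eq continuous_intros continuous_on_product_coordinates)
  moreover have "hom_space A = unit_cube (carrier A) \<inter> (?Z \<inter> ?N \<inter> ?O)"
    unfolding hom_space_def
    by (auto simp: mv_hom_def std_mv_def unit_cube_def)
  ultimately show ?thesis by (auto simp: closedin_closed)
qed

text \<open>A term in elements of \<open>A\<close> already has a value in \<open>A\<close>, so the
  definable maps on \<open>hom_space A\<close> are the evaluations \<open>e a\<close> at single
  elements; separation makes \<open>e\<close> injective.\<close>

lemma mv_iso_hom_space:
  assumes A: "mv_algebra A" and sep: "mv_separated A (mv_hom A std_mv)"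
  shows "mv_iso A (mv_definable (carrier A) (hom_space A))" (is "mv_iso A ?M")
proof -
  interpret mv_separated A "mv_hom A std_mv" by fact
  let ?X = "hom_space A"
  have X: "?X \<subseteq> unit_cube (carrier A)" by (simp add: hom_space_def)
  define e where "e a = (\<lambda>p\<in>?X. p a)" for a
  have eval: "(\<lambda>p\<in>?X. mv_eval std_mv p t) = e (mv_eval A (\<lambda>a. a) t)" if "set_mv_term t \<subseteq> carrier A" for t
    unfolding e_def using mv_hom_eval[OF A _ that] by (intro restrict_ext) (simp add: hom_space_def)
  have e_image: "e ` carrier A = carrier ?M"
    unfolding carrier_mv_definable[OF X]
  proof
    show "e ` carrier A \<subseteq> (\<lambda>t. \<lambda>p\<in>?X. mv_eval std_mv p t) ` {t. set_mv_term t \<subseteq> carrier A}"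
    proof
      fix f assume "f \<in> e ` carrier A"
      then obtain a where "a \<in> carrier A" "f = e a" by blast
      then have "f = (\<lambda>p\<in>?X. mv_eval std_mv p (Var a))" "set_mv_term (Var a) \<subseteq> carrier A"
        by (simp_all add: e_def)
      then show "f \<in> (\<lambda>t. \<lambda>p\<in>?X. mv_eval std_mv p t) ` {t. set_mv_term t \<subseteq> carrier A}" by blast
    qed
    show "(\<lambda>t. \<lambda>p\<in>?X. mv_eval std_mv p t) ` {t. set_mv_term t \<subseteq> carrier A} \<subseteq> e ` carrier A"
    proof
      fix f assume "f \<in> (\<lambda>t. \<lambda>p\<in>?X. mv_eval std_mv p t) ` {t. set_mv_term t \<subseteq> carrier A}"
      then obtain t where t: "set_mv_term t \<subseteq> carrier A" "f = (\<lambda>p\<in>?X. mv_eval std_mv p t)" by blast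
      have "mv_eval A (\<lambda>a. a) t \<in> carrier A" using t(1) by (auto intro!: mv_eval_closed[OF A])
      then show "f \<in> e ` carrier A" using eval[OF t(1)] t(2) by simp
    qed
  qed
  have p: "p (zero A) = 0" "\<And>x. x \<in> carrier A \<Longrightarrow> p (neg A x) = 1 - p x"
    "\<And>x y. x \<in> carrier A \<Longrightarrow> y \<in> carrier A \<Longrightarrow> p (oplus A x y) = min (p x + p y) 1" if "p \<in> ?X" for p
    using that by (auto simp: hom_space_def mv_hom_def std_mv_def)
  have "e \<in> mv_hom A ?M"
    unfolding mv_hom_def
  proof (intro CollectI conjI ballI)
    show "e \<in> carrier A \<rightarrow> carrier ?M" using e_image by blast
    show "e (zero A) = zero ?M"
      unfolding mv_definable_simps e_def by (rule restrict_ext) (rule p(1))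
    show "e (neg A x) = neg ?M (e x)" if "x \<in> carrier A" for x
      unfolding mv_definable_simps e_def using p(2)[OF _ that] by (intro restrict_ext) simp
    show "e (oplus A x y) = oplus ?M (e x) (e y)" if "x \<in> carrier A" "y \<in> carrier A" for x y
      unfolding mv_definable_simps e_def using p(3)[OF _ that] by (intro restrict_ext) simp
  qed
  moreover have "inj_on e (carrier A)"
  proof (rule inj_onI)
    fix a b assume c: "a \<in> carrier A" "b \<in> carrier A" and eq: "e a = e b"
    show "a = b"
    proof (rule separated[OF c])
      fix h assume "h \<in> mv_hom A std_mv"
      then have "coord_proj (carrier A) h \<in> ?X" by (rule coord_proj_hom_space[OF A])
      then have "coord_proj (carrier A) h a = coord_proj (carrier A) h b"
        using fun_cong[OF eq, of "coord_proj (carrier A) h"] by (simp add: e_def)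
      then show "h a = h b" using c by (simp add: coord_proj_def)
    qed
  qed
  ultimately show ?thesis using e_image by (auto simp: mv_iso_def bij_betw_def)
qed

text \<open>Homomorphisms commute with terms, so the two terms of
  \<open>outgoing_tangent_imp_not_dominated\<close>, evaluated in \<open>A\<close>, are elements
  that contradict the domination condition.\<close>

lemma hom_space_no_outgoing_tangent:
  assumes A: "mv_algebra A" and ss: "strongly_semisimple_mv A" and C: "C \<subseteq> carrier A" "finite C"
  shows "\<not> (tangent C (coord_proj C ` hom_space A) k u x \<and>
    rationally_outgoing C (coord_proj C ` hom_space A) k u x)"
proof
  let ?Y = "coord_proj C ` hom_space A"
  assume out: "tangent C ?Y k u x \<and> rationally_outgoing C ?Y k u x"
  have sub: "?Y \<subseteq> unit_cube C"
    using coord_proj_unit_cube[OF _ C(1)] by (auto simp: hom_space_def)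
  obtain a b where ab: "set_mv_term a \<subseteq> C" "set_mv_term b \<subseteq> C"
    and zero: "\<forall>y\<in>?Y. mv_eval std_mv y a = 0 \<longrightarrow> mv_eval std_mv y b = 0"
    and big: "\<forall>M::nat. \<exists>y\<in>?Y. mv_eval std_mv y b > M * mv_eval std_mv y a"
    using outgoing_tangent_imp_not_dominated[OF C(2) sub coord_proj_image_closed[OF closedin_hom_space]
        conjunct1[OF out] conjunct2[OF out]]
    by (elim exE conjE)
  have abA: "set_mv_term a \<subseteq> carrier A" "set_mv_term b \<subseteq> carrier A" using ab C(1) by auto
  then have cl: "mv_eval A (\<lambda>a. a) a \<in> carrier A" "mv_eval A (\<lambda>a. a) b \<in> carrier A"
    by (auto intro!: mv_eval_closed[OF A])
  have h_eval: "h (mv_eval A (\<lambda>a. a) t) = mv_eval std_mv (coord_proj C (coord_proj (carrier A) h)) t"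
    if "h \<in> mv_hom A std_mv" "set_mv_term t \<subseteq> C" for h t
    using that C(1) by (simp add: mv_hom_eval[OF A that(1)] mv_eval_coord_proj)
  have "h (mv_eval A (\<lambda>a. a) b) = 0" if h: "h \<in> mv_hom A std_mv" "h (mv_eval A (\<lambda>a. a) a) = 0" for h
    using zero coord_proj_hom_space[OF A h(1)] h(2) h_eval[OF h(1) ab(1)] h_eval[OF h(1) ab(2)] by auto
  then obtain m :: nat where m: "\<forall>h\<in>mv_hom A std_mv. h (mv_eval A (\<lambda>a. a) b) \<le> m * h (mv_eval A (\<lambda>a. a) a)"
    using strongly_semisimple_homs(2)[OF A ss cl] by blast
  obtain p where p: "p \<in> hom_space A"
    "mv_eval std_mv (coord_proj C p) b > m * mv_eval std_mv (coord_proj C p) a"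
    using big by blast
  then have "p \<in> mv_hom A std_mv" by (simp add: hom_space_def)
  then have "p (mv_eval A (\<lambda>a. a) b) > m * p (mv_eval A (\<lambda>a. a) a)"
    using p(2) by (simp add: mv_hom_eval[OF A] abA mv_eval_coord_proj ab)
  then show False using m \<open>p \<in> mv_hom A std_mv\<close> by force
qed

lemma strongly_semisimple_definable:
  assumes A: "mv_algebra A" and X: "closedin (top_of_set (unit_cube (carrier A))) X"
    and iso: "mv_iso A (mv_definable (carrier A) X)"
    and no: "\<And>C k u x. C \<subseteq> carrier A \<Longrightarrow> finite C \<Longrightarrow>
      \<not> (tangent C (coord_proj C ` X) k u x \<and> rationally_outgoing C (coord_proj C ` X) k u x)"
  shows "strongly_semisimple_mv A"
proof -
  interpret mv_algebra A by fact
  let ?M = "mv_definable (carrier A) X"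
  have Xs: "X \<subseteq> unit_cube (carrier A)" using closedin_subset[OF X] by simp
  obtain e where e: "e \<in> mv_hom A ?M" and bij: "bij_betw e (carrier A) (carrier ?M)"
    using iso by (auto simp: mv_iso_def)
  have e_term: "\<exists>t. set_mv_term t \<subseteq> carrier A \<and> e a = (\<lambda>p\<in>X. mv_eval std_mv p t)" if "a \<in> carrier A" for a
    using e that carrier_mv_definable[OF Xs] by (fastforce simp: mv_hom_def)
  define H where "H = (\<lambda>p a. e a p) ` X"
  have "mv_separated A H"
  proof unfold_locales
    show "H \<subseteq> mv_hom A std_mv"
    proof
      fix h assume "h \<in> H"
      then obtain p where p: "p \<in> X" "h = (\<lambda>a. e a p)" by (auto simp: H_def)
      have "h a \<in> carrier std_mv" if "a \<in> carrier A" for a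
      proof -
        from e_term[OF that] obtain t
          where t: "set_mv_term t \<subseteq> carrier A" "e a = (\<lambda>p\<in>X. mv_eval std_mv p t)" by blast
        have "mv_eval std_mv p t \<in> carrier std_mv"
          using t(1) p(1) Xs by (intro mv_eval_closed[OF mv_algebra_std_mv]) (auto simp: unit_cube_def std_mv_def)
        then show ?thesis using t(2) p by simp
      qed
      then show "h \<in> mv_hom A std_mv"
        using e p by (auto simp: mv_hom_def mv_definable_simps std_mv_eval_simps)
    qed
    fix a b assume c: "a \<in> carrier A" "b \<in> carrier A" and eq: "\<And>h. h \<in> H \<Longrightarrow> h a = h b"
    have "e a p = e b p" if "p \<in> X" for p using eq that by (auto simp: H_def)
    moreover have "e a \<in> extensional X" "e b \<in> extensional X"
      using e_term[OF c(1)] e_term[OF c(2)] by auto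
    ultimately have "e a = e b" by (intro extensionalityI)
    then show "a = b" using bij c by (auto simp: bij_betw_def inj_on_def)
  qed
  then interpret mv_separated A H .
  show ?thesis
  proof (rule strongly_semisimpleI)
    fix a b assume c: "a \<in> carrier A" "b \<in> carrier A" and zero: "\<And>h. h \<in> H \<Longrightarrow> h a = 0 \<Longrightarrow> h b = 0"
    obtain s where s: "set_mv_term s \<subseteq> carrier A" "e a = (\<lambda>p\<in>X. mv_eval std_mv p s)"
      using e_term[OF c(1)] by blast
    obtain t where t: "set_mv_term t \<subseteq> carrier A" "e b = (\<lambda>p\<in>X. mv_eval std_mv p t)"
      using e_term[OF c(2)] by blast
    \<comment> \<open>Finitely many variables occur in the two terms, and \<open>e a\<close> and
      \<open>e b\<close> depend on these coordinates alone.\<close>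
    define C where "C = set_mv_term s \<union> set_mv_term t"
    have C: "C \<subseteq> carrier A" "finite C" using s t by (auto simp: C_def)
    let ?Y = "coord_proj C ` X"
    have ev: "mv_eval std_mv (coord_proj C p) s = e a p" "mv_eval std_mv (coord_proj C p) t = e b p"
      if "p \<in> X" for p
      using that s(2) t(2) by (simp_all add: mv_eval_coord_proj C_def)
    show "\<exists>m::nat. \<forall>h\<in>H. h b \<le> m * h a"
    proof (rule ccontr)
      assume none: "\<not> ?thesis"
      have "\<exists>k u x. tangent C ?Y k u x \<and> rationally_outgoing C ?Y k u x"
      proof (rule not_dominated_imp_outgoing_tangent[OF C(2)])
        show "?Y \<subseteq> unit_cube C" using coord_proj_unit_cube[OF _ C(1)] Xs by blast
        show "closed ?Y" by (rule coord_proj_image_closed[OF X])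
        show "set_mv_term s \<subseteq> C" "set_mv_term t \<subseteq> C" by (auto simp: C_def)
        show "mv_eval std_mv y t = 0" if y: "y \<in> ?Y" "mv_eval std_mv y s = 0" for y
        proof -
          obtain p where p: "p \<in> X" "y = coord_proj C p" using y(1) by blast
          then have "(\<lambda>a. e a p) \<in> H" by (simp add: H_def)
          from zero[OF this] show ?thesis using y(2) ev[OF p(1)] p(2) by simp
        qed
        show "\<exists>y\<in>?Y. mv_eval std_mv y t > M * mv_eval std_mv y s" for M :: nat
        proof -
          obtain h where h: "h \<in> H" "\<not> h b \<le> real M * h a" using none by blast
          then obtain p where p: "p \<in> X" "h = (\<lambda>a. e a p)" by (auto simp: H_def)
          then have "mv_eval std_mv (coord_proj C p) t > M * mv_eval std_mv (coord_proj C p) s"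
            using h(2) ev[OF p(1)] by simp
          then show ?thesis using p(1) by blast
        qed
      qed
      then show False using no[OF C] by blast
    qed
  qed
qed

theorem corollary4p9:
  fixes A :: "'a mv"
  assumes "mv_algebra A"
  shows "strongly_semisimple_mv A \<longleftrightarrow>
    (\<exists>X. closedin (top_of_set (unit_cube (carrier A))) X \<and>
         mv_iso A (mv_definable (carrier A) X) \<and>
         (\<forall>C. C \<subseteq> carrier A \<and> finite C \<longrightarrow>
            \<not> (\<exists>k u x. tangent C (coord_proj C ` X) k u x \<and>
                       rationally_outgoing C (coord_proj C ` X) k u x)))"
proof (rule iffI, goal_cases)
  case ss: 1
  show ?case
  proof (intro exI[of _ "hom_space A"] conjI allI impI notI)
    show "closedin (top_of_set (unit_cube (carrier A))) (hom_space A)" by (rule closedin_hom_space)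
    show "mv_iso A (mv_definable (carrier A) (hom_space A))"
      by (rule mv_iso_hom_space[OF assms strongly_semisimple_homs(1)[OF assms ss]])
    fix C
    assume "C \<subseteq> carrier A \<and> finite C"
      and "\<exists>k u x. tangent C (coord_proj C ` hom_space A) k u x \<and>
        rationally_outgoing C (coord_proj C ` hom_space A) k u x"
    then show False using hom_space_no_outgoing_tangent[OF assms ss] by blast
  qed
next
  case 2
  then obtain X where X: "closedin (top_of_set (unit_cube (carrier A))) X"
    and iso: "mv_iso A (mv_definable (carrier A) X)"
    and no: "\<forall>C. C \<subseteq> carrier A \<and> finite C \<longrightarrow>
      \<not> (\<exists>k u x. tangent C (coord_proj C ` X) k u x \<and> rationally_outgoing C (coord_proj C ` X) k u x)"
    by (elim exE conjE)
  show ?case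
    by (rule strongly_semisimple_definable[OF assms X iso]) (use no in blast)
qed

end
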